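(* Let $T=(N,E)$ be a directed tree with root $0\in N$ and set of leaves $L$. Let $P=\{\ell_1,\ell_2,\ldots\}\subseteq N\setminus\{0\}$ with $(0,\ell_1),(\ell_1,\ell_2),\ldots\in E$ be a path of nodes that starts with a child of the root and either terminates at a leaf or has infinitely many nodes, and let $k^*$ be a child of the root with $k^*\notin P$ whenever $\deg(0)\geq2$. Let $F=(F_n)_{n\in N}$, $G=(G_n)_{n\in N}$ be families of univariate distribution functions and $B=(B_e)_{e\in E}$, $C=(C_e)_{e\in E}$ families of bivariate copulas. Let $X=(X_n)_{n\in N}\sim\mathcal M(F,T,B)$ and $Y=(Y_n)_{n\in N}\sim\mathcal M(G,T,C)$ be such that for all $(i,j)\in E$: - $X_j\uparrow_{st}X_i$ if $j\ne k^*$; - $Y_i\uparrow_{st}Y_j$ if $j\notin L$, and $Y_j\uparrow_{st}Y_i$ if $j\notin P$. Assume moreover that $\overline{\mathrm{Ran}(F_n)}=\overline{\mathrm{Ran}(G_n)}$ for all $n\in N$. Then: (i) If $B_e\leq_{lo}C_e$ for all $e\in E$ and $F_n\leq_{st}G_n$ for all $n\in N$, then $X\leq_{ism}Y$. (ii) If $B_e\leq_{lo}C_e$ for all $e\in E$ and $F_n\geq_{st}G_n$ for all $n\in N$, then $X\leq_{dsm}Y$.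
   Context: Trees. $N=\{0,1,\dots,d\}$ with $d\in\mathbb N$, or $N=\mathbb N_0$. A (directed) tree $T=(N,E)$ with root $0$ has oriented edges $E\subset N\times N$ such that for every $i\in N\setminus\{0\}$ there is a unique directed path from $0$ to $i$. $\deg(i)$ is the (possibly infinite) number of $j$ with $(i,j)\in E$ or $(j,i)\in E$; $L=\{k\in N\setminus\{0\}:\deg(k)=1\}$. If $(i,j)\in E$, then $j$ is a child of $i$. Between any two nodes there is a unique undirected path; the path between $i$ and $j$ is the set of nodes strictly between them. Markov tree distributions. A node $i$ separates disjoint $A,B\subset N$ if for all $a\in A$, $b\in B$ the path between $a$ and $b$ contains $i$. $(X_n)_{n\in N}$ follows a Markov tree distribution with respect to $T$ if for all finite disjoint $A,B\subset N$ and every $i$ separating $A$ and $B$, $(X_j)_{j\in A}$ and $(X_j)_{j\in B}$ are conditionally independent given $X_i$. $X\sim\mathcal M(F,T,B)$ means that $X$ has the (unique) Markov tree distribution with respect to $T$ such that $X_n$ has distribution function $F_n$ for all $n$ and $B_e$ is a copula of $(X_i,X_j)$ for all $e=(i,j)\in E$, i.e. $P(X_i\le x,X_j\le y)=B_e(F_i(x),F_j(y))$. Notation. "Increasing" means non-decreasing. $V\uparrow_{st}U$ means that $\mathbb E[f(V)\mid U=u]$ is increasing in $u$ outside a $P^U$-null set, for all increasing $f:\mathbb R\to\mathbb R$ such that the expectations exist. $\mathrm{Ran}(F)$ is the range of $F$ and $\overline A$ the closure of $A\subseteq[0,1]$. $B_e\leq_{lo}C_e$ means $B_e(u,v)\le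 C_e(u,v)$ for all $(u,v)\in[0,1]^2$. $F_n\leq_{st}G_n$ is the usual stochastic order of the corresponding distributions ($\int f\,dF_n\le\int f\,dG_n$ for all increasing $f$ for which the integrals exist, i.e. $F_n(x)\ge G_n(x)$ for all $x$). Integral orders. $f:\mathbb R^m\to\mathbb R$ is supermodular if $f(x)+f(y)\le f(x\wedge y)+f(x\vee y)$ for all $x,y$; it is increasing (decreasing) supermodular if it is also componentwise increasing (decreasing). A measurable weight function $b:\mathbb R^m\to[1,\infty)$ is fixed (e.g. $b(x)=\max\{1,\|x\|^p\}$); random vectors are assumed $b$-integrable, and test functions are measurable and $b$-bounded ($\sup_x|f(x)|/b(x)<\infty$). $V\leq_{ism}W$ (resp. $V\leq_{dsm}W$) means $\mathbb Ef(V)\le\mathbb Ef(W)$ for all $b$-bounded increasing (resp. decreasing) supermodular $f$; for infinite sequences it means that all finite-dimensional subvectors are so ordered. *)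

theory Defs
  imports "HOL-Probability.Probability" "HOL-Library.Extended_Nat"
begin

subsection \<open>Trees\<close>

(* A directed path may a priori revisit nodes; uniqueness of directed paths from the root then
   excludes loops, directed cycles and edges into the root. *)
definition directed_path :: "(nat \<times> nat) set \<Rightarrow> nat \<Rightarrow> nat list \<Rightarrow> nat \<Rightarrow> bool" where
  "directed_path E i p j \<longleftrightarrow>
     p \<noteq> [] \<and> hd p = i \<and> last p = j \<and> successively (\<lambda>u v. (u, v) \<in> E) p"

definition rooted_tree :: "nat set \<Rightarrow> (nat \<times> nat) set \<Rightarrow> bool" where
  "rooted_tree N E \<longleftrightarrow>
     ((\<exists>d\<ge>1. N = {0..d}) \<or> N = UNIV) \<and> E \<subseteq> N \<times> N \<and>
     (\<forall>i\<in>N - {0}. \<exists>!p. directed_path E 0 p i)"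

definition neighbours :: "(nat \<times> nat) set \<Rightarrow> nat \<Rightarrow> nat set" where
  "neighbours E i = {j. (i, j) \<in> E \<or> (j, i) \<in> E}"

definition node_degree :: "(nat \<times> nat) set \<Rightarrow> nat \<Rightarrow> enat" where
  "node_degree E i = (if finite (neighbours E i) then enat (card (neighbours E i)) else \<infinity>)"

definition leaves :: "nat set \<Rightarrow> (nat \<times> nat) set \<Rightarrow> nat set" where
  "leaves N E = {k \<in> N - {0}. node_degree E k = 1}"

definition undirected_path :: "(nat \<times> nat) set \<Rightarrow> nat \<Rightarrow> nat list \<Rightarrow> nat \<Rightarrow> bool" where
  "undirected_path E i p j \<longleftrightarrow>
     p \<noteq> [] \<and> hd p = i \<and> last p = j \<and> distinct p \<and> successively (\<lambda>u v. v \<in> neighbours E u) p"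

(* In a tree, the undirected path between two nodes of N is unique, so the union below is over a
   single path. *)
definition path_between :: "(nat \<times> nat) set \<Rightarrow> nat \<Rightarrow> nat \<Rightarrow> nat set" where
  "path_between E i j = (\<Union>p\<in>{p. undirected_path E i p j}. set p - {i, j})"

definition separates :: "(nat \<times> nat) set \<Rightarrow> nat \<Rightarrow> nat set \<Rightarrow> nat set \<Rightarrow> bool" where
  "separates E i A B \<longleftrightarrow> (\<forall>a\<in>A. \<forall>b\<in>B. i \<in> path_between E a b)"

(* P = {l 1, l 2, ...}, where l 0 is the root *)
definition path_from_root :: "nat set \<Rightarrow> (nat \<times> nat) set \<Rightarrow> nat set \<Rightarrow> bool" where
  "path_from_root N E P \<longleftrightarrow> P \<subseteq> N - {0} \<and>
     (\<exists>l :: nat \<Rightarrow> nat. l 0 = 0 \<and>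
       ((\<exists>n\<ge>1. (\<forall>k<n. (l k, l (Suc k)) \<in> E) \<and> l n \<in> leaves N E \<and> P = l ` {1..n}) \<or>
        ((\<forall>k. (l k, l (Suc k)) \<in> E) \<and> infinite P \<and> P = l ` {1..})))"

subsection \<open>Distribution functions and copulas\<close>

definition distribution_function :: "(real \<Rightarrow> real) \<Rightarrow> bool" where
  "distribution_function F \<longleftrightarrow>
     mono F \<and> (\<forall>x. continuous (at_right x) F) \<and> (F \<longlongrightarrow> 0) at_bot \<and> (F \<longlongrightarrow> 1) at_top"

(* Copulas are functions on the unit square; values elsewhere are irrelevant. *)
definition copula :: "(real \<Rightarrow> real \<Rightarrow> real) \<Rightarrow> bool" where
  "copula C \<longleftrightarrow>
     (\<forall>u\<in>{0..1}. C u 0 = 0 \<and> C 0 u = 0 \<and> C u 1 = u \<and> C 1 u = u) \<and>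
     (\<forall>u1\<in>{0..1}. \<forall>u2\<in>{0..1}. \<forall>v1\<in>{0..1}. \<forall>v2\<in>{0..1}. u1 \<le> u2 \<longrightarrow> v1 \<le> v2 \<longrightarrow>
        C u2 v2 - C u2 v1 - C u1 v2 + C u1 v1 \<ge> 0)"

definition lo_le :: "(real \<Rightarrow> real \<Rightarrow> real) \<Rightarrow> (real \<Rightarrow> real \<Rightarrow> real) \<Rightarrow> bool" where
  "lo_le B C \<longleftrightarrow> (\<forall>u\<in>{0..1}. \<forall>v\<in>{0..1}. B u v \<le> C u v)"

definition st_le :: "(real \<Rightarrow> real) \<Rightarrow> (real \<Rightarrow> real) \<Rightarrow> bool" where
  "st_le F G \<longleftrightarrow> (\<forall>f :: real \<Rightarrow> real. mono f \<longrightarrow>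
     integrable (interval_measure F) f \<longrightarrow> integrable (interval_measure G) f \<longrightarrow>
     integral\<^sup>L (interval_measure F) f \<le> integral\<^sup>L (interval_measure G) f)"

subsection \<open>Conditioning\<close>

(* the sub-sigma-algebra of M generated by U *)
definition generated :: "'a measure \<Rightarrow> ('a \<Rightarrow> real) \<Rightarrow> 'a measure" where
  "generated M U = vimage_algebra (space M) U borel"

definition cond_indep_given ::
    "'a measure \<Rightarrow> ('a \<Rightarrow> real) \<Rightarrow> 'b measure \<Rightarrow> ('a \<Rightarrow> 'b) \<Rightarrow> 'c measure \<Rightarrow> ('a \<Rightarrow> 'c) \<Rightarrow> bool" where
  "cond_indep_given M U S V T W \<longleftrightarrow> (\<forall>A\<in>sets S. \<forall>B\<in>sets T. AE \<omega> in M.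
     real_cond_exp M (generated M U) (\<lambda>\<omega>. indicator A (V \<omega>) * indicator B (W \<omega>)) \<omega> =
     real_cond_exp M (generated M U) (\<lambda>\<omega>. indicator A (V \<omega>)) \<omega> *
     real_cond_exp M (generated M U) (\<lambda>\<omega>. indicator B (W \<omega>)) \<omega>)"

(* V is stochastically increasing in U; g is a version of u |-> E[f(V) | U = u] *)
definition st_increasing_in :: "'a measure \<Rightarrow> ('a \<Rightarrow> real) \<Rightarrow> ('a \<Rightarrow> real) \<Rightarrow> bool" where
  "st_increasing_in M V U \<longleftrightarrow>
     (\<forall>f :: real \<Rightarrow> real. mono f \<longrightarrow> integrable M (\<lambda>\<omega>. f (V \<omega>)) \<longrightarrow>
       (\<exists>g\<in>borel_measurable borel.
          (AE \<omega> in M. g (U \<omega>) = real_cond_exp M (generated M U) (\<lambda>\<omega>. f (V \<omega>)) \<omega>) \<and>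
          (\<exists>Z\<in>null_sets (distr M borel U). mono_on (- Z) g)))"

subsection \<open>Markov tree distributions\<close>

definition subvector :: "nat set \<Rightarrow> (nat \<Rightarrow> 'a \<Rightarrow> real) \<Rightarrow> 'a \<Rightarrow> nat \<Rightarrow> real" where
  "subvector J X \<omega> = (\<lambda>j\<in>J. X j \<omega>)"

abbreviation borel_vec :: "nat set \<Rightarrow> (nat \<Rightarrow> real) measure" where
  "borel_vec J \<equiv> (\<Pi>\<^sub>M j\<in>J. borel)"

definition markov_tree ::
    "'a measure \<Rightarrow> (nat \<Rightarrow> 'a \<Rightarrow> real) \<Rightarrow> nat set \<Rightarrow> (nat \<times> nat) set \<Rightarrow> bool" where
  "markov_tree M X N E \<longleftrightarrow>
     (\<forall>A B i. A \<subseteq> N \<and> B \<subseteq> N \<and> finite A \<and> finite B \<and> A \<inter> B = {} \<and> i \<in> N \<and> separates E i A B \<longrightarrow>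
        cond_indep_given M (X i) (borel_vec A) (subvector A X) (borel_vec B) (subvector B X))"

definition markov_tree_distributed ::
    "'a measure \<Rightarrow> (nat \<Rightarrow> 'a \<Rightarrow> real) \<Rightarrow> (nat \<Rightarrow> real \<Rightarrow> real) \<Rightarrow> nat set \<Rightarrow> (nat \<times> nat) set \<Rightarrow>
     (nat \<times> nat \<Rightarrow> real \<Rightarrow> real \<Rightarrow> real) \<Rightarrow> bool" where
  "markov_tree_distributed M X F N E B \<longleftrightarrow>
     prob_space M \<and> (\<forall>n\<in>N. X n \<in> borel_measurable M) \<and> markov_tree M X N E \<and>
     (\<forall>n\<in>N. cdf (distr M borel (X n)) = F n) \<and>
     (\<forall>(i, j)\<in>E. \<forall>x y.
        measure M {\<omega> \<in> space M. X i \<omega> \<le> x \<and> X j \<omega> \<le> y} = B (i, j) (F i x) (F j y))"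

subsection \<open>Integral orders\<close>

(* The space R^J is space (borel_vec J), i.e. the functions that are undefined outside J. On it,
   \<le>, inf and sup of the function type are the componentwise order, minimum and maximum. *)
definition supermodular :: "nat set \<Rightarrow> ((nat \<Rightarrow> real) \<Rightarrow> real) \<Rightarrow> bool" where
  "supermodular J f \<longleftrightarrow> (\<forall>x\<in>space (borel_vec J). \<forall>y\<in>space (borel_vec J).
     f x + f y \<le> f (inf x y) + f (sup x y))"

definition weight_function :: "nat set \<Rightarrow> ((nat \<Rightarrow> real) \<Rightarrow> real) \<Rightarrow> bool" where
  "weight_function J b \<longleftrightarrow> b \<in> borel_measurable (borel_vec J) \<and> (\<forall>x\<in>space (borel_vec J). 1 \<le> b x)"

definition weight_bounded ::
    "nat set \<Rightarrow> ((nat \<Rightarrow> real) \<Rightarrow> real) \<Rightarrow> ((nat \<Rightarrow> real) \<Rightarrow> real) \<Rightarrow> bool" where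
  "weight_bounded J b f \<longleftrightarrow> (\<exists>c. \<forall>x\<in>space (borel_vec J). \<bar>f x\<bar> / b x \<le> c)"

(* V and W are random vectors with values in R^J *)
definition ism_le_vec ::
    "nat set \<Rightarrow> ((nat \<Rightarrow> real) \<Rightarrow> real) \<Rightarrow>
     'a measure \<Rightarrow> ('a \<Rightarrow> nat \<Rightarrow> real) \<Rightarrow> 'b measure \<Rightarrow> ('b \<Rightarrow> nat \<Rightarrow> real) \<Rightarrow> bool" where
  "ism_le_vec J b M V M' W \<longleftrightarrow>
     (\<forall>f\<in>borel_measurable (borel_vec J).
        weight_bounded J b f \<and> supermodular J f \<and> mono_on (space (borel_vec J)) f \<longrightarrow>
        (\<integral>\<omega>. f (V \<omega>) \<partial>M) \<le> (\<integral>\<omega>. f (W \<omega>) \<partial>M'))"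

definition dsm_le_vec ::
    "nat set \<Rightarrow> ((nat \<Rightarrow> real) \<Rightarrow> real) \<Rightarrow>
     'a measure \<Rightarrow> ('a \<Rightarrow> nat \<Rightarrow> real) \<Rightarrow> 'b measure \<Rightarrow> ('b \<Rightarrow> nat \<Rightarrow> real) \<Rightarrow> bool" where
  "dsm_le_vec J b M V M' W \<longleftrightarrow>
     (\<forall>f\<in>borel_measurable (borel_vec J).
        weight_bounded J b f \<and> supermodular J f \<and> antimono_on (space (borel_vec J)) f \<longrightarrow>
        (\<integral>\<omega>. f (V \<omega>) \<partial>M) \<le> (\<integral>\<omega>. f (W \<omega>) \<partial>M'))"

(* The subvectors that are compared: the vector itself if it is finite, and all finite-dimensional
   subvectors of an infinite sequence. *)
definition compared_index_sets :: "nat set \<Rightarrow> nat set set" where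
  "compared_index_sets N = (if finite N then {N} else {J. finite J \<and> J \<subseteq> N})"

(* b J is the weight function on R^J *)
definition weight_integrable ::
    "(nat set \<Rightarrow> (nat \<Rightarrow> real) \<Rightarrow> real) \<Rightarrow> nat set \<Rightarrow> 'a measure \<Rightarrow> (nat \<Rightarrow> 'a \<Rightarrow> real) \<Rightarrow> bool" where
  "weight_integrable b N M X \<longleftrightarrow>
     (\<forall>J\<in>compared_index_sets N. integrable M (\<lambda>\<omega>. b J (subvector J X \<omega>)))"

definition ism_le ::
    "(nat set \<Rightarrow> (nat \<Rightarrow> real) \<Rightarrow> real) \<Rightarrow> nat set \<Rightarrow>
     'a measure \<Rightarrow> (nat \<Rightarrow> 'a \<Rightarrow> real) \<Rightarrow> 'b measure \<Rightarrow> (nat \<Rightarrow> 'b \<Rightarrow> real) \<Rightarrow> bool" where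
  "ism_le b N M X M' Y \<longleftrightarrow>
     (\<forall>J\<in>compared_index_sets N. ism_le_vec J (b J) M (subvector J X) M' (subvector J Y))"

definition dsm_le ::
    "(nat set \<Rightarrow> (nat \<Rightarrow> real) \<Rightarrow> real) \<Rightarrow> nat set \<Rightarrow>
     'a measure \<Rightarrow> (nat \<Rightarrow> 'a \<Rightarrow> real) \<Rightarrow> 'b measure \<Rightarrow> (nat \<Rightarrow> 'b \<Rightarrow> real) \<Rightarrow> bool" where
  "dsm_le b N M X M' Y \<longleftrightarrow>
     (\<forall>J\<in>compared_index_sets N. dsm_le_vec J (b J) M (subvector J X) M' (subvector J Y))"

end

theory Submission
  imports Defs
begin

text \<open>
  Applying the distribution functions to the coordinates turns \<open>X\<close> and \<open>Y\<close> into processes \<open>U\<close> and \<open>V\<close>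
  in \<open>[0, 1]\<close>. As the ranges of \<open>F\<^sub>n\<close> and \<open>G\<^sub>n\<close> have the same closure, \<open>U\<^sub>n\<close> and \<open>V\<^sub>n\<close> have the same
  law, so that only the dependence is left to compare; the stochastic order of the marginals is an
  inequality between quantile functions.

  A child that is stochastically increasing in its parent is obtained from it by a randomised
  update that is increasing in the parent. Averaging over such an update preserves supermodularity.
  Starting from \<open>U\<close>, the edges are exchanged for those of \<open>V\<close> one after the other: \<open>(0, k\<^sup>*)\<close> is first,
  parents precede children, and an edge of \<open>P\<close> is exchanged only after everything that is not below
  it. If \<open>(i, j)\<close> is next, the later nodes are averaged out with the kernels of \<open>U\<close>, and the vector
  of nodes treated before is stochastically increasing in \<open>V\<^sub>i\<close>: along the way from \<open>i\<close> to the root one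
  uses that parents increase in their children, elsewhere that children outside \<open>P\<close> increase in their
  parents. Hence the exchange reduces to the pointwise order of the two copulas.
\<close>

subsection \<open>Trees\<close>

text \<open>The order of the exchange is dictated by what is not assumed. Along
  \<open>(0, k)\<close> the child of \<open>X\<close> may fail to increase in its parent, so no
  monotone kernel is available for this edge; it becomes the base case, where a bare comparison of
  pairs suffices. Along \<open>P\<close> the child of \<open>Y\<close> may fail to increase in its
  parent, so monotone dependence on \<open>V i\<close> can pass \<open>P\<close> only upwards; this
  works once all nodes of \<open>P\<close> still present are \<open>i\<close> or above
  \<open>i\<close>. Upward steps start at nodes that have a child, which the exception for leaves
  permits.

  Atoms shape the treatment of the copulas: a copula is tied to its pair only on the ranges of the
  marginals. Equality of the transformed laws lets both copulas of an edge be evaluated at the same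
  point, and rays, open or closed, serve as test events.

  Supermodularity handles the dependence. Monotonicity of the test function is spent on the
  marginals and on the passage from bounded to integrable functions, where cutting off values has to
  preserve supermodularity and clipping has to be dominated.\<close>

definition uconnected :: "(nat \<times> nat) set \<Rightarrow> nat set \<Rightarrow> bool" where
  "uconnected E S \<longleftrightarrow> (\<forall>s\<in>S. \<forall>t\<in>S. \<exists>p. undirected_path E s p t \<and> set p \<subseteq> S)"

lemma neighbours_sym: "a \<in> neighbours E b \<longleftrightarrow> b \<in> neighbours E a"
  by (auto simp: neighbours_def)

lemma undirected_path_rev: "undirected_path E s p t \<Longrightarrow> undirected_path E t (rev p) s"
  by (auto simp: undirected_path_def hd_rev last_rev neighbours_sym)

lemma undirected_path_Cons:
  assumes "undirected_path E b p t" "a \<notin> set p" "a \<in> neighbours E b"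
  shows "undirected_path E a (a # p) t"
  using assms by (cases p) (auto simp: undirected_path_def neighbours_sym)

lemma uconnected_singleton: "uconnected E {i}"
  unfolding uconnected_def undirected_path_def by (auto intro!: exI[of _ "[i]"])

lemma uconnected_insert:
  assumes "uconnected E S" "b \<in> S" "a \<notin> S" "a \<in> neighbours E b"
  shows "uconnected E (insert a S)"
proof -
  have to: "\<exists>p. undirected_path E a p t \<and> set p \<subseteq> insert a S" if t: "t \<in> S" for t
  proof -
    obtain p where p: "undirected_path E b p t" "set p \<subseteq> S"
      using assms t unfolding uconnected_def by meson
    then have "undirected_path E a (a # p) t"
      using assms by (intro undirected_path_Cons) auto
    then show ?thesis using p by (intro exI[of _ "a # p"]) auto
  qed
  have "\<exists>p. undirected_path E t p a \<and> set p \<subseteq> insert a S" if "t \<in> S" for t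
    using to[OF that] undirected_path_rev by (metis set_rev)
  moreover have "\<exists>p. undirected_path E a p a \<and> set p \<subseteq> insert a S"
    by (intro exI[of _ "[a]"]) (auto simp: undirected_path_def)
  ultimately show ?thesis
    using assms(1) to unfolding uconnected_def by (metis insert_iff subset_insertI2)
qed

text \<open>\<open>path_between\<close> is a union over paths, so exhibiting one path through
  \<open>b\<close> suffices: a path from \<open>b\<close> to \<open>s\<close> inside
  \<open>S\<close>, prolonged by the edge between \<open>b\<close> and \<open>a\<close>, stays
  simple because \<open>a\<close> lies outside \<open>S\<close>.\<close>

lemma uconnected_separates:
  assumes "uconnected E S" "b \<in> S" "a \<notin> S" "a \<in> neighbours E b"
  shows "separates E b (S - {b}) {a}"
  unfolding separates_def
proof safe
  fix s assume s: "s \<in> S" "s \<noteq> b"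
  obtain p where p: "undirected_path E b p s" "set p \<subseteq> S"
    using assms s unfolding uconnected_def by meson
  then have "undirected_path E a (a # p) s"
    using assms by (intro undirected_path_Cons) auto
  then have "undirected_path E s (rev (a # p)) a"
    by (rule undirected_path_rev)
  moreover have "b \<in> set (rev (a # p)) - {s, a}"
    using p s assms by (auto simp: undirected_path_def)
  ultimately show "b \<in> path_between E s a"
    unfolding path_between_def by blast
qed

lemma ex_maximal:
  fixes f :: "'b \<Rightarrow> nat"
  assumes "finite S" "S \<noteq> {}"
  obtains m where "m \<in> S" "\<And>n. n \<in> S \<Longrightarrow> f n \<le> f m"
proof -
  have "Max (f ` S) \<in> f ` S" using assms by (intro Max_in) auto
  then obtain m where "m \<in> S" "f m = Max (f ` S)" by auto
  then show ?thesis using that assms by (simp add: Max_ge)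
qed

text \<open>Connected sets are built node by node so that the Markov property is applied to one edge
  at a time. \<open>Q b a\<close> will say that the process at \<open>a\<close> increases
  stochastically in the process at \<open>b\<close>; the edge between them may have either
  orientation.\<close>

inductive grown :: "(nat \<times> nat) set \<Rightarrow> (nat \<Rightarrow> nat \<Rightarrow> bool) \<Rightarrow> nat \<Rightarrow> nat set \<Rightarrow> bool"
  for E Q i where
  single: "grown E Q i {i}"
| attach: "grown E Q i S \<Longrightarrow> b \<in> S \<Longrightarrow> a \<notin> S \<Longrightarrow> a \<in> neighbours E b \<Longrightarrow> Q b a \<Longrightarrow>
    grown E Q i (insert a S)"

lemma grown_uconnected: "grown E Q i S \<Longrightarrow> uconnected E S"
  by (induction rule: grown.induct) (auto intro: uconnected_singleton uconnected_insert)

section \<open>Directed paths, depth and ancestors in a rooted tree\<close>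

locale tree =
  fixes N :: "nat set" and E :: "(nat \<times> nat) set"
  assumes rooted: "rooted_tree N E"
begin

lemma edge_nodes: "(i, j) \<in> E \<Longrightarrow> i \<in> N" "(i, j) \<in> E \<Longrightarrow> j \<in> N"
  using rooted by (auto simp: rooted_tree_def)

lemma nodes_0_1: "0 \<in> N" "1 \<in> N"
  using rooted by (auto simp: rooted_tree_def)

lemma ex1_path: "j \<in> N \<Longrightarrow> j \<noteq> 0 \<Longrightarrow> \<exists>!p. directed_path E 0 p j"
  using rooted by (auto simp: rooted_tree_def)

lemma ex_path: "j \<in> N \<Longrightarrow> \<exists>p. directed_path E 0 p j"
proof (cases "j = 0")
  case True
  then show ?thesis by (intro exI[of _ "[0]"]) (simp add: directed_path_def)
next
  case False
  assume "j \<in> N"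
  with False show ?thesis using ex1_path[of j] by blast
qed

lemma directed_path_append:
  "directed_path E i p j \<Longrightarrow> (j, k) \<in> E \<Longrightarrow> directed_path E k q l \<Longrightarrow> directed_path E i (p @ q) l"
  by (auto simp: directed_path_def successively_append_iff)

lemma directed_path_snoc:
  "directed_path E i p j \<Longrightarrow> (j, k) \<in> E \<Longrightarrow> directed_path E i (p @ [k]) k"
  by (rule directed_path_append) (auto simp: directed_path_def)

text \<open>Uniqueness is postulated only for paths to nodes other than \<open>0\<close>. A directed
  cycle through the root is therefore detected at node \<open>1\<close>: put in front of the path to
  \<open>1\<close>, it would give a second such path.\<close>

lemma root_no_parent: "(i, 0) \<notin> E"
proof
  assume e: "(i, 0) \<in> E"
  obtain q where q: "directed_path E 0 q i" using ex_path edge_nodes e by blast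
  obtain p where p: "directed_path E 0 p 1" using ex_path nodes_0_1 by blast
  have "directed_path E 0 (q @ p) 1" using q e p by (rule directed_path_append)
  then have "q @ p = p" using p ex1_path nodes_0_1 by (metis One_nat_def nat.distinct(1))
  then show False using q by (simp add: directed_path_def)
qed

lemma parent_unique: "(i, j) \<in> E \<Longrightarrow> (k, j) \<in> E \<Longrightarrow> i = k"
proof -
  assume e: "(i, j) \<in> E" "(k, j) \<in> E"
  obtain p q where p: "directed_path E 0 p i" and q: "directed_path E 0 q k"
    using ex_path edge_nodes e by metis
  have "j \<noteq> 0" "j \<in> N" using e root_no_parent edge_nodes by metis+
  then have "p @ [j] = q @ [j]"
    using ex1_path[of j] directed_path_snoc[OF p e(1)] directed_path_snoc[OF q e(2)] by blast
  then show ?thesis using p q by (auto simp: directed_path_def)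
qed

text \<open>The root is treated apart because uniqueness of the directed path is postulated for the
  other nodes only.\<close>

definition depth :: "nat \<Rightarrow> nat" where
  "depth j = (if j = 0 then 0 else length (THE p. directed_path E 0 p j) - 1)"

lemma depth_child: "(i, j) \<in> E \<Longrightarrow> depth j = Suc (depth i)"
proof -
  assume e: "(i, j) \<in> E"
  then have j: "j \<noteq> 0" "j \<in> N" "i \<in> N" using root_no_parent edge_nodes by metis+
  have len: "depth j = length p - 1" if "directed_path E 0 p j" "j \<noteq> 0" "j \<in> N" for p j
    using that the1_equality[OF ex1_path[of j]] by (auto simp: depth_def)
  show ?thesis
  proof (cases "i = 0")
    case True
    have "directed_path E 0 [0, j] j" using e True by (simp add: directed_path_def)
    then show ?thesis using len j True by (fastforce simp: depth_def)
  next
    case False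
    then obtain p where p: "directed_path E 0 p i" using ex_path j by blast
    have "depth j = length (p @ [j]) - 1"
      using len j directed_path_snoc[OF p e] by blast
    moreover have "depth i = length p - 1" using len p False j by blast
    moreover have "length p > 0" using p by (simp add: directed_path_def)
    ultimately show ?thesis by simp
  qed
qed

lemma depth_mono: "(i, j) \<in> E\<^sup>* \<Longrightarrow> depth i \<le> depth j"
  by (induction rule: rtrancl_induct) (auto simp: depth_child)

lemma depth_eq: "(i, j) \<in> E\<^sup>* \<Longrightarrow> depth j \<le> depth i \<Longrightarrow> i = j"
  by (induction rule: rtrancl_induct) (auto simp: depth_child dest: depth_mono)

lemma anc_nodes: "(i, j) \<in> E\<^sup>* \<Longrightarrow> j \<in> N \<Longrightarrow> i \<in> N"
  by (induction rule: converse_rtrancl_induct) (auto dest: edge_nodes)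

lemma root_anc: "j \<in> N \<Longrightarrow> (0, j) \<in> E\<^sup>*"
proof -
  have "(hd p, last p) \<in> E\<^sup>*" if "p \<noteq> []" "successively (\<lambda>u v. (u, v) \<in> E) p" for p
    using that
  proof (induction p)
    case (Cons a p)
    then show ?case by (cases p) (auto intro: converse_rtrancl_into_rtrancl)
  qed simp
  note path = this
  assume "j \<in> N"
  then obtain p where "directed_path E 0 p j" using ex_path by blast
  then show "(0, j) \<in> E\<^sup>*" using path[of p] by (simp add: directed_path_def)
qed

lemma ex_parent: "j \<in> N \<Longrightarrow> j \<noteq> 0 \<Longrightarrow> \<exists>i. (i, j) \<in> E"
  using root_anc[of j] by (auto elim: rtranclE)

lemma anc_parent: "(a, j) \<in> E\<^sup>* \<Longrightarrow> a \<noteq> j \<Longrightarrow> (i, j) \<in> E \<Longrightarrow> (a, i) \<in> E\<^sup>*"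
  by (metis parent_unique rtranclE)

lemma anc_comparable: "(a, i) \<in> E\<^sup>* \<Longrightarrow> (b, i) \<in> E\<^sup>* \<Longrightarrow> (a, b) \<in> E\<^sup>* \<or> (b, a) \<in> E\<^sup>*"
proof (induction arbitrary: b rule: rtrancl_induct)
  case (step y z)
  then show ?case by (metis anc_parent rtrancl.rtrancl_into_rtrancl)
qed simp

lemma finite_anc: "j \<in> N \<Longrightarrow> finite {a. (a, j) \<in> E\<^sup>*}"
proof -
  assume "j \<in> N"
  then have "(0, j) \<in> E\<^sup>*" by (rule root_anc)
  then show ?thesis
  proof (induction rule: rtrancl_induct)
    case base
    have "{a. (a, 0) \<in> E\<^sup>*} = {0}" using root_no_parent by (auto elim: rtranclE)
    then show ?case by simp
  next
    case (step y z)
    have "{a. (a, z) \<in> E\<^sup>*} \<subseteq> insert z {a. (a, y) \<in> E\<^sup>*}" using anc_parent step(2) by auto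
    then show ?case using step.IH finite_subset by blast
  qed
qed

section \<open>Sets closed under parents and their growth from a node\<close>

definition parent_closed :: "nat set \<Rightarrow> bool" where
  "parent_closed S \<longleftrightarrow> S \<subseteq> N \<and> (\<forall>(i, j)\<in>E. j \<in> S \<longrightarrow> i \<in> S)"

lemma parent_closed_anc: "parent_closed S \<Longrightarrow> (a, j) \<in> E\<^sup>* \<Longrightarrow> j \<in> S \<Longrightarrow> a \<in> S"
proof -
  assume "parent_closed S" and "(a, j) \<in> E\<^sup>*" "j \<in> S"
  from this(2,3) show "a \<in> S"
    by (induction rule: converse_rtrancl_induct) (use \<open>parent_closed S\<close> in \<open>unfold parent_closed_def, blast+\<close>)
qed

text \<open>Degrees may be infinite, but each node has only finitely many ancestors, so adding all
  ancestors keeps a finite set finite.\<close>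

lemma finite_parent_closed_hull:
  assumes "finite J" "J \<subseteq> N"
  obtains T where "finite T" "J \<subseteq> T" "parent_closed T"
proof
  let ?T = "\<Union>j\<in>J. {a. (a, j) \<in> E\<^sup>*}"
  show "finite ?T" using assms finite_anc by auto
  show "J \<subseteq> ?T" by auto
  show "parent_closed ?T"
    using assms anc_nodes unfolding parent_closed_def
    by (auto intro: converse_rtrancl_into_rtrancl)
qed

lemma grown_ancestors:
  assumes "(a, i) \<in> E\<^sup>*" and "\<And>c d. (c, d) \<in> E \<Longrightarrow> (d, i) \<in> E\<^sup>* \<Longrightarrow> Q d c"
  shows "grown E Q i {c. (a, c) \<in> E\<^sup>* \<and> (c, i) \<in> E\<^sup>*}"
  using assms(1)
proof (induction rule: converse_rtrancl_induct)
  case base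
  have "{c. (i, c) \<in> E\<^sup>* \<and> (c, i) \<in> E\<^sup>*} = {i}" using depth_eq depth_mono by auto
  then show ?case using grown.single by simp
next
  case (step a b)
  have eq: "{c. (a, c) \<in> E\<^sup>* \<and> (c, i) \<in> E\<^sup>*} = insert a {c. (b, c) \<in> E\<^sup>* \<and> (c, i) \<in> E\<^sup>*}"
    (is "?A = insert a ?B")
  proof (intro equalityI subsetI)
    fix c assume c: "c \<in> ?A"
    then consider "(b, c) \<in> E\<^sup>*" | "(c, b) \<in> E\<^sup>*" "c \<noteq> b" using anc_comparable step by blast
    then show "c \<in> insert a ?B"
    proof cases
      case 2
      then have "(c, a) \<in> E\<^sup>*" using anc_parent step by blast
      then have "c = a" using c depth_eq depth_mono by auto
      then show ?thesis by simp
    qed (use c in auto)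
  next
    fix c assume "c \<in> insert a ?B"
    then show "c \<in> ?A" using step by (auto intro: converse_rtrancl_into_rtrancl)
  qed
  have "a \<notin> ?B" using depth_mono depth_child[OF step(1)] by (fastforce dest: depth_mono)
  then show ?case
    unfolding eq using step assms(2) by (intro grown.attach[where b = b]) (auto simp: neighbours_def)
qed

text \<open>The set grows from \<open>i\<close> up to the root and then by the remaining nodes in
  order of depth, so that each of them finds its parent present. Hence the edges ending in
  \<open>i\<close> or in an ancestor of \<open>i\<close> are crossed upwards and all others
  downwards, which is the division between \<open>up\<close> and \<open>down\<close>.\<close>

lemma grown_parent_closed:
  assumes "finite T" "parent_closed T" "i \<in> T"
    and up: "\<And>c d. (c, d) \<in> E \<Longrightarrow> (d, i) \<in> E\<^sup>* \<Longrightarrow> Q d c"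
    and down: "\<And>c d. (c, d) \<in> E \<Longrightarrow> d \<in> T \<Longrightarrow> (d, i) \<notin> E\<^sup>* \<Longrightarrow> Q c d"
  shows "grown E Q i T"
proof -
  let ?A = "{c. (c, i) \<in> E\<^sup>*}"
  have i: "i \<in> N" using assms by (auto simp: parent_closed_def)
  have A0: "{c. (0, c) \<in> E\<^sup>* \<and> (c, i) \<in> E\<^sup>*} = ?A" using root_anc anc_nodes i by auto
  have A: "grown E Q i ?A"
    using grown_ancestors[where Q = Q, OF root_anc[OF i]] up unfolding A0 by blast
  have "S \<subseteq> T \<Longrightarrow> parent_closed S \<Longrightarrow> grown E Q i (?A \<union> S)" if "finite S" for S
    using that
  proof (induction S rule: finite_ranking_induct[where f = depth])
    case empty
    then show ?case using A by simp
  next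
    \<comment> \<open>\<open>x\<close> has maximal depth, hence no child in the set; leaving it out
      keeps the set closed under parents.\<close>
    case (insert x S)
    show ?case
    proof (cases "x \<in> ?A \<union> S")
      case True
      have "parent_closed S \<or> x \<in> S"
        using insert(2,5) unfolding parent_closed_def by (fastforce simp: depth_child)
      then have "grown E Q i (?A \<union> S)" using insert by (auto simp: insert_absorb)
      then show ?thesis using True by (metis Un_insert_right insert_absorb)
    next
      case False
      have pc: "parent_closed S"
        using insert(2,5) unfolding parent_closed_def by (fastforce simp: depth_child)
      have "x \<noteq> 0" using False root_anc[OF i] by (cases "x = 0") auto
      moreover have "x \<in> N" using insert(5) by (auto simp: parent_closed_def)
      ultimately obtain p where p: "(p, x) \<in> E" using ex_parent by blast
      have "p \<noteq> x" using depth_child[OF p] by auto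
      then have "p \<in> S" using insert(5) p by (auto simp: parent_closed_def)
      then have "grown E Q i (insert x (?A \<union> S))"
        using insert pc p down[OF p] False
        by (intro grown.attach[where b = p]) (auto simp: neighbours_def)
      then show ?thesis by simp
    qed
  qed
  then have "grown E Q i (?A \<union> T)" using assms by simp
  moreover have "?A \<subseteq> T" using parent_closed_anc assms by auto
  ultimately show ?thesis by (simp add: Un_absorb1)
qed

lemma parent_closed_uconnected: "finite T \<Longrightarrow> parent_closed T \<Longrightarrow> i \<in> T \<Longrightarrow> uconnected E T"
  using grown_uconnected[OF grown_parent_closed[where Q = "\<lambda>_ _. True"]] by blast

section \<open>Leaves, the distinguished path and the choice of the next edge\<close>

lemma inner_not_leaf: "(b, c) \<in> E \<Longrightarrow> b \<notin> leaves N E"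
proof
  assume e: "(b, c) \<in> E" and "b \<in> leaves N E"
  then have b: "b \<in> N" "b \<noteq> 0" "node_degree E b = 1" by (auto simp: leaves_def)
  obtain a where a: "(a, b) \<in> E" using ex_parent b by blast
  have "a \<noteq> c" using depth_child[OF a] depth_child[OF e] by auto
  have "finite (neighbours E b)" "card (neighbours E b) = 1"
    using b by (auto simp: node_degree_def one_enat_def split: if_splits)
  moreover have "{a, c} \<subseteq> neighbours E b" using a e by (auto simp: neighbours_def)
  ultimately show False using card_mono[of "neighbours E b" "{a, c}"] \<open>a \<noteq> c\<close> by simp
qed

lemma path_comparable:
  assumes "path_from_root N E P" "p \<in> P" "q \<in> P"
  shows "(p, q) \<in> E\<^sup>* \<or> (q, p) \<in> E\<^sup>*"
proof -
  have anc: "(l x, l y) \<in> E\<^sup>*" if "x \<le> y" "\<And>k. k < y \<Longrightarrow> (l k, l (Suc k)) \<in> E" for l :: "nat \<Rightarrow> nat" and x y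
    using that by (induction y rule: dec_induct) (auto intro: rtrancl.rtrancl_into_rtrancl)
  from assms(1) obtain l where l: "(\<exists>n\<ge>1. (\<forall>k<n. (l k, l (Suc k)) \<in> E) \<and> P = l ` {1..n}) \<or>
      ((\<forall>k. (l k, l (Suc k)) \<in> E) \<and> P = l ` {1..})"
    unfolding path_from_root_def by blast
  then obtain x y where "p = l x" "q = l y" "\<forall>k. k < x \<or> k < y \<longrightarrow> (l k, l (Suc k)) \<in> E"
    using assms(2,3) by (elim disjE exE conjE) fastforce+
  then show ?thesis using anc[of x y l] anc[of y x l] by (meson le_cases)
qed

text \<open>Serves the case of a root with a single child, in which \<open>k\<close> may lie on
  \<open>P\<close>: if \<open>k\<close> is then the deepest node of \<open>P\<close> in a subtree,
  the rest of the subtree is still below it.\<close>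

lemma only_child_anc:
  assumes "(0, k) \<in> E" "\<not> node_degree E 0 \<ge> 2" "n \<in> N" "n \<noteq> 0"
  shows "(k, n) \<in> E\<^sup>*"
proof -
  have fin: "finite (neighbours E 0)" "card (neighbours E 0) \<le> 1"
    using assms(2) by (auto simp: node_degree_def numeral_eq_enat split: if_splits)
  obtain c where c: "(0, c) \<in> E" "(c, n) \<in> E\<^sup>*"
    using root_anc[OF assms(3)] assms(4) by (auto elim: converse_rtranclE)
  have "{k, c} \<subseteq> neighbours E 0" using assms c by (auto simp: neighbours_def)
  then have "k = c" using fin card_mono[OF fin(1), of "{k, c}"] by (cases "k = c") auto
  then show ?thesis using c by simp
qed

text \<open>The removed node is a deepest one, other than \<open>0\<close> and \<open>k\<close>,
  below the last node \<open>m\<close> of \<open>P\<close> in \<open>S\<close> (the root, if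
  \<open>P\<close> misses \<open>S\<close>). Every node of \<open>P\<close> in \<open>S\<close> is
  \<open>m\<close> or an ancestor of \<open>m\<close>, so what remains of \<open>P\<close> lies at
  or above the parent \<open>i\<close>; maximal depth makes \<open>j\<close> childless in
  \<open>S\<close>.\<close>

lemma removable_node:
  assumes S: "finite S" "parent_closed S" "0 \<in> S" "S \<noteq> {0, k}" "k \<in> S"
    and k: "(0, k) \<in> E" "node_degree E 0 \<ge> 2 \<Longrightarrow> k \<notin> P"
    and P: "path_from_root N E P"
  obtains i j where "(i, j) \<in> E" "j \<in> S" "j \<noteq> 0" "j \<noteq> k" "parent_closed (S - {j})"
    "i \<in> S" "i \<noteq> j" "\<And>p. p \<in> P \<Longrightarrow> p \<in> S - {j} \<Longrightarrow> (p, i) \<in> E\<^sup>*"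
proof -
  have SN: "S \<subseteq> N" using S by (auto simp: parent_closed_def)
  have PN: "P \<subseteq> N - {0}" using P by (auto simp: path_from_root_def)
  obtain m where m: "m \<in> insert 0 (P \<inter> S)" "\<And>p. p \<in> insert 0 (P \<inter> S) \<Longrightarrow> depth p \<le> depth m"
  proof (rule ex_maximal[of "insert 0 (P \<inter> S)" depth])
    show "finite (insert 0 (P \<inter> S))" using S by simp
  qed (use that in auto)
  have pm: "(p, m) \<in> E\<^sup>*" if "p \<in> P \<inter> S" for p
  proof (cases "m = 0")
    case True
    then have "depth p \<le> depth 0" using m that by auto
    then have "0 = p" using root_anc depth_eq that SN by blast
    then show ?thesis using that PN by auto
  next
    case False
    then have "m \<in> P" using m by auto
    then have "(p, m) \<in> E\<^sup>* \<or> (m, p) \<in> E\<^sup>*" using path_comparable[OF P] that by auto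
    then show ?thesis using depth_eq m(2) that by blast
  qed
  define Q where "Q = {n \<in> S - {0, k}. (m, n) \<in> E\<^sup>*}"
  have "Q \<noteq> {}"
  proof (cases "m = 0")
    case True
    then have "Q = S - {0, k}" using root_anc SN by (auto simp: Q_def)
    then show ?thesis using S by auto
  next
    case False
    then have mP: "m \<in> P" "m \<in> S" using m by auto
    show ?thesis
    proof (cases "m = k")
      case True
      then have "\<not> node_degree E 0 \<ge> 2" using k mP by auto
      then have "Q = S - {0, k}"
        using only_child_anc k SN True unfolding Q_def by blast
      then show ?thesis using S by auto
    next
      case km: False
      then show ?thesis using mP False by (auto simp: Q_def)
    qed
  qed
  have fin: "finite Q" using S by (simp add: Q_def)
  obtain j where j: "j \<in> Q" "\<And>n. n \<in> Q \<Longrightarrow> depth n \<le> depth j"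
    by (rule ex_maximal[OF fin \<open>Q \<noteq> {}\<close>, of depth]) (use that in auto)
  have j': "j \<in> S" "j \<noteq> 0" "j \<noteq> k" "(m, j) \<in> E\<^sup>*" using j by (auto simp: Q_def)
  then obtain i where i: "(i, j) \<in> E" using ex_parent SN by blast
  have leaf: "c \<notin> S" if "(j, c) \<in> E" for c
  proof
    assume "c \<in> S"
    moreover have "c \<noteq> 0" using that root_no_parent by metis
    moreover have "c \<noteq> k" using that k(1) parent_unique j' by metis
    moreover have "(m, c) \<in> E\<^sup>*" using j' that by auto
    ultimately have "c \<in> Q" by (simp add: Q_def)
    then show False using j(2)[of c] depth_child[OF that] by simp
  qed
  show ?thesis
  proof
    show "(i, j) \<in> E" "j \<in> S" "j \<noteq> 0" "j \<noteq> k" by fact+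
    show "parent_closed (S - {j})" using S(2) leaf unfolding parent_closed_def by auto
    show "i \<in> S" using S(2) i j' unfolding parent_closed_def by auto
    show "i \<noteq> j" using depth_child[OF i] by auto
    fix p assume p: "p \<in> P" "p \<in> S - {j}"
    then have "(p, j) \<in> E\<^sup>*" using pm j' by (meson DiffD1 IntI rtrancl_trans)
    then show "(p, i) \<in> E\<^sup>*" using anc_parent i p by blast
  qed
qed

end

subsection \<open>Conditional expectation and the Markov property\<close>

text \<open>Up to the final truncation all test functions belong to this class, so that
  integrability is automatic on every probability space that occurs, including products with the
  uniform law.\<close>

definition bdd_borel :: "'a measure \<Rightarrow> ('a \<Rightarrow> real) \<Rightarrow> bool" where
  "bdd_borel M f \<longleftrightarrow> f \<in> borel_measurable M \<and> (\<exists>c. \<forall>x\<in>space M. \<bar>f x\<bar> \<le> c)"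

lemma bdd_borelI:
  "f \<in> borel_measurable M \<Longrightarrow> (\<And>x. x \<in> space M \<Longrightarrow> \<bar>f x\<bar> \<le> c) \<Longrightarrow> bdd_borel M f"
  unfolding bdd_borel_def by blast

lemma bdd_borel_measurable: "bdd_borel M f \<Longrightarrow> f \<in> borel_measurable M"
  unfolding bdd_borel_def by blast

lemma bdd_borel_compose:
  "g \<in> measurable M K \<Longrightarrow> bdd_borel K f \<Longrightarrow> bdd_borel M (\<lambda>x. f (g x))"
  unfolding bdd_borel_def by (auto dest: measurable_space)

lemma bdd_borel_mult:
  assumes "bdd_borel M f" "bdd_borel M g"
  shows "bdd_borel M (\<lambda>x. f x * g x)"
proof -
  obtain c d where "\<And>x. x \<in> space M \<Longrightarrow> \<bar>f x\<bar> \<le> c" "\<And>x. x \<in> space M \<Longrightarrow> \<bar>g x\<bar> \<le> d"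
    using assms unfolding bdd_borel_def by blast
  then have "\<bar>f x * g x\<bar> \<le> c * d" if "x \<in> space M" for x
    unfolding abs_mult using that by (intro mult_mono) (auto intro: order_trans[OF abs_ge_zero])
  then show ?thesis
    by (rule bdd_borelI[rotated]) (use assms in \<open>auto simp: bdd_borel_def\<close>)
qed

lemma bdd_borel_add:
  assumes "bdd_borel M f" "bdd_borel M g"
  shows "bdd_borel M (\<lambda>x. f x + g x)"
proof -
  obtain c d where "\<And>x. x \<in> space M \<Longrightarrow> \<bar>f x\<bar> \<le> c" "\<And>x. x \<in> space M \<Longrightarrow> \<bar>g x\<bar> \<le> d"
    using assms unfolding bdd_borel_def by blast
  then have "\<bar>f x + g x\<bar> \<le> c + d" if "x \<in> space M" for x
    using that by (smt (verit))
  then show ?thesis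
    by (rule bdd_borelI[rotated]) (use assms in \<open>auto simp: bdd_borel_def\<close>)
qed

lemma bdd_borel_const: "bdd_borel M (\<lambda>x. c)"
  by (rule bdd_borelI[where c = "\<bar>c\<bar>"]) auto

lemma bdd_borel_minus: "bdd_borel M f \<Longrightarrow> bdd_borel M (\<lambda>x. - f x)"
  unfolding bdd_borel_def by auto

lemma bdd_borel_diff:
  "bdd_borel M f \<Longrightarrow> bdd_borel M g \<Longrightarrow> bdd_borel M (\<lambda>x. f x - g x)"
  using bdd_borel_add[of M f "\<lambda>x. - g x"] bdd_borel_minus[of M g] by simp

lemma bdd_borel_indicator: "A \<in> sets M \<Longrightarrow> bdd_borel M (indicator A)"
  by (rule bdd_borelI[where c = 1]) (auto simp: indicator_def)

lemma (in finite_measure) bdd_borel_integrable: "bdd_borel M f \<Longrightarrow> integrable M f"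
  unfolding bdd_borel_def by (auto intro!: integrable_const_bound AE_I2)

lemma (in finite_measure) integrable_mult_bdd_borel:
  assumes "bdd_borel M f" "integrable M g"
  shows "integrable M (\<lambda>x. f x * g x)"
proof -
  obtain c where c: "\<And>x. x \<in> space M \<Longrightarrow> \<bar>f x\<bar> \<le> c"
    using assms unfolding bdd_borel_def by blast
  show ?thesis
  proof (rule Bochner_Integration.integrable_bound)
    show "integrable M (\<lambda>x. c * g x)" using assms by simp
    show "(\<lambda>x. f x * g x) \<in> borel_measurable M"
      using assms(2) bdd_borel_measurable[OF assms(1)] by (intro borel_measurable_times) auto
    have "\<bar>f x * g x\<bar> \<le> \<bar>c * g x\<bar>" if "x \<in> space M" for x
      using c[OF that] unfolding abs_mult by (intro mult_right_mono) auto
    then show "AE x in M. norm (f x * g x) \<le> norm (c * g x)" by auto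
  qed
qed

section \<open>Conditioning on a real random variable\<close>

lemma space_generated: "space (generated M U) = space M"
  by (simp add: generated_def)

lemma generated_measurable: "U \<in> borel_measurable (generated M U)"
  unfolding generated_def by (rule measurable_vimage_algebra1) auto

lemma generated_measurable_compose:
  "f \<in> borel_measurable borel \<Longrightarrow> (\<lambda>x. f (U x)) \<in> borel_measurable (generated M U)"
  using measurable_compose[OF generated_measurable] by blast

lemma sets_generated: "sets (generated M U) = {U -` A \<inter> space M |A. A \<in> sets borel}"
  by (simp add: generated_def sets_vimage_algebra2)

context prob_space
begin

lemma generated_subalgebra: "U \<in> borel_measurable M \<Longrightarrow> subalgebra M (generated M U)"
  unfolding subalgebra_def by (auto simp: sets_generated space_generated)

lemma generated_finite_subalgebra:
  "U \<in> borel_measurable M \<Longrightarrow> finite_measure_subalgebra M (generated M U)"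
  using generated_subalgebra by unfold_locales

lemma generated_sigma_finite:
  assumes "U \<in> borel_measurable M"
  shows "sigma_finite_subalgebra M (generated M U)"
proof -
  interpret finite_measure_subalgebra M "generated M U"
    using assms by (rule generated_finite_subalgebra)
  show ?thesis by unfold_locales
qed

lemma cond_exp_generated_integral:
  assumes "U \<in> borel_measurable M" "bdd_borel borel f" "integrable M Z"
  shows "(LINT x|M. f (U x) * real_cond_exp M (generated M U) Z x) = (LINT x|M. f (U x) * Z x)"
proof (rule sigma_finite_subalgebra.real_cond_exp_intg(2)[OF generated_sigma_finite[OF assms(1)]])
  show "integrable M (\<lambda>x. f (U x) * Z x)"
    by (rule integrable_mult_bdd_borel[OF bdd_borel_compose[OF assms(1,2)] assms(3)])
  show "(\<lambda>x. f (U x)) \<in> borel_measurable (generated M U)"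
    by (rule generated_measurable_compose[OF bdd_borel_measurable[OF assms(2)]])
  show "Z \<in> borel_measurable M" using assms(3) by auto
qed

text \<open>Every event of the generated sigma-algebra is a preimage under \<open>U\<close>, so the
  defining identity has to be tested only on the functions \<open>indicator A (U x)\<close>.\<close>

lemma cond_exp_generated_unique:
  assumes "U \<in> borel_measurable M" "integrable M Z" "k \<in> borel_measurable borel"
    and "integrable M (\<lambda>x. k (U x))"
    and eq: "\<And>A. A \<in> sets borel \<Longrightarrow>
      (LINT x|M. indicator A (U x) * Z x) = (LINT x|M. indicator A (U x) * k (U x))"
  shows "AE x in M. real_cond_exp M (generated M U) Z x = k (U x)"
proof (rule sigma_finite_subalgebra.real_cond_exp_charact)
  show "sigma_finite_subalgebra M (generated M U)" using assms by (intro generated_sigma_finite)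
  show "integrable M Z" "integrable M (\<lambda>x. k (U x))" by fact+
  show "(\<lambda>x. k (U x)) \<in> borel_measurable (generated M U)"
    using assms by (intro generated_measurable_compose)
  fix A assume "A \<in> sets (generated M U)"
  then obtain B where B: "A = U -` B \<inter> space M" "B \<in> sets borel" by (auto simp: sets_generated)
  have ind: "(LINT x|M. indicator A x * f x) = (LINT x|M. indicator B (U x) * f x)" for f :: "'a \<Rightarrow> real"
    by (intro Bochner_Integration.integral_cong) (auto simp: B indicator_def)
  show "set_lebesgue_integral M A Z = set_lebesgue_integral M A (\<lambda>x. k (U x))"
    unfolding set_lebesgue_integral_def real_scaleR_def ind by (rule eq[OF B(2)])
qed

lemma cond_exp_integrable:
  "U \<in> borel_measurable M \<Longrightarrow> integrable M Z \<Longrightarrow> integrable M (real_cond_exp M (generated M U) Z)"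
  using sigma_finite_subalgebra.real_cond_exp_int(1)[OF generated_sigma_finite] by blast

text \<open>Conditional expectation is self-adjoint: both sides equal the integral of the product of
  the two conditional expectations.\<close>

lemma cond_exp_swap:
  assumes "U \<in> borel_measurable M" "bdd_borel M Z" "bdd_borel M W"
  shows "(LINT x|M. real_cond_exp M (generated M U) Z x * W x) =
    (LINT x|M. Z x * real_cond_exp M (generated M U) W x)"
proof -
  let ?R = "real_cond_exp M (generated M U)"
  note sf = generated_sigma_finite[OF assms(1)]
  have i: "integrable M (?R Z)" "integrable M (?R W)"
    using assms by (auto intro: cond_exp_integrable bdd_borel_integrable)
  have "(LINT x|M. ?R Z x * ?R W x) = (LINT x|M. ?R Z x * W x)"
    using sigma_finite_subalgebra.real_cond_exp_intg(2)[OF sf, of "?R Z" W] assms(2,3)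
      integrable_mult_bdd_borel[OF assms(3) i(1)] bdd_borel_measurable
    by (auto simp: mult.commute)
  moreover have "(LINT x|M. ?R W x * ?R Z x) = (LINT x|M. ?R W x * Z x)"
    using sigma_finite_subalgebra.real_cond_exp_intg(2)[OF sf, of "?R W" Z] assms(2,3)
      integrable_mult_bdd_borel[OF assms(2) i(2)] bdd_borel_measurable
    by (auto simp: mult.commute)
  ultimately show ?thesis by (simp add: mult.commute)
qed

end

text \<open>Setting the other coordinates to 0 keeps all vectors in one space, whereas
  \<open>borel_vec S\<close> changes with \<open>S\<close>. The same test function can then be
  carried through inductions over \<open>S\<close>, and nodes are added by function update.\<close>

definition restricted :: "nat set \<Rightarrow> (nat \<Rightarrow> 'a \<Rightarrow> real) \<Rightarrow> 'a \<Rightarrow> nat \<Rightarrow> real" where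
  "restricted S U w = (\<lambda>n. if n \<in> S then U n w else 0)"

lemma zero_extension_measurable:
  "(\<lambda>x n. if n \<in> S then x n else 0) \<in> borel_vec S \<rightarrow>\<^sub>M borel_vec UNIV"
proof (rule measurable_PiM_single')
  fix i :: nat
  show "(\<lambda>x. if i \<in> S then x i else 0) \<in> borel_vec S \<rightarrow>\<^sub>M borel"
    by (cases "i \<in> S") auto
qed auto

lemma subvector_measurable:
  "(\<And>n. n \<in> S \<Longrightarrow> U n \<in> borel_measurable M) \<Longrightarrow> subvector S U \<in> M \<rightarrow>\<^sub>M borel_vec S"
  unfolding subvector_def by (rule measurable_restrict)

lemma restricted_subvector:
  "restricted S U w = (\<lambda>n. if n \<in> S then subvector S U w n else 0)"
  by (auto simp: restricted_def subvector_def)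

lemma restricted_measurable:
  "(\<And>n. n \<in> S \<Longrightarrow> U n \<in> borel_measurable M) \<Longrightarrow> restricted S U \<in> M \<rightarrow>\<^sub>M borel_vec UNIV"
  unfolding restricted_subvector[abs_def]
  by (rule measurable_compose[OF subvector_measurable zero_extension_measurable])

lemma box_in_borel_vec:
  "finite S \<Longrightarrow> (\<And>i. i \<in> S \<Longrightarrow> A i \<in> sets borel) \<Longrightarrow> Pi\<^sub>E S A \<in> sets (borel_vec S)"
  by (rule sets_PiM_I_finite)

lemma borel_vec_eqI:
  fixes P Q :: "(nat \<Rightarrow> real) measure"
  assumes S: "finite S" and P: "finite_measure P" "sets P = sets (borel_vec S)" "sets Q = sets (borel_vec S)"
    and eq: "\<And>A. (\<And>i. i \<in> S \<Longrightarrow> A i \<in> sets borel) \<Longrightarrow> emeasure P (Pi\<^sub>E S A) = emeasure Q (Pi\<^sub>E S A)"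
  shows "P = Q"
proof (rule measure_eqI_PiM_finite[OF S P(2,3) eq])
  show "range (\<lambda>_. Pi\<^sub>E S (\<lambda>_. UNIV)) \<subseteq> prod_algebra S (\<lambda>_. borel :: real measure)"
    using S by (auto intro!: prod_algebraI_finite)
  show "(\<Union>i. (\<lambda>_. Pi\<^sub>E S (\<lambda>_. UNIV)) i) = space (borel_vec S)"
    by (simp add: space_PiM)
  show "emeasure P (Pi\<^sub>E S (\<lambda>_. UNIV)) \<noteq> \<infinity>"
    using finite_measure.emeasure_finite[OF P(1)] by simp
qed auto

section \<open>The Markov property along one edge\<close>

locale markov_process = tree N E + prob_space M
  for N E and M :: "'a measure" +
  fixes U :: "nat \<Rightarrow> 'a \<Rightarrow> real"
  assumes U_measurable: "\<And>n. n \<in> N \<Longrightarrow> U n \<in> borel_measurable M"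
    and U_unit: "\<And>n w. n \<in> N \<Longrightarrow> U n w \<in> {0..1}"
    and markov: "markov_tree M U N E"
begin

abbreviation cond :: "nat \<Rightarrow> ('a \<Rightarrow> real) \<Rightarrow> 'a \<Rightarrow> real" where
  "cond n \<equiv> real_cond_exp M (generated M (U n))"

text \<open>The factor of the box at \<open>b\<close> is a function of \<open>U b\<close> and can be
  moved in and out of the conditional expectation; the remaining coordinates of \<open>S\<close> are
  separated from \<open>a\<close> by \<open>b\<close>, so conditional independence splits their
  product with the event at \<open>a\<close>.\<close>

lemma markov_box:
  assumes S: "finite S" "S \<subseteq> N" "uconnected E S" "b \<in> S"
    and a: "a \<in> N" "a \<notin> S" "a \<in> neighbours E b"
    and A: "\<And>i. i \<in> S \<Longrightarrow> A i \<in> sets borel" and B: "B \<in> sets borel"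
  shows "(LINT w|M. indicator (Pi\<^sub>E S A) (subvector S U w) * indicator B (U a w)) =
    (LINT w|M. indicator (Pi\<^sub>E S A) (subvector S U w) * cond b (\<lambda>w. indicator B (U a w)) w)"
proof -
  let ?S = "S - {b}"
  define Z :: "'a \<Rightarrow> real" where "Z w = indicator (Pi\<^sub>E ?S A) (subvector ?S U w)" for w
  define W :: "'a \<Rightarrow> real" where "W w = indicator B (U a w)" for w
  define \<psi> :: "real \<Rightarrow> real" where "\<psi> = indicator (A b)"
  have bN: "b \<in> N" and mb: "U b \<in> borel_measurable M" using S U_measurable by auto
  note sf = generated_sigma_finite[OF mb]
  have split: "indicator (Pi\<^sub>E S A) (subvector S U w) = \<psi> (U b w) * Z w" for w
    using S by (auto simp: indicator_def Z_def \<psi>_def subvector_def PiE_iff)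
  have "separates E b ?S {a}" using S a by (intro uconnected_separates) auto
  then have ci: "cond_indep_given M (U b) (borel_vec ?S) (subvector ?S U) (borel_vec {a}) (subvector {a} U)"
    using markov S a bN unfolding markov_tree_def by (elim allE[of _ ?S] allE[of _ "{a}"] allE[of _ b]) auto
  define B' where "B' = Pi\<^sub>E {a} (\<lambda>_. B)"
  have W: "indicator B' (subvector {a} U w) = W w" for w
    by (auto simp: indicator_def W_def B'_def subvector_def PiE_iff)
  have "Pi\<^sub>E ?S A \<in> sets (borel_vec ?S)" "B' \<in> sets (borel_vec {a})"
    using S A B unfolding B'_def by (auto intro!: box_in_borel_vec)
  then have ae: "AE w in M. cond b (\<lambda>w. Z w * W w) w = cond b Z w * cond b W w"
    using ci unfolding cond_indep_given_def Z_def W[symmetric] by blast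
  have bZ: "bdd_borel M Z" unfolding Z_def
    by (rule bdd_borel_compose[OF subvector_measurable bdd_borel_indicator])
      (use S A U_measurable in \<open>auto intro!: box_in_borel_vec\<close>)
  have bW: "bdd_borel M W" unfolding W_def
    by (rule bdd_borel_compose[OF U_measurable bdd_borel_indicator]) (use a B in auto)
  have b\<psi>: "bdd_borel borel \<psi>" unfolding \<psi>_def using A S by (auto intro: bdd_borel_indicator)
  have b\<psi>U: "bdd_borel M (\<lambda>w. \<psi> (U b w))" by (rule bdd_borel_compose[OF mb b\<psi>])
  have iW: "integrable M (cond b W)" by (intro cond_exp_integrable mb bdd_borel_integrable bW)
  have "(LINT w|M. \<psi> (U b w) * (Z w * W w)) = (LINT w|M. \<psi> (U b w) * cond b (\<lambda>w. Z w * W w) w)"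
    by (rule cond_exp_generated_integral[symmetric])
      (auto intro: mb b\<psi> bdd_borel_integrable bdd_borel_mult bZ bW)
  also have "\<dots> = (LINT w|M. (\<psi> (U b w) * cond b W w) * cond b Z w)"
  proof (rule integral_cong_AE)
    have [measurable]: "(\<lambda>w. \<psi> (U b w)) \<in> borel_measurable M"
      using b\<psi>U by (rule bdd_borel_measurable)
    show "(\<lambda>w. \<psi> (U b w) * cond b (\<lambda>w. Z w * W w) w) \<in> borel_measurable M"
      "(\<lambda>w. \<psi> (U b w) * cond b W w * cond b Z w) \<in> borel_measurable M"
      by measurable
  qed (use ae in auto)
  also have "\<dots> = (LINT w|M. (\<psi> (U b w) * cond b W w) * Z w)"
  proof (rule sigma_finite_subalgebra.real_cond_exp_intg(2)[OF sf])
    show "integrable M (\<lambda>w. (\<psi> (U b w) * cond b W w) * Z w)"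
      using integrable_mult_bdd_borel[OF bdd_borel_mult[OF b\<psi>U bZ] iW] by (simp add: ac_simps)
    show "(\<lambda>w. \<psi> (U b w) * cond b W w) \<in> borel_measurable (generated M (U b))"
      using generated_measurable_compose[OF bdd_borel_measurable[OF b\<psi>]]
      by (intro borel_measurable_times) auto
    show "Z \<in> borel_measurable M" using bZ by (rule bdd_borel_measurable)
  qed
  finally show ?thesis unfolding split W_def by (simp add: ac_simps)
qed

text \<open>For fixed \<open>B\<close> both sides are integrals of \<open>g\<close> against the
  images on \<open>R^S\<close> of finite measures, with densities \<open>W\<close> and its
  conditional expectation. These images agree on boxes by \<open>markov_box\<close>, hence
  everywhere.\<close>

lemma markov_indicator:
  assumes S: "finite S" "S \<subseteq> N" "uconnected E S" "b \<in> S"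
    and a: "a \<in> N" "a \<notin> S" "a \<in> neighbours E b"
    and g: "bdd_borel (borel_vec UNIV) g" and B: "B \<in> sets borel"
  shows "(LINT w|M. g (restricted S U w) * indicator B (U a w)) =
    (LINT w|M. g (restricted S U w) * cond b (\<lambda>w. indicator B (U a w)) w)"
proof -
  define W :: "'a \<Rightarrow> real" where "W w = indicator B (U a w)" for w
  have mb: "U b \<in> borel_measurable M" using S U_measurable by auto
  note sf = generated_sigma_finite[OF mb]
  have bW: "bdd_borel M W" unfolding W_def
    by (rule bdd_borel_compose[OF U_measurable bdd_borel_indicator]) (use a B in auto)
  note mW = bdd_borel_measurable[OF bW]
  have iW: "integrable M W" by (intro bdd_borel_integrable bW)
  have iC: "integrable M (cond b W)" by (intro cond_exp_integrable mb iW)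
  have W0: "AE w in M. 0 \<le> W w" by (simp add: W_def)
  have C0: "AE w in M. 0 \<le> cond b W w"
    by (rule sigma_finite_subalgebra.real_cond_exp_pos[OF sf]) (auto simp: W_def[abs_def] mW[unfolded W_def[abs_def]])
  have mS: "subvector S U \<in> M \<rightarrow>\<^sub>M borel_vec S" using S U_measurable by (intro subvector_measurable) auto
  define D where "D R = distr (density M (\<lambda>w. ennreal (R w))) (borel_vec S) (subvector S U)" for R :: "'a \<Rightarrow> real"
  have eD: "emeasure (D R) Y = ennreal (LINT w|M. indicator Y (subvector S U w) * R w)"
    if "integrable M R" "AE w in M. 0 \<le> R w" "Y \<in> sets (borel_vec S)" for R Y
  proof -
    have m: "R \<in> borel_measurable M" using that by auto
    have Y: "subvector S U -` Y \<inter> space M \<in> sets M" using mS that(3) by (rule measurable_sets)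
    have "emeasure (D R) Y = (\<integral>\<^sup>+w. ennreal (R w) * indicator (subvector S U -` Y \<inter> space M) w \<partial>M)"
      unfolding D_def using mS that m Y by (simp add: emeasure_distr emeasure_density)
    also have "\<dots> = (\<integral>\<^sup>+w. ennreal (indicator Y (subvector S U w) * R w) \<partial>M)"
      by (intro nn_integral_cong) (auto simp: indicator_def)
    also have "\<dots> = ennreal (LINT w|M. indicator Y (subvector S U w) * R w)"
    proof (rule nn_integral_eq_integral)
      show "integrable M (\<lambda>w. indicator Y (subvector S U w) * R w)"
        by (rule integrable_mult_bdd_borel[OF bdd_borel_compose[OF mS bdd_borel_indicator] that(1)]) fact
    qed (use that in auto)
    finally show ?thesis .
  qed
  have "D W = D (cond b W)"
  proof (rule borel_vec_eqI[OF S(1)])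
    show "finite_measure (D W)"
      by (rule finite_measureI) (use eD[OF iW W0, of "space (borel_vec S)"] in \<open>simp add: D_def\<close>)
    fix A :: "nat \<Rightarrow> real set" assume A: "\<And>i. i \<in> S \<Longrightarrow> A i \<in> sets borel"
    then have box: "Pi\<^sub>E S A \<in> sets (borel_vec S)" using S by (intro box_in_borel_vec)
    have "(LINT w|M. indicator (Pi\<^sub>E S A) (subvector S U w) * W w) =
      (LINT w|M. indicator (Pi\<^sub>E S A) (subvector S U w) * cond b W w)"
      unfolding W_def[abs_def] by (rule markov_box) (use S a A B in auto)
    then show "emeasure (D W) (Pi\<^sub>E S A) = emeasure (D (cond b W)) (Pi\<^sub>E S A)"
      by (simp only: eD[OF iW W0 box] eD[OF iC C0 box])
  qed (auto simp: D_def)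
  define v where "v x = g (\<lambda>n. if n \<in> S then x n else 0)" for x
  have mv: "v \<in> borel_measurable (borel_vec S)"
    unfolding v_def using measurable_compose[OF zero_extension_measurable bdd_borel_measurable[OF g]] .
  have iD: "integral\<^sup>L (D R) v = (LINT w|M. g (restricted S U w) * R w)"
    if "integrable M R" "AE w in M. 0 \<le> R w" for R
  proof -
    have m: "R \<in> borel_measurable M" using that by auto
    have "integral\<^sup>L (D R) v = (LINT w|(density M (\<lambda>w. ennreal (R w))). v (subvector S U w))"
      unfolding D_def using mS mv by (intro integral_distr) auto
    also have "\<dots> = (LINT w|M. R w * v (subvector S U w))"
      using measurable_compose[OF mS mv] m that by (subst integral_density) auto
    finally show ?thesis by (simp add: v_def restricted_subvector mult.commute)
  qed
  show ?thesis
    using iD[OF iW W0] iD[OF iC C0] \<open>D W = D (cond b W)\<close> unfolding W_def by simp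
qed

end

subsection \<open>Monotone update kernels\<close>

definition unif :: "real measure" where
  "unif = uniform_measure lborel {0..1}"

lemma sets_unif [measurable_cong, simp]: "sets unif = sets borel"
  by (simp add: unif_def)

lemma space_unif [simp]: "space unif = UNIV"
  by (simp add: unif_def)

interpretation unif: prob_space unif
  unfolding unif_def by (rule prob_space_uniform_measure) auto

lemma measure_unif_UNIV [simp]: "measure unif UNIV = 1"
  using unif.prob_space by simp

lemma measure_unif_lessThan:
  assumes "0 \<le> k" "k \<le> 1"
  shows "measure unif {..<k} = k"
proof -
  have "{0..1} \<inter> {..<k} = (if k = 0 then {} else {0..<k})" using assms by auto
  then show ?thesis
    unfolding unif_def using assms by (subst measure_uniform_measure) auto
qed

text \<open>The second argument is a uniform random number. Monotonicity in the state is required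
  for each of its values, so that with the randomness held fixed the update is an increasing
  map.\<close>

definition monotone_kernel :: "(real \<Rightarrow> real \<Rightarrow> real) \<Rightarrow> bool" where
  "monotone_kernel \<phi> \<longleftrightarrow>
     (\<lambda>z. \<phi> (fst z) (snd z)) \<in> borel_measurable (borel \<Otimes>\<^sub>M borel) \<and> (\<forall>u. mono (\<lambda>x. \<phi> x u)) \<and>
     (\<forall>x u. \<phi> x u \<in> {0..1})"

definition bounded_mono :: "('a::order \<Rightarrow> real) \<Rightarrow> bool" where
  "bounded_mono h \<longleftrightarrow> mono h \<and> (\<exists>c. \<forall>x. \<bar>h x\<bar> \<le> c)"

lemma bounded_mono_borel:
  fixes h :: "real \<Rightarrow> real"
  shows "bounded_mono h \<Longrightarrow> bdd_borel borel h"
  unfolding bounded_mono_def bdd_borel_def by (auto intro: borel_measurable_mono)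

text \<open>A convenient form of \<open>st_increasing_in\<close>: the test functions are bounded,
  and the version of the conditional expectation increases on the whole line instead of off a null
  set. \<open>increasing_U\<close> provides the passage.\<close>

definition increasing_in :: "'a measure \<Rightarrow> ('a \<Rightarrow> real) \<Rightarrow> ('a \<Rightarrow> real) \<Rightarrow> bool" where
  "increasing_in M V U \<longleftrightarrow>
     (\<forall>h :: real \<Rightarrow> real. bounded_mono h \<longrightarrow>
       (\<exists>k :: real \<Rightarrow> real. bounded_mono k \<and>
         (AE w in M. real_cond_exp M (generated M U) (\<lambda>w. h (V w)) w = k (U w))))"

lemma pair_measure_eqI:
  assumes P: "finite_measure P" "sets P = sets (A \<Otimes>\<^sub>M B)" "sets Q = sets (A \<Otimes>\<^sub>M B)"
    and eq: "\<And>X Y. X \<in> sets A \<Longrightarrow> Y \<in> sets B \<Longrightarrow> emeasure P (X \<times> Y) = emeasure Q (X \<times> Y)"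
  shows "P = Q"
proof (rule measure_eqI_generator_eq[OF Int_stable_pair_measure_generator pair_measure_closed])
  show "sets P = sigma_sets (space A \<times> space B) {X \<times> Y |X Y. X \<in> sets A \<and> Y \<in> sets B}"
    "sets Q = sigma_sets (space A \<times> space B) {X \<times> Y |X Y. X \<in> sets A \<and> Y \<in> sets B}"
    using P by (auto simp: sets_pair_measure)
  show "range (\<lambda>_::nat. space A \<times> space B) \<subseteq> {X \<times> Y |X Y. X \<in> sets A \<and> Y \<in> sets B}" by blast
  show "emeasure P ((\<lambda>_::nat. space A \<times> space B) i) \<noteq> \<infinity>" for i
    using finite_measure.emeasure_finite[OF P(1)] by simp
qed (auto simp: eq)

lemma measure_eq_integral:
  fixes f :: "'a \<Rightarrow> real"
  assumes "\<And>x. x \<in> space M \<Longrightarrow> f x = indicator A x" "A \<subseteq> space M"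
  shows "measure M A = (LINT x|M. f x)"
proof -
  have "(LINT x|M. f x) = (LINT x|M. indicator A x)"
    using assms by (intro Bochner_Integration.integral_cong) auto
  then show ?thesis using assms(2) by (simp add: Int_absorb2)
qed

text \<open>Tail events \<open>t < Z\<close> are limits of tail events at points above
  \<open>t\<close>. The points are rational because inequalities between conditional tail
  probabilities hold almost surely for countably many levels at once.\<close>

lemma ex_rat_seq:
  fixes t :: real
  assumes "t < 1"
  obtains q where "\<And>n::nat. q n \<in> \<rat>" "\<And>n. t < q n" "\<And>n. q n \<le> 1" "q \<longlonglongrightarrow> t"
proof -
  have "\<exists>r\<in>\<rat>. t < r \<and> r < min 1 (t + 1 / real (Suc n))" for n
    using assms by (intro Rats_dense_in_real) auto
  then obtain q where q: "\<And>n. q n \<in> \<rat>" "\<And>n. t < q n" "\<And>n. q n < min 1 (t + 1 / real (Suc n))"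
    by metis
  have "q \<longlonglongrightarrow> t"
  proof (rule tendsto_sandwich[where f = "\<lambda>_. t" and h = "\<lambda>n. t + 1 / real (Suc n)"])
    show "(\<lambda>n. t + 1 / real (Suc n)) \<longlonglongrightarrow> t"
      using tendsto_add[OF tendsto_const LIMSEQ_inverse_real_of_nat, of t]
      by (simp add: inverse_eq_divide)
    show "eventually (\<lambda>n. t \<le> q n) sequentially" by (intro always_eventually allI less_imp_le q(2))
    show "eventually (\<lambda>n. q n \<le> t + 1 / real (Suc n)) sequentially"
      using q(3) by (intro always_eventually allI) (metis less_imp_le min_less_iff_conj)
  qed simp
  then show ?thesis using that[of q] q by (metis less_imp_le min_less_iff_conj)
qed

context prob_space
begin

text \<open>The quantile transform of the conditional distribution functions turns conditional laws that
  increase stochastically into an update function that increases pointwise.\<close>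

lemma ex_monotone_kernel:
  assumes Y: "Y \<in> borel_measurable M" and Z: "Z \<in> borel_measurable M"
    and unit: "\<And>w. Z w \<in> {0..1}" and inc: "increasing_in M Z Y"
  obtains \<phi> where "monotone_kernel \<phi>"
    "\<And>B. B \<in> sets borel \<Longrightarrow> AE w in M. real_cond_exp M (generated M Y) (\<lambda>w. indicator B (Z w)) w =
       (LINT u|unif. indicator B (\<phi> (Y w) u))"
proof -
  interpret U: pair_prob_space M unif ..
  let ?P = "M \<Otimes>\<^sub>M unif"
  let ?cond = "real_cond_exp M (generated M Y)"
  note sf = generated_sigma_finite[OF Y]
  define H where "H q w = (indicator {q<..} (Z w) :: real)" for q w
  have bH: "bdd_borel M (H q)" for q
    unfolding H_def by (rule bdd_borel_compose[OF Z bdd_borel_indicator]) auto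
  have iH: "integrable M (H q)" for q by (intro bdd_borel_integrable bH)
  have bm: "bounded_mono (indicator {q<..} :: real \<Rightarrow> real)" for q :: real
    unfolding bounded_mono_def by (auto simp: mono_def indicator_def intro!: exI[of _ 1])
  have "\<exists>k :: real \<Rightarrow> real. bounded_mono k \<and> (AE w in M. ?cond (H q) w = k (Y w))" for q
    using inc bm[of q] unfolding increasing_in_def H_def by blast
  then obtain k0 where k0: "\<And>q. bounded_mono (k0 q :: real \<Rightarrow> real)"
    "\<And>q. AE w in M. ?cond (H q) w = k0 q (Y w)" by metis
  define k where "k q x = max 0 (min 1 (k0 q x))" for q x
  have k_unit: "0 \<le> k q x" "k q x \<le> 1" for q x by (auto simp: k_def)
  have k_mono: "x \<le> y \<Longrightarrow> k q x \<le> k q y" for q x y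
    using k0(1)[of q] unfolding bounded_mono_def mono_def k_def by (smt (verit))
  have k_meas [measurable]: "k q \<in> borel_measurable borel" for q
    using k_mono by (intro borel_measurable_mono) (auto simp: mono_def)
  have k_cond: "AE w in M. ?cond (H q) w = k q (Y w)" for q
  proof -
    have "AE w in M. ?cond (H q) w \<ge> 0"
      by (rule sigma_finite_subalgebra.real_cond_exp_ge_c[OF sf iH]) (auto simp: H_def)
    moreover have "AE w in M. ?cond (H q) w \<le> 1"
      by (rule sigma_finite_subalgebra.real_cond_exp_le_c[OF sf iH]) (auto simp: H_def indicator_def)
    ultimately show ?thesis using k0(2)[of q] by eventually_elim (auto simp: k_def)
  qed
  \<comment> \<open>Monotonicity of \<open>k q x\<close> in \<open>x\<close> holds everywhere by
    construction; monotonicity in the level \<open>q\<close> comes from the conditional expectations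
    and holds only almost surely, simultaneously for all rational levels.\<close>
  have k_anti: "AE w in M. \<forall>q\<in>\<rat>. \<forall>r\<in>\<rat>. q \<le> r \<longrightarrow> k r (Y w) \<le> k q (Y w)"
  proof -
    have "AE w in M. q \<le> r \<longrightarrow> k r (Y w) \<le> k q (Y w)" for q r
    proof (cases "q \<le> r")
      case True
      have "AE w in M. ?cond (H r) w \<le> ?cond (H q) w"
        by (rule sigma_finite_subalgebra.real_cond_exp_mono[OF sf _ iH iH])
          (use True in \<open>auto simp: H_def indicator_def\<close>)
      then show ?thesis using k_cond[of q] k_cond[of r] by eventually_elim auto
    qed simp
    then show ?thesis by (simp add: AE_ball_countable countable_rat)
  qed
  \<comment> \<open>\<open>\<phi> x u\<close> is the generalised inverse of the conditional tail
    probabilities \<open>k q x\<close>, with levels restricted to rationals in the unit interval.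
    Comparing \<open>u\<close> with tails makes \<open>\<phi>\<close> decreasing in
    \<open>u\<close>, which is harmless, and increasing in \<open>x\<close>. The extra 0 is the
    value when no level qualifies.\<close>
  define T where "T x u = insert 0 {q \<in> \<rat>. 0 \<le> q \<and> q \<le> 1 \<and> u < k q x}" for x u :: real
  define \<phi> where "\<phi> x u = Sup (T x u)" for x u
  have bdd: "bdd_above (T x u)" for x u unfolding T_def by (intro bdd_aboveI[where M = 1]) auto
  have less_iff: "t < \<phi> x u \<longleftrightarrow> t < 0 \<or> (\<exists>q\<in>\<rat> \<inter> {0..1} \<inter> {t<..}. u < k q x)" for t x u
    unfolding \<phi>_def by (subst less_cSup_iff[OF _ bdd]) (auto simp: T_def)
  have \<phi>_meas [measurable]: "(\<lambda>z. \<phi> (fst z) (snd z)) \<in> borel_measurable (borel \<Otimes>\<^sub>M borel)"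
  proof (rule borel_measurableI_greater)
    fix t
    have "{z \<in> space (borel \<Otimes>\<^sub>M borel). t < \<phi> (fst z) (snd z)} =
      (if t < 0 then space (borel \<Otimes>\<^sub>M borel) else
       (\<Union>q\<in>\<rat> \<inter> {0..1} \<inter> {t<..}. {z \<in> space (borel \<Otimes>\<^sub>M borel). snd z < k q (fst z)}))"
      unfolding less_iff by auto
    also have "\<dots> \<in> sets (borel \<Otimes>\<^sub>M borel)"
      by (auto intro!: sets.countable_UN' countable_subset[OF _ countable_rat])
    finally show "{z \<in> space (borel \<Otimes>\<^sub>M borel). t < \<phi> (fst z) (snd z)} \<in> sets (borel \<Otimes>\<^sub>M borel)" .
  qed
  have "mono (\<lambda>x. \<phi> x u)" for u
  proof (rule monoI)
    fix x y :: real assume "x \<le> y"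
    then have "T x u \<subseteq> T y u" using k_mono unfolding T_def by (auto intro: less_le_trans)
    then show "\<phi> x u \<le> \<phi> y u"
      unfolding \<phi>_def by (intro cSup_subset_mono bdd) (auto simp: T_def)
  qed
  moreover have \<phi>_unit: "\<phi> x u \<in> {0..1}" for x u
    using less_iff[of 1 x u] less_iff[of "\<phi> x u" x u] by (auto simp: not_less)
  ultimately have kernel: "monotone_kernel \<phi>" using \<phi>_meas unfolding monotone_kernel_def by blast
  have \<phi>Y [measurable]: "(\<lambda>z. \<phi> (Y (fst z)) (snd z)) \<in> borel_measurable ?P"
  proof -
    have "(\<lambda>z. (Y (fst z), snd z)) \<in> ?P \<rightarrow>\<^sub>M (borel \<Otimes>\<^sub>M borel)"
      using Y by measurable
    from measurable_compose[OF this \<phi>_meas] show ?thesis by simp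
  qed
  note Y [measurable] Z [measurable]
  have ray: "\<P>(w in M. Y w \<in> A \<and> t < Z w) =
      \<P>(z in ?P. Y (fst z) \<in> A \<and> t < \<phi> (Y (fst z)) (snd z))"
    if A [measurable]: "A \<in> sets borel" and t: "0 \<le> t" for A t
  proof (cases "t < 1")
    case False
    then have "\<not> t < Z w" "\<not> t < \<phi> x u" for w x u
      using unit[of w] by (auto simp: less_iff)
    then show ?thesis by simp
  next
    case True
    \<comment> \<open>Nothing is known about continuity of \<open>k t x\<close> in \<open>t\<close>,
      so the tail of \<open>\<phi>\<close> at \<open>t\<close> is obtained as a limit of tails at
      levels \<open>q n > t\<close>, on both sides of the identity.\<close>
    obtain q where q: "\<And>n::nat. q n \<in> \<rat>" "\<And>n. t < q n" "\<And>n. q n \<le> 1" "q \<longlonglongrightarrow> t"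
      using ex_rat_seq[OF True] by blast
    have step: "(LINT w|M. indicat_real A (Y w) * indicator {q n<..} (Z w)) =
      (LINT z|?P. indicat_real A (Y (fst z)) * indicator {..<k (q n) (Y (fst z))} (snd z))" for n
    proof -
      have "(LINT w|M. indicat_real A (Y w) * H (q n) w) = (LINT w|M. indicat_real A (Y w) * ?cond (H (q n)) w)"
        by (rule cond_exp_generated_integral[symmetric, OF Y bdd_borel_indicator iH]) fact
      also have "\<dots> = (LINT w|M. indicat_real A (Y w) * k (q n) (Y w))"
        by (rule integral_cong_AE) (use k_cond[of "q n"] in auto)
      also have "\<dots> = (LINT w|M. (LINT u|unif. indicat_real A (Y w) * indicator {..<k (q n) (Y w)} u))"
        by (intro Bochner_Integration.integral_cong)
          (simp_all add: k_unit measure_unif_lessThan)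
      also have "\<dots> = (LINT z|?P. indicat_real A (Y (fst z)) * indicator {..<k (q n) (Y (fst z))} (snd z))"
      proof -
        have "{z \<in> space ?P. snd z < k (q n) (Y (fst z))} \<in> sets ?P" by measurable
        then have m: "(\<lambda>z. indicat_real A (Y (fst z)) * indicator {..<k (q n) (Y (fst z))} (snd z) :: real)
            \<in> borel_measurable ?P"
          unfolding indicator_def lessThan_iff by measurable
        show ?thesis
          by (subst U.integral_fst'[symmetric])
            (auto intro!: U.P.integrable_const_bound[where B = 1] m simp: indicator_def)
      qed
      finally show ?thesis by (simp add: H_def)
    qed
    have "(\<lambda>n. LINT w|M. indicat_real A (Y w) * indicator {q n<..} (Z w)) \<longlonglongrightarrow>
      (LINT w|M. indicat_real A (Y w) * indicator {t<..} (Z w))"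
    proof (rule integral_dominated_convergence[where w = "\<lambda>_. 1"])
      show "AE w in M. (\<lambda>n. indicat_real A (Y w) * indicator {q n<..} (Z w)) \<longlonglongrightarrow>
        (indicat_real A (Y w) * indicator {t<..} (Z w) :: real)"
      proof (intro AE_I2 tendsto_mult tendsto_const tendsto_eventually)
        fix w
        show "\<forall>\<^sub>F n in sequentially. indicator {q n<..} (Z w) = (indicator {t<..} (Z w) :: real)"
        proof (cases "t < Z w")
          case True
          show ?thesis
            by (rule eventually_mono[OF order_tendstoD(2)[OF q(4) True]]) (use True in auto)
        next
          case False
          then have "\<not> q n < Z w" for n using q(2)[of n] by linarith
          then show ?thesis using False by simp
        qed
      qed
    qed (auto simp: indicator_def)
    moreover have "(\<lambda>n. LINT z|?P. indicat_real A (Y (fst z)) * indicator {..<k (q n) (Y (fst z))} (snd z)) \<longlonglongrightarrow>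
      (LINT z|?P. indicat_real A (Y (fst z)) * indicator {t<..} (\<phi> (Y (fst z)) (snd z)))"
    proof (rule integral_dominated_convergence[where w = "\<lambda>_. 1"])
      show "(\<lambda>z. indicat_real A (Y (fst z)) * indicator {..<k (q n) (Y (fst z))} (snd z) :: real)
          \<in> borel_measurable ?P" for n
        unfolding indicator_def lessThan_iff by measurable
      have "AE z in ?P. \<forall>q\<in>\<rat>. \<forall>r\<in>\<rat>. q \<le> r \<longrightarrow> k r (Y (fst z)) \<le> k q (Y (fst z))"
        by (rule AE_distrD[of fst "?P" M "\<lambda>w. \<forall>q\<in>\<rat>. \<forall>r\<in>\<rat>. q \<le> r \<longrightarrow> k r (Y w) \<le> k q (Y w)"])
          (use k_anti in \<open>simp_all only: unif.distr_pair_fst measurable_fst\<close>)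
      then show "AE z in ?P. (\<lambda>n. indicat_real A (Y (fst z)) * indicator {..<k (q n) (Y (fst z))} (snd z)) \<longlonglongrightarrow>
        (indicat_real A (Y (fst z)) * indicator {t<..} (\<phi> (Y (fst z)) (snd z)) :: real)"
      proof eventually_elim
        case (elim z)
        have "\<forall>\<^sub>F n in sequentially. indicator {..<k (q n) (Y (fst z))} (snd z) =
          (indicator {t<..} (\<phi> (Y (fst z)) (snd z)) :: real)"
        proof (cases "t < \<phi> (Y (fst z)) (snd z)")
          case True
          then obtain r where r: "r \<in> \<rat>" "t < r" "snd z < k r (Y (fst z))"
            using t by (auto simp: less_iff)
          have "\<forall>\<^sub>F n in sequentially. snd z < k (q n) (Y (fst z))"
            using order_tendstoD(2)[OF q(4) r(2)]
          proof eventually_elim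
            case (elim n)
            then have "k r (Y (fst z)) \<le> k (q n) (Y (fst z))"
              using \<open>\<forall>q\<in>\<rat>. \<forall>r\<in>\<rat>. q \<le> r \<longrightarrow> k r (Y (fst z)) \<le> k q (Y (fst z))\<close> q(1) r(1) by auto
            then show ?case using r(3) by linarith
          qed
          then show ?thesis using True by (auto elim: eventually_mono)
        next
          case False
          have "\<not> snd z < k (q n) (Y (fst z))" for n
          proof
            assume "snd z < k (q n) (Y (fst z))"
            moreover have "q n \<in> \<rat> \<inter> {0..1} \<inter> {t<..}" using q(1,2,3)[of n] t by auto
            ultimately show False using False unfolding less_iff by blast
          qed
          then show ?thesis using False by simp
        qed
        then show ?case by (intro tendsto_mult tendsto_const tendsto_eventually)
      qed
    qed (auto simp: indicator_def)
    ultimately have eq: "(LINT w|M. indicat_real A (Y w) * indicator {t<..} (Z w)) =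
      (LINT z|?P. indicat_real A (Y (fst z)) * indicator {t<..} (\<phi> (Y (fst z)) (snd z)))"
      unfolding step by (rule LIMSEQ_unique)
    have "\<P>(w in M. Y w \<in> A \<and> t < Z w) = (LINT w|M. indicat_real A (Y w) * indicator {t<..} (Z w))"
      by (rule measure_eq_integral) (auto simp: indicator_def)
    moreover have "\<P>(z in ?P. Y (fst z) \<in> A \<and> t < \<phi> (Y (fst z)) (snd z)) =
      (LINT z|?P. indicat_real A (Y (fst z)) * indicator {t<..} (\<phi> (Y (fst z)) (snd z)))"
      by (rule measure_eq_integral) (auto simp: indicator_def)
    ultimately show ?thesis using eq by simp
  qed
  have law: "(LINT w|M. indicat_real A (Y w) * indicator B (Z w)) =
      (LINT z|?P. indicat_real A (Y (fst z)) * indicator B (\<phi> (Y (fst z)) (snd z)))"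
    if A [measurable]: "A \<in> sets borel" and B [measurable]: "B \<in> sets borel" for A B
  proof -
    \<comment> \<open>The value \<open>- 1\<close>, below the range of \<open>Z\<close>, encodes
      failure of \<open>Y w \<in> A\<close>. The joint law with this event becomes the law of one
      real variable, which is determined by its upper rays: levels from 0 on are given by
      \<open>ray\<close>, levels in \<open>[-1, 0)\<close> by the law of \<open>Y\<close>.\<close>
    define V where "V w = (if Y w \<in> A then Z w else - 1)" for w
    define W where "W z = (if Y (fst z) \<in> A then \<phi> (Y (fst z)) (snd z) else - 1)" for z
    have V [measurable]: "V \<in> borel_measurable M" unfolding V_def by measurable
    have W [measurable]: "W \<in> borel_measurable ?P" unfolding W_def by measurable
    have mB: "indicat_real (B \<inter> {0..1}) \<in> borel_measurable borel" by measurable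
    interpret D: prob_space "distr M borel V" using V by (rule prob_space_distr)
    have "distr M borel V = distr ?P borel W"
    proof (rule measure_eqI_lessThan)
      fix t :: real
      show "emeasure (distr M borel V) {t<..} < \<infinity>"
        using D.emeasure_finite by (simp add: less_top[symmetric])
      have "\<P>(w in M. t < V w) = \<P>(z in ?P. t < W z)"
      proof -
        consider "t < - 1" | "- 1 \<le> t" "t < 0" | "0 \<le> t" by linarith
        then show ?thesis
        proof cases
          case 1
          then have "t < V w" "t < W z" for w z
            using unit[of w] \<phi>_unit[of "Y (fst z)" "snd z"] by (auto simp: V_def W_def)
          then show ?thesis using prob_space U.P.prob_space by simp
        next
          case 2
          have V': "t < V w \<longleftrightarrow> Y w \<in> A" for w using 2 unit[of w] by (auto simp: V_def)
          have W': "t < W z \<longleftrightarrow> Y (fst z) \<in> A" for z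
            using 2 \<phi>_unit[of "Y (fst z)" "snd z"] by (auto simp: W_def)
          have "\<P>(w in M. Y w \<in> A) = measure (distr ?P M fst) {w \<in> space M. Y w \<in> A}"
            by (simp add: unif.distr_pair_fst)
          also have "\<dots> = measure ?P (fst -` {w \<in> space M. Y w \<in> A} \<inter> space ?P)"
            by (rule measure_distr) measurable
          also have "fst -` {w \<in> space M. Y w \<in> A} \<inter> space ?P = {z \<in> space ?P. Y (fst z) \<in> A}"
            by (auto simp: space_pair_measure)
          finally show ?thesis unfolding V' W' .
        next
          case 3
          have V': "t < V w \<longleftrightarrow> Y w \<in> A \<and> t < Z w" for w using 3 by (auto simp: V_def)
          have W': "t < W z \<longleftrightarrow> Y (fst z) \<in> A \<and> t < \<phi> (Y (fst z)) (snd z)" for z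
            using 3 by (auto simp: W_def)
          show ?thesis unfolding V' W' by (rule ray[OF A 3])
        qed
      qed
      then show "emeasure (distr M borel V) {t<..} = emeasure (distr ?P borel W) {t<..}"
        by (simp add: emeasure_distr vimage_def Int_def conj_commute emeasure_eq_measure U.P.emeasure_eq_measure)
    qed auto
    then have "(LINT x|(distr M borel V). indicat_real (B \<inter> {0..1}) x) =
        (LINT x|(distr ?P borel W). indicat_real (B \<inter> {0..1}) x)" by simp
    then have "(LINT w|M. indicat_real (B \<inter> {0..1}) (V w)) =
        (LINT z|?P. indicat_real (B \<inter> {0..1}) (W z))"
      unfolding integral_distr[OF V mB] integral_distr[OF W mB] .
    moreover have "indicat_real (B \<inter> {0..1}) (V w) = indicator A (Y w) * indicator B (Z w)" for w
      using unit[of w] by (auto simp: V_def indicator_def)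
    moreover have "indicat_real (B \<inter> {0..1}) (W z) = indicator A (Y (fst z)) * indicator B (\<phi> (Y (fst z)) (snd z))" for z
      using \<phi>_unit[of "Y (fst z)" "snd z"] by (auto simp: W_def indicator_def)
    ultimately show ?thesis by simp
  qed
  have "AE w in M. ?cond (\<lambda>w. indicator B (Z w)) w = (LINT u|unif. indicator B (\<phi> (Y w) u))"
    if B [measurable]: "B \<in> sets borel" for B
  proof (rule cond_exp_generated_unique[OF Y])
    show "integrable M (\<lambda>w. indicat_real B (Z w))"
      by (intro bdd_borel_integrable bdd_borel_compose[OF Z bdd_borel_indicator] B)
    have m: "(\<lambda>z. indicat_real B (\<phi> (fst z) (snd z))) \<in> borel_measurable (borel \<Otimes>\<^sub>M unif)"
      by measurable
    show mK: "(\<lambda>x. LINT u|unif. indicat_real B (\<phi> x u)) \<in> borel_measurable borel"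
      by (rule unif.borel_measurable_lebesgue_integral) (use m in \<open>simp add: case_prod_beta\<close>)
    show "integrable M (\<lambda>w. LINT u|unif. indicat_real B (\<phi> (Y w) u))"
    proof (rule bdd_borel_integrable[OF bdd_borelI])
      show "(\<lambda>w. LINT u|unif. indicat_real B (\<phi> (Y w) u)) \<in> borel_measurable M"
        using measurable_compose[OF Y mK] .
      fix w
      have "(\<lambda>u. (Y w, u)) \<in> unif \<rightarrow>\<^sub>M (borel \<Otimes>\<^sub>M unif)" by simp
      from measurable_compose[OF this m]
      have sm: "(\<lambda>u. \<bar>indicat_real B (\<phi> (Y w) u)\<bar>) \<in> borel_measurable unif" by simp
      have "\<bar>LINT u|unif. indicat_real B (\<phi> (Y w) u)\<bar> \<le> (LINT u|unif. \<bar>indicat_real B (\<phi> (Y w) u)\<bar>)"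
        by (rule integral_abs_bound)
      also have "\<dots> \<le> 1"
      proof (rule unif.integral_le_const)
        show "integrable unif (\<lambda>u. \<bar>indicat_real B (\<phi> (Y w) u)\<bar>)"
          by (rule unif.bdd_borel_integrable[OF bdd_borelI[OF sm, of 1]]) (simp add: indicator_def)
      qed (simp add: indicator_def)
      finally show "\<bar>LINT u|unif. indicat_real B (\<phi> (Y w) u)\<bar> \<le> 1" .
    qed
    fix A :: "real set" assume A [measurable]: "A \<in> sets borel"
    have m: "(\<lambda>z. indicat_real A (Y (fst z)) * indicator B (\<phi> (Y (fst z)) (snd z))) \<in> borel_measurable ?P"
      by measurable
    have "(LINT z|?P. indicat_real A (Y (fst z)) * indicator B (\<phi> (Y (fst z)) (snd z))) =
        (LINT w|M. (LINT u|unif. indicat_real A (Y w) * indicator B (\<phi> (Y w) u)))"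
      by (subst U.integral_fst'[symmetric])
        (auto intro!: U.P.integrable_const_bound[where B = 1] m simp: indicator_def)
    then show "(LINT w|M. indicat_real A (Y w) * indicat_real B (Z w)) =
        (LINT w|M. indicat_real A (Y w) * (LINT u|unif. indicat_real B (\<phi> (Y w) u)))"
      by (simp add: law[OF A B])
  qed
  then show ?thesis using kernel that by blast
qed

end

section \<open>Averaging a node out with its update kernel\<close>

definition update_kernel :: "'a measure \<Rightarrow> ('a \<Rightarrow> real) \<Rightarrow> ('a \<Rightarrow> real) \<Rightarrow> (real \<Rightarrow> real \<Rightarrow> real) \<Rightarrow> bool" where
  "update_kernel M Z Y \<phi> \<longleftrightarrow> monotone_kernel \<phi> \<and>
     (\<forall>B\<in>sets borel. AE w in M. real_cond_exp M (generated M Y) (\<lambda>w. indicator B (Z w)) w =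
       (LINT u|unif. indicator B (\<phi> (Y w) u)))"

text \<open>The backward operator of the kernel: it integrates out node \<open>a\<close>, attached
  to \<open>b\<close>, and thereby turns a test function for a set containing \<open>a\<close> into
  one for the set without \<open>a\<close>.\<close>

definition kernel_average ::
    "(real \<Rightarrow> real \<Rightarrow> real) \<Rightarrow> nat \<Rightarrow> nat \<Rightarrow> ((nat \<Rightarrow> real) \<Rightarrow> real) \<Rightarrow> (nat \<Rightarrow> real) \<Rightarrow> real" where
  "kernel_average \<phi> b a g y = (LINT u|unif. g (y(a := \<phi> (y b) u)))"

lemma fun_upd_measurable:
  assumes "X \<in> Q \<rightarrow>\<^sub>M borel_vec UNIV" and V: "V \<in> borel_measurable Q"
  shows "(\<lambda>w. (X w)(a := V w)) \<in> Q \<rightarrow>\<^sub>M borel_vec UNIV"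
proof (rule measurable_PiM_single')
  fix i :: nat
  have "(\<lambda>w. X w i) \<in> borel_measurable Q"
    by (rule measurable_compose[OF assms(1)]) simp
  then show "(\<lambda>w. ((X w)(a := V w)) i) \<in> borel_measurable Q" using V by (cases "i = a") auto
qed auto

lemma kernel_measurable:
  assumes \<phi>: "monotone_kernel \<phi>" and X: "X \<in> borel_measurable Q"
  shows "(\<lambda>z. \<phi> (X (fst z)) (snd z)) \<in> borel_measurable (Q \<Otimes>\<^sub>M unif)"
proof -
  have "(\<lambda>z. (X (fst z), snd z)) \<in> (Q \<Otimes>\<^sub>M unif) \<rightarrow>\<^sub>M (borel \<Otimes>\<^sub>M borel)" using X by measurable
  from measurable_compose[OF this, of "\<lambda>z. \<phi> (fst z) (snd z)" borel] show ?thesis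
    using \<phi> by (simp add: monotone_kernel_def)
qed

lemma update_measurable:
  assumes "monotone_kernel \<phi>"
  shows "(\<lambda>p. (fst p)(a := \<phi> (fst p b) (snd p))) \<in> (borel_vec UNIV \<Otimes>\<^sub>M unif) \<rightarrow>\<^sub>M borel_vec UNIV"
  by (rule fun_upd_measurable[OF measurable_fst kernel_measurable[OF assms]]) simp

lemma bdd_borel_vec_bound:
  "bdd_borel (borel_vec UNIV) g \<Longrightarrow> \<exists>c. \<forall>y. \<bar>g y\<bar> \<le> c"
  by (auto simp: bdd_borel_def space_PiM)

lemma update_section_integrable:
  assumes "monotone_kernel \<phi>" "bdd_borel (borel_vec UNIV) g"
  shows "integrable unif (\<lambda>u. g (y(a := \<phi> (y b) u)))"
proof -
  have "bdd_borel (borel_vec UNIV \<Otimes>\<^sub>M unif) (\<lambda>p. g ((fst p)(a := \<phi> (fst p b) (snd p))))"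
    by (rule bdd_borel_compose[OF update_measurable]) fact+
  moreover have "(\<lambda>u. (y, u)) \<in> unif \<rightarrow>\<^sub>M (borel_vec UNIV \<Otimes>\<^sub>M unif)"
    by (intro measurable_Pair) (auto simp: space_PiM)
  ultimately have "bdd_borel unif (\<lambda>u. g ((fst (y, u))(a := \<phi> (fst (y, u) b) (snd (y, u)))))"
    by (rule bdd_borel_compose[rotated])
  then show ?thesis by (intro unif.bdd_borel_integrable) simp
qed

lemma bdd_borel_kernel_average:
  assumes "monotone_kernel \<phi>" "bdd_borel (borel_vec UNIV) g"
  shows "bdd_borel (borel_vec UNIV) (kernel_average \<phi> b a g)"
proof -
  obtain c where c: "\<And>y. \<bar>g y\<bar> \<le> c" using bdd_borel_vec_bound[OF assms(2)] by blast
  show ?thesis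
  proof (rule bdd_borelI)
    show "kernel_average \<phi> b a g \<in> borel_measurable (borel_vec UNIV)"
      unfolding kernel_average_def[abs_def]
      using measurable_compose[OF update_measurable[OF assms(1)] bdd_borel_measurable[OF assms(2)]]
      by (intro unif.borel_measurable_lebesgue_integral) (simp add: case_prod_beta)
    fix y
    have "\<bar>kernel_average \<phi> b a g y\<bar> \<le> (LINT u|unif. \<bar>g (y(a := \<phi> (y b) u))\<bar>)"
      unfolding kernel_average_def by (rule integral_abs_bound)
    also have "\<dots> \<le> c"
      by (rule unif.integral_le_const) (auto intro!: integrable_abs update_section_integrable assms c)
    finally show "\<bar>kernel_average \<phi> b a g y\<bar> \<le> c" .
  qed
qed

lemma mono_kernel_average:
  assumes "monotone_kernel \<phi>" "bdd_borel (borel_vec UNIV) g" "mono g"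
  shows "mono (kernel_average \<phi> b a g)"
proof (rule monoI)
  fix x y :: "nat \<Rightarrow> real" assume "x \<le> y"
  then have "x(a := \<phi> (x b) u) \<le> y(a := \<phi> (y b) u)" for u
    using assms(1) unfolding monotone_kernel_def mono_def le_fun_def by auto
  then show "kernel_average \<phi> b a g x \<le> kernel_average \<phi> b a g y"
    unfolding kernel_average_def using assms
    by (intro integral_mono update_section_integrable) (auto simp: mono_def)
qed

lemma supermodular_UNIV: "supermodular UNIV g \<longleftrightarrow> (\<forall>x y. g x + g y \<le> g (inf x y) + g (sup x y))"
  by (simp add: supermodular_def space_PiM)

text \<open>For fixed \<open>u\<close> the update commutes with meets and joins, since a monotone
  map of the totally ordered line preserves minima and maxima. Composition with such a map preserves
  supermodularity, and so does integration over \<open>u\<close>.\<close>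

lemma supermodular_kernel_average:
  assumes "monotone_kernel \<phi>" "bdd_borel (borel_vec UNIV) g" "supermodular UNIV g"
  shows "supermodular UNIV (kernel_average \<phi> b a g)"
  unfolding supermodular_UNIV
proof (intro allI)
  fix x y :: "nat \<Rightarrow> real"
  let ?up = "\<lambda>y u. y(a := \<phi> (y b) u)"
  have mono: "mono (\<lambda>x. \<phi> x u)" for u using assms(1) by (simp add: monotone_kernel_def)
  have "inf (\<phi> (x b) u) (\<phi> (y b) u) = \<phi> (inf (x b) (y b)) u" for u
    using monoD[OF mono[of u], of "x b" "y b"] monoD[OF mono[of u], of "y b" "x b"]
    by (cases "x b \<le> y b") (auto simp: inf_absorb1 inf_absorb2)
  then have "inf (?up x u) (?up y u) = ?up (inf x y) u" for u
    by (auto simp: fun_eq_iff)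
  moreover have "sup (\<phi> (x b) u) (\<phi> (y b) u) = \<phi> (sup (x b) (y b)) u" for u
    using monoD[OF mono[of u], of "x b" "y b"] monoD[OF mono[of u], of "y b" "x b"]
    by (cases "x b \<le> y b") (auto simp: sup_absorb1 sup_absorb2)
  then have "sup (?up x u) (?up y u) = ?up (sup x y) u" for u
    by (auto simp: fun_eq_iff)
  ultimately have "g (?up x u) + g (?up y u) \<le> g (?up (inf x y) u) + g (?up (sup x y) u)" for u
    using assms(3) unfolding supermodular_UNIV by metis
  then have "(LINT u|unif. g (?up x u) + g (?up y u)) \<le> (LINT u|unif. g (?up (inf x y) u) + g (?up (sup x y) u))"
    using assms by (intro integral_mono Bochner_Integration.integrable_add update_section_integrable)
  then show "kernel_average \<phi> b a g x + kernel_average \<phi> b a g y \<le>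
      kernel_average \<phi> b a g (inf x y) + kernel_average \<phi> b a g (sup x y)"
    unfolding kernel_average_def
      Bochner_Integration.integral_add[OF update_section_integrable[OF assms(1,2)] update_section_integrable[OF assms(1,2)]] .
qed

lemma restricted_insert: "restricted (insert a S) U w = (restricted S U w)(a := U a w)"
  by (auto simp: restricted_def)

context markov_process
begin

lemma ex_update_kernel:
  assumes "b \<in> N" "a \<in> N" "increasing_in M (U a) (U b)"
  obtains \<phi> where "update_kernel M (U a) (U b) \<phi>"
proof (rule ex_monotone_kernel[OF U_measurable[OF assms(1)] U_measurable[OF assms(2)] U_unit[OF assms(2)] assms(3)])
  fix \<phi>
  assume "monotone_kernel \<phi>" "\<And>B. B \<in> sets borel \<Longrightarrow> AE w in M. cond b (\<lambda>w. indicator B (U a w)) w =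
       (LINT u|unif. indicator B (\<phi> (U b w) u))"
  then show thesis by (intro that[of \<phi>]) (simp add: update_kernel_def)
qed

lemma restricted_U_measurable: "S \<subseteq> N \<Longrightarrow> restricted S U \<in> M \<rightarrow>\<^sub>M borel_vec UNIV"
  using U_measurable by (intro restricted_measurable) auto

text \<open>The vector on \<open>S\<close> together with \<open>U a\<close> has the law of that
  vector together with \<open>\<phi> (U b) u\<close>, where \<open>u\<close> is independent of it:
  on rectangles this is \<open>markov_indicator\<close> and the defining property of the kernel.
  Coordinate \<open>b\<close> can be read off from the vector because
  \<open>b \<in> S\<close>.\<close>

lemma kernel_extend:
  assumes S: "finite S" "S \<subseteq> N" "uconnected E S" "b \<in> S"
    and a: "a \<in> N" "a \<notin> S" "a \<in> neighbours E b"
    and \<phi>: "update_kernel M (U a) (U b) \<phi>" and g: "bdd_borel (borel_vec UNIV) g"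
  shows "(LINT w|M. g (restricted (insert a S) U w)) = (LINT w|M. kernel_average \<phi> b a g (restricted S U w))"
proof -
  interpret pair: pair_prob_space M unif ..
  let ?P = "M \<Otimes>\<^sub>M unif" and ?K = "borel_vec UNIV \<Otimes>\<^sub>M borel"
  let ?R = "restricted S U"
  have bN: "b \<in> N" using S by auto
  have \<phi>m: "monotone_kernel \<phi>" using \<phi> by (simp add: update_kernel_def)
  have [measurable]: "(\<lambda>z. \<phi> (fst z) (snd z)) \<in> borel_measurable (borel \<Otimes>\<^sub>M borel)"
    using \<phi>m by (simp add: monotone_kernel_def)
  have R [measurable]: "?R \<in> M \<rightarrow>\<^sub>M borel_vec UNIV" by (rule restricted_U_measurable[OF S(2)])
  have Ub [measurable]: "U b \<in> borel_measurable M" and Ua [measurable]: "U a \<in> borel_measurable M"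
    using U_measurable bN a by auto
  have \<phi>U [measurable]: "(\<lambda>z. \<phi> (U b (fst z)) (snd z)) \<in> borel_measurable ?P"
    by (rule kernel_measurable[OF \<phi>m Ub])
  define V where "V w = (?R w, U a w)" for w
  define W where "W z = (?R (fst z), \<phi> (U b (fst z)) (snd z))" for z
  have V: "V \<in> M \<rightarrow>\<^sub>M ?K" unfolding V_def by measurable
  have W: "W \<in> ?P \<rightarrow>\<^sub>M ?K" unfolding W_def by measurable
  interpret D: prob_space "distr M ?K V" using V by (rule prob_space_distr)
  have law: "distr M ?K V = distr ?P ?K W"
  proof (rule pair_measure_eqI)
    fix X :: "(nat \<Rightarrow> real) set" and Y :: "real set"
    assume X [measurable]: "X \<in> sets (borel_vec UNIV)" and Y [measurable]: "Y \<in> sets borel"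
    have XY: "X \<times> Y \<in> sets ?K" using X Y by auto
    have m: "(\<lambda>z. indicat_real X (?R (fst z)) * indicator Y (\<phi> (U b (fst z)) (snd z))) \<in> borel_measurable ?P"
      by measurable
    have "measure M (V -` (X \<times> Y) \<inter> space M) = (LINT w|M. indicator X (?R w) * indicator Y (U a w))"
      by (rule measure_eq_integral) (auto simp: indicator_def V_def)
    also have "\<dots> = (LINT w|M. indicator X (?R w) * cond b (\<lambda>w. indicator Y (U a w)) w)"
      by (rule markov_indicator[OF S a bdd_borel_indicator[OF X] Y])
    also have "\<dots> = (LINT w|M. indicator X (?R w) * (LINT u|unif. indicator Y (\<phi> (U b w) u)))"
    proof (rule integral_cong_AE)
      have "(\<lambda>w. LINT u|unif. indicat_real Y (\<phi> (U b w) u)) \<in> borel_measurable M"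
        by (rule unif.borel_measurable_lebesgue_integral) (simp add: case_prod_beta)
      then show "(\<lambda>w. indicator X (?R w) * (LINT u|unif. indicat_real Y (\<phi> (U b w) u))) \<in> borel_measurable M"
        by measurable
      have "AE w in M. cond b (\<lambda>w. indicator Y (U a w)) w = (LINT u|unif. indicator Y (\<phi> (U b w) u))"
        using \<phi> Y by (simp add: update_kernel_def)
      then show "AE w in M. indicator X (?R w) * cond b (\<lambda>w. indicator Y (U a w)) w =
          indicator X (?R w) * (LINT u|unif. indicator Y (\<phi> (U b w) u))"
        by eventually_elim simp
    qed measurable
    also have "\<dots> = (LINT w|M. (LINT u|unif. indicator X (?R w) * indicator Y (\<phi> (U b w) u)))" by simp
    also have "\<dots> = (LINT z|?P. indicator X (?R (fst z)) * indicator Y (\<phi> (U b (fst z)) (snd z)))"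
      by (subst pair.integral_fst'[symmetric])
        (auto intro!: pair.P.integrable_const_bound[where B = 1] m simp: indicator_def)
    also have "\<dots> = measure ?P (W -` (X \<times> Y) \<inter> space ?P)"
      by (rule measure_eq_integral[symmetric]) (auto simp: indicator_def W_def)
    finally show "emeasure (distr M ?K V) (X \<times> Y) =
        emeasure (distr ?P ?K W) (X \<times> Y)"
      using V W XY by (simp add: emeasure_distr emeasure_eq_measure pair.P.emeasure_eq_measure)
  qed (auto intro: D.finite_measure_axioms)
  define h where "h p = g ((fst p)(a := snd p))" for p
  have h: "bdd_borel ?K h"
    unfolding h_def by (rule bdd_borel_compose[OF fun_upd_measurable[OF measurable_fst measurable_snd] g])
  note mh = bdd_borel_measurable[OF h]
  have "(LINT w|M. g (restricted (insert a S) U w)) = integral\<^sup>L (distr M ?K V) h"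
    unfolding integral_distr[OF V mh] by (simp add: h_def V_def restricted_insert)
  also have "\<dots> = (LINT z|?P. h (W z))"
    unfolding law integral_distr[OF W mh] ..
  also have "\<dots> = (LINT w|M. (LINT u|unif. h (W (w, u))))"
    by (rule pair.integral_fst'[symmetric])
      (intro pair.P.bdd_borel_integrable bdd_borel_compose[OF W h])
  also have "\<dots> = (LINT w|M. kernel_average \<phi> b a g (?R w))"
    using S by (simp add: h_def W_def kernel_average_def restricted_def)
  finally show ?thesis .
qed

lemma grown_root: "grown E Q i S \<Longrightarrow> finite S \<and> i \<in> S"
  by (induction rule: grown.induct) auto

text \<open>Averaging out the node attached last leaves a bounded increasing function of the smaller
  vector. It does not touch coordinate \<open>i\<close>, so it commutes with multiplication by
  functions of \<open>U i\<close> and leaves the conditional expectation given \<open>U i\<close>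
  unchanged.\<close>

lemma increasing_restricted:
  assumes "grown E (\<lambda>b a. increasing_in M (U a) (U b)) i S" "S \<subseteq> N"
    and "bdd_borel (borel_vec UNIV) g" "mono g"
  shows "\<exists>d. bounded_mono d \<and> (AE w in M. cond i (\<lambda>w. g (restricted S U w)) w = d (U i w))"
  using assms
proof (induction arbitrary: g rule: grown.induct)
  case single
  define d where "d x = g (\<lambda>n. if n = i then x else 0)" for x
  obtain c where c: "\<And>y. \<bar>g y\<bar> \<le> c" using bdd_borel_vec_bound single by blast
  have "mono d" unfolding d_def using single(3) by (auto intro!: monoI monoD[OF single(3)] simp: le_fun_def)
  then have d: "bounded_mono d" using c unfolding bounded_mono_def d_def by blast
  have Ui: "U i \<in> borel_measurable M" using single U_measurable by auto
  have eq: "g (restricted {i} U w) = d (U i w)" for w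
    unfolding d_def restricted_def by (intro arg_cong[where f = g]) auto
  have "AE w in M. cond i (\<lambda>w. d (U i w)) w = d (U i w)"
  proof (rule sigma_finite_subalgebra.real_cond_exp_F_meas[OF generated_sigma_finite[OF Ui]])
    show "integrable M (\<lambda>w. d (U i w))"
      by (rule bdd_borel_integrable[OF bdd_borel_compose[OF Ui bounded_mono_borel[OF d]]])
    show "(\<lambda>w. d (U i w)) \<in> borel_measurable (generated M (U i))"
      by (rule generated_measurable_compose[OF bdd_borel_measurable[OF bounded_mono_borel[OF d]]])
  qed
  then show ?case using d unfolding eq by blast
next
  case (attach S b a)
  have S: "finite S" "S \<subseteq> N" "uconnected E S" "b \<in> S" "i \<in> S"
    using attach grown_root grown_uconnected by auto
  have a: "a \<in> N" "a \<notin> S" "a \<in> neighbours E b" using attach by auto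
  have Ui: "U i \<in> borel_measurable M" using S U_measurable by auto
  obtain \<phi> where \<phi>: "update_kernel M (U a) (U b) \<phi>"
    using ex_update_kernel[of b a] S a attach by blast
  then have \<phi>m: "monotone_kernel \<phi>" by (simp add: update_kernel_def)
  let ?k = "kernel_average \<phi> b a g"
  have bk: "bdd_borel (borel_vec UNIV) ?k"
    by (rule bdd_borel_kernel_average[OF \<phi>m attach(8)])
  obtain d where d: "bounded_mono d" "AE w in M. cond i (\<lambda>w. ?k (restricted S U w)) w = d (U i w)"
    using attach.IH[OF S(2) bk mono_kernel_average[OF \<phi>m attach(8,9)]] by blast
  have "AE w in M. cond i (\<lambda>w. g (restricted (insert a S) U w)) w = d (U i w)"
  proof (rule cond_exp_generated_unique[OF Ui])
    show "integrable M (\<lambda>w. g (restricted (insert a S) U w))"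
      by (intro bdd_borel_integrable bdd_borel_compose[OF restricted_U_measurable] attach)
    show "d \<in> borel_measurable borel"
      by (rule bdd_borel_measurable[OF bounded_mono_borel[OF d(1)]])
    show "integrable M (\<lambda>w. d (U i w))"
      by (rule bdd_borel_integrable[OF bdd_borel_compose[OF Ui bounded_mono_borel[OF d(1)]]])
    fix A :: "real set" assume A [measurable]: "A \<in> sets borel"
    have ind: "bdd_borel (borel_vec UNIV) (\<lambda>y. indicator A (y i))"
      by (rule bdd_borel_compose[OF _ bdd_borel_indicator[OF A]]) simp
    have "(LINT w|M. indicator A (restricted (insert a S) U w i) * g (restricted (insert a S) U w)) =
      (LINT w|M. kernel_average \<phi> b a (\<lambda>y. indicator A (y i) * g y) (restricted S U w))"
      by (rule kernel_extend[OF S(1-4) a \<phi> bdd_borel_mult[OF ind attach(8)]])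
    also have "\<dots> = (LINT w|M. indicator A (U i w) * ?k (restricted S U w))"
    proof -
      have "i \<noteq> a" using S(5) a(2) by blast
      then have "kernel_average \<phi> b a (\<lambda>y. indicator A (y i) * g y) y = indicator A (y i) * ?k y" for y
        by (simp add: kernel_average_def)
      moreover have "restricted S U w i = U i w" for w using S(5) by (simp add: restricted_def)
      ultimately show ?thesis by simp
    qed
    also have "\<dots> = (LINT w|M. indicator A (U i w) * cond i (\<lambda>w. ?k (restricted S U w)) w)"
      by (rule cond_exp_generated_integral[symmetric, OF Ui bdd_borel_indicator[OF A]])
        (intro bdd_borel_integrable bdd_borel_compose[OF restricted_U_measurable] S bk)
    also have "\<dots> = (LINT w|M. indicator A (U i w) * d (U i w))"
    proof (rule integral_cong_AE)
      have "(\<lambda>w. d (U i w)) \<in> borel_measurable M"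
        by (rule measurable_compose[OF Ui bdd_borel_measurable[OF bounded_mono_borel[OF d(1)]]])
      then show "(\<lambda>w. indicator A (U i w) * d (U i w)) \<in> borel_measurable M"
        using Ui by measurable
    qed (use Ui d(2) in auto)
    finally show "(LINT w|M. indicator A (U i w) * g (restricted (insert a S) U w)) =
        (LINT w|M. indicator A (U i w) * d (U i w))"
      using S(5) by (simp add: restricted_def)
  qed
  then show ?case using d by blast
qed

end

subsection \<open>Comparison of pairs\<close>

lemma nat_floor_cell:
  fixes a e :: real
  assumes "e > 0"
  shows "real (nat \<lfloor>a / e\<rfloor>) * e \<le> max 0 a" "a < real (nat \<lfloor>a / e\<rfloor>) * e + e"
proof -
  consider "0 \<le> \<lfloor>a / e\<rfloor>" | "\<lfloor>a / e\<rfloor> < 0" by linarith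
  then have "real (nat \<lfloor>a / e\<rfloor>) * e \<le> max 0 a \<and> a < real (nat \<lfloor>a / e\<rfloor>) * e + e"
  proof cases
    case 1
    then have "real (nat \<lfloor>a / e\<rfloor>) \<le> a / e" "a / e < real (nat \<lfloor>a / e\<rfloor>) + 1" by linarith+
    then show ?thesis using assms by (auto simp: field_simps)
  next
    case 2
    then have "a / e < 0" by linarith
    then have "a < 0" using assms by (simp add: field_simps)
    then show ?thesis using 2 assms by simp
  qed
  then show "real (nat \<lfloor>a / e\<rfloor>) * e \<le> max 0 a" "a < real (nat \<lfloor>a / e\<rfloor>) * e + e" by auto
qed

lemma nat_floor_mono: "e > 0 \<Longrightarrow> a \<le> b \<Longrightarrow> nat \<lfloor>a / e\<rfloor> \<le> nat \<lfloor>b / e\<rfloor>" for a b e :: real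
  by (intro nat_mono floor_mono divide_right_mono) auto

text \<open>Level sets of increasing functions are rays that may be open or closed; the predicate
  avoids the distinction.\<close>

definition up_set :: "real set \<Rightarrow> bool" where
  "up_set A \<longleftrightarrow> (\<forall>x y. x \<in> A \<longrightarrow> x \<le> y \<longrightarrow> y \<in> A)"

lemma up_set_borel:
  assumes "up_set A"
  shows "A \<in> sets borel"
proof -
  have "mono (indicator A :: real \<Rightarrow> real)"
    using assms unfolding up_set_def mono_def indicator_def by auto
  then have "indicat_real A \<in> borel_measurable borel" by (rule borel_measurable_mono)
  then show ?thesis by (simp add: borel_measurable_indicator_iff)
qed

text \<open>Supermodularity applied to \<open>y(j := z')\<close> and \<open>y'(j := z)\<close>,
  whose meet and join are the two vectors on the right. In this form it says that increments in
  coordinate \<open>j\<close> grow with the other coordinates.\<close>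

lemma supermodular_update:
  assumes "supermodular UNIV g" "y \<le> y'" "z \<le> z'"
  shows "g (y(j := z')) + g (y'(j := z)) \<le> g (y(j := z)) + g (y'(j := z'))"
proof -
  have "inf (y(j := z')) (y'(j := z)) = y(j := z)" "sup (y(j := z')) (y'(j := z)) = y'(j := z')"
    using assms(2,3) by (auto simp: fun_eq_iff le_fun_def inf_absorb1 inf_absorb2 sup_absorb1 sup_absorb2)
  then show ?thesis using assms(1) unfolding supermodular_UNIV by metis
qed

text \<open>The increments of \<open>z \<mapsto> g (y(j := z))\<close> are dominated by those for \<open>y = 1\<close>, so the last
  coordinate can be discretised along the level sets of the latter, uniformly in \<open>y\<close>; summation by
  parts then leaves increasing functions of \<open>y\<close> multiplied by indicators of up-sets.\<close>

lemma supermodular_coupling: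
  fixes W :: "'a \<Rightarrow> nat \<Rightarrow> real" and W' :: "'b \<Rightarrow> nat \<Rightarrow> real"
  assumes M: "prob_space M" and M': "prob_space M'"
    and W: "W \<in> M \<rightarrow>\<^sub>M borel_vec UNIV" and W': "W' \<in> M' \<rightarrow>\<^sub>M borel_vec UNIV"
    and Z: "Z \<in> borel_measurable M" and Z': "Z' \<in> borel_measurable M'"
    and unit: "\<And>w n. w \<in> space M \<Longrightarrow> W w n \<in> {0..1}" "\<And>w n. w \<in> space M' \<Longrightarrow> W' w n \<in> {0..1}"
      "\<And>w. w \<in> space M \<Longrightarrow> Z w \<in> {0..1}" "\<And>w. w \<in> space M' \<Longrightarrow> Z' w \<in> {0..1}"
    and lawW: "\<And>f. bdd_borel (borel_vec UNIV) f \<Longrightarrow> (LINT w|M. f (W w)) = (LINT w|M'. f (W' w))"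
    and lawZ: "\<And>f. bdd_borel borel f \<Longrightarrow> (LINT w|M. f (Z w)) = (LINT w|M'. f (Z' w))"
    and lo: "\<And>A d. up_set A \<Longrightarrow> bdd_borel (borel_vec UNIV) d \<Longrightarrow> mono d \<Longrightarrow>
      (LINT w|M. indicator A (Z w) * d (W w)) \<le> (LINT w|M'. indicator A (Z' w) * d (W' w))"
    and g: "bdd_borel (borel_vec UNIV) g" "supermodular UNIV g"
  shows "(LINT w|M. g ((W w)(j := Z w))) \<le> (LINT w|M'. g ((W' w)(j := Z' w)))"
proof -
  define y0 :: "nat \<Rightarrow> real" where "y0 = (\<lambda>_. 0)"
  define y1 :: "nat \<Rightarrow> real" where "y1 = (\<lambda>_. 1)"
  have y01: "y0 \<le> y1" by (simp add: y0_def y1_def le_fun_def)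
  \<comment> \<open>Subtracting the values at \<open>y0\<close> makes the increments of
    \<open>g' y\<close> lie between 0 and those of \<open>G\<close>. The subtracted term depends on
    the last coordinate alone, so \<open>lawZ\<close> restores it at the end.\<close>
  define g' where "g' y z = g (y(j := z)) - g (y0(j := z))" for y z
  have g'_mono: "g' y z' - g' y z \<le> g' y' z' - g' y' z" if "y \<le> y'" "z \<le> z'" for y y' z z'
    using supermodular_update[OF g(2) that, of j] by (simp add: g'_def)
  define G where "G = g' y1"
  have g'0: "g' y0 z = 0" for z by (simp add: g'_def)
  have G_mono: "z \<le> z' \<Longrightarrow> G z \<le> G z'" for z z'
    using g'_mono[OF y01, of z z'] by (simp add: G_def g'0)
  obtain c where c: "\<And>y. \<bar>g y\<bar> \<le> c" using bdd_borel_vec_bound[OF g(1)] by blast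
  have G_bound: "G z - G 0 \<le> 4 * c" for z
    using c[of "y1(j := z)"] c[of "y0(j := z)"] c[of "y1(j := 0)"] c[of "y0(j := 0)"]
    by (auto simp: G_def g'_def abs_le_iff)
  have b_g: "bdd_borel (borel_vec UNIV) (\<lambda>y. g (y(j := z)))" for z
    by (rule bdd_borel_compose[OF fun_upd_measurable g(1)]) simp_all
  have b_g0: "bdd_borel borel (\<lambda>z. g (y0(j := z)))"
    by (rule bdd_borel_compose[OF fun_upd_measurable g(1)]) (simp_all add: space_PiM)
  have b_g': "bdd_borel (borel_vec UNIV) (\<lambda>y. g' y z)" for z
    unfolding g'_def by (intro bdd_borel_diff b_g bdd_borel_const)
  have main: "(LINT w|M. g' (W w) (Z w)) \<le> (LINT w|M'. g' (W' w) (Z' w))"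
  proof (rule field_le_epsilon)
    fix \<epsilon> :: real assume "\<epsilon> > 0"
    \<comment> \<open>A discretisation error of at most \<open>e\<close> arises on each side of the
      comparison.\<close>
    define e where "e = \<epsilon> / 2"
    have e: "e > 0" using \<open>\<epsilon> > 0\<close> by (simp add: e_def)
    define k where "k z = nat \<lfloor>(G z - G 0) / e\<rfloor>" for z
    define K where "K = nat \<lfloor>(4 * c) / e\<rfloor>"
    have kK: "k z \<le> K" for z
      unfolding k_def K_def by (intro nat_floor_mono[OF e] G_bound)
    have k_mono: "z \<le> z' \<Longrightarrow> k z \<le> k z'" for z z'
      unfolding k_def using G_mono[of z z'] by (intro nat_floor_mono[OF e]) auto
    have k0: "k 0 = 0" by (simp add: k_def)
    \<comment> \<open>One point from every cell of the partition of the unit interval by the values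
      of \<open>k\<close>. If \<open>G\<close> jumps over a cell, the previous point is kept, so
      that \<open>rep\<close> stays increasing and the increment across the empty cell
      vanishes.\<close>
    define rep where "rep = rec_nat (0::real)
      (\<lambda>l r. if \<exists>z\<in>{0..1}. k z = Suc l then (SOME z. z \<in> {0..1} \<and> k z = Suc l) else r)"
    have rep0: "rep 0 = 0" by (simp add: rep_def)
    have repS: "rep (Suc l) = (if \<exists>z\<in>{0..1}. k z = Suc l then (SOME z. z \<in> {0..1} \<and> k z = Suc l) else rep l)" for l
      unfolding rep_def by (simp only: old.nat.rec)
    have some: "(SOME z. z \<in> {0..1} \<and> k z = Suc l) \<in> {0..1} \<and> k (SOME z. z \<in> {0..1} \<and> k z = Suc l) = Suc l"
      if "\<exists>z\<in>{0..1}. k z = Suc l" for l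
      using someI_ex[of "\<lambda>z. z \<in> {0..1} \<and> k z = Suc l"] that by blast
    have rep_unit: "rep l \<in> {0..1}" for l
    proof (induction l)
      case (Suc l)
      then show ?case using some[of l] unfolding repS by (auto split: if_splits)
    qed (simp add: rep0)
    have k_rep: "k (rep l) \<le> l" for l
    proof (induction l)
      case (Suc l)
      then show ?case using some[of l] unfolding repS by (auto split: if_splits)
    qed (simp add: rep0 k0)
    have rep_Suc: "rep l \<le> rep (Suc l)" for l
    proof (cases "\<exists>z\<in>{0..1}. k z = Suc l")
      case True
      then have "k (rep l) < k (rep (Suc l))" using some[OF True] k_rep[of l] by (simp add: repS)
      then show ?thesis using k_mono[of "rep (Suc l)" "rep l"] by linarith
    qed (simp add: repS)
    have k_rep_k: "k (rep (k z)) = k z" if "z \<in> {0..1}" for z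
    proof (cases "k z")
      case (Suc l)
      then have "\<exists>z\<in>{0..1}. k z = Suc l" using that by blast
      then show ?thesis using some[of l] Suc by (simp add: repS)
    qed (simp add: rep0 k0)
    \<comment> \<open>\<open>z\<close> and its representative lie in the same cell, so
      \<open>G\<close> differs by at most \<open>e\<close> between them; the increment of
      \<open>g' y\<close> is squeezed between 0 and that of \<open>G\<close>, uniformly in
      \<open>y\<close>.\<close>
    have close: "\<bar>g' y z - g' y (rep (k z))\<bar> \<le> e" if "z \<in> {0..1}" "\<And>n. y n \<in> {0..1}" for y z
    proof -
      let ?r = "rep (k z)"
      have y: "y0 \<le> y" "y \<le> y1" using that(2) by (auto simp: y0_def y1_def le_fun_def)
      have same: "k ?r = k z" by (rule k_rep_k[OF that(1)])
      have nn: "G 0 \<le> G z" "G 0 \<le> G ?r" using rep_unit[of "k z"] that(1) by (auto intro: G_mono)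
      have "\<bar>G z - G ?r\<bar> \<le> e"
        using nat_floor_cell[OF e, of "G z - G 0"] nat_floor_cell[OF e, of "G ?r - G 0"] same nn
        unfolding k_def by (auto simp: abs_le_iff)
      then show ?thesis
      proof (cases "z \<le> ?r")
        case True
        show ?thesis using g'_mono[OF y(1) True] g'_mono[OF y(2) True] \<open>\<bar>G z - G ?r\<bar> \<le> e\<close>
          by (auto simp: g'0 G_def abs_le_iff)
      next
        case False
        then have "?r \<le> z" by simp
        then show ?thesis using g'_mono[OF y(1), of ?r z] g'_mono[OF y(2), of ?r z] \<open>\<bar>G z - G ?r\<bar> \<le> e\<close>
          by (auto simp: g'0 G_def abs_le_iff)
      qed
    qed
    define \<Delta> where "\<Delta> l y = g' y (rep (Suc l)) - g' y (rep l)" for l y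
    have b\<Delta>: "bdd_borel (borel_vec UNIV) (\<Delta> l)" for l
      unfolding \<Delta>_def[abs_def] by (intro bdd_borel_diff b_g')
    have mono\<Delta>: "mono (\<Delta> l)" for l
      unfolding \<Delta>_def[abs_def] by (intro monoI g'_mono rep_Suc)
    have up_k: "up_set {z. l < k z}" for l
      unfolding up_set_def using k_mono by (auto intro: less_le_trans)
    define s where "s y z = g' y 0 + (\<Sum>l<K. indicator {z. l < k z} z * \<Delta> l y)" for y z
    have s_eq: "s y z = g' y (rep (k z))" for y z
    proof -
      have "(\<Sum>l<K. indicator {z. l < k z} z * \<Delta> l y) = (\<Sum>l<k z. \<Delta> l y)"
        using kK[of z] by (intro sum.mono_neutral_cong_right) (auto simp: indicator_def)
      also have "\<dots> = g' y (rep (k z)) - g' y (rep 0)"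
        unfolding \<Delta>_def by (rule sum_lessThan_telescope)
      finally show ?thesis by (simp add: s_def rep0)
    qed
    have approx: "\<bar>(LINT w|Q. g' (X w) (V w)) - (LINT w|Q. s (X w) (V w))\<bar> \<le> e \<and>
        (LINT w|Q. s (X w) (V w)) = (LINT w|Q. g' (X w) 0) +
          (\<Sum>l<K. LINT w|Q. indicator {z. l < k z} (V w) * \<Delta> l (X w))"
      if Q: "prob_space Q" and X: "X \<in> Q \<rightarrow>\<^sub>M borel_vec UNIV" and V: "V \<in> borel_measurable Q"
        and u: "\<And>w n. w \<in> space Q \<Longrightarrow> X w n \<in> {0..1}" "\<And>w. w \<in> space Q \<Longrightarrow> V w \<in> {0..1}"
      for Q :: "'x measure" and X V
    proof -
      interpret Q: prob_space Q by fact
      have i1: "integrable Q (\<lambda>w. g' (X w) 0)"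
        by (intro Q.bdd_borel_integrable bdd_borel_compose[OF X] b_g')
      have i2: "integrable Q (\<lambda>w. indicator {z. l < k z} (V w) * \<Delta> l (X w))" for l
        by (intro Q.bdd_borel_integrable bdd_borel_mult bdd_borel_compose[OF X] b\<Delta>
            bdd_borel_compose[OF V bdd_borel_indicator] up_set_borel up_k)
      have i_s: "integrable Q (\<lambda>w. s (X w) (V w))"
        unfolding s_def by (intro Bochner_Integration.integrable_add Bochner_Integration.integrable_sum i1 i2)
      have ig: "integrable Q (\<lambda>w. g' (X w) (V w))"
      proof (intro Q.bdd_borel_integrable)
        show "bdd_borel Q (\<lambda>w. g' (X w) (V w))"
          unfolding g'_def by (intro bdd_borel_diff bdd_borel_compose[OF V b_g0] bdd_borel_compose[OF fun_upd_measurable[OF X V] g(1)])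
      qed
      have "(LINT w|Q. s (X w) (V w)) = (LINT w|Q. g' (X w) 0) +
          (\<Sum>l<K. LINT w|Q. indicator {z. l < k z} (V w) * \<Delta> l (X w))"
        unfolding s_def Bochner_Integration.integral_add[OF i1 Bochner_Integration.integrable_sum[OF i2]]
          Bochner_Integration.integral_sum[OF i2] ..
      moreover have "\<bar>(LINT w|Q. g' (X w) (V w)) - (LINT w|Q. s (X w) (V w))\<bar> \<le> e"
      proof -
        have "\<bar>LINT w|Q. g' (X w) (V w) - s (X w) (V w)\<bar> \<le> (LINT w|Q. \<bar>g' (X w) (V w) - s (X w) (V w)\<bar>)"
          by (rule integral_abs_bound)
        also have "\<dots> \<le> e"
        proof (rule Q.integral_le_const)
          show "integrable Q (\<lambda>w. \<bar>g' (X w) (V w) - s (X w) (V w)\<bar>)" using ig i_s by auto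
          show "AE w in Q. \<bar>g' (X w) (V w) - s (X w) (V w)\<bar> \<le> e"
            unfolding s_eq using u close by (intro AE_I2) auto
        qed
        finally show ?thesis using ig i_s by simp
      qed
      ultimately show ?thesis by blast
    qed
    have sums: "(\<Sum>l<K. LINT w|M. indicator {z. l < k z} (Z w) * \<Delta> l (W w)) \<le>
        (\<Sum>l<K. LINT w|M'. indicator {z. l < k z} (Z' w) * \<Delta> l (W' w))"
      by (intro sum_mono lo up_k b\<Delta> mono\<Delta>)
    have "(LINT w|M. s (W w) (Z w)) \<le> (LINT w|M'. s (W' w) (Z' w))"
      using approx[OF M W Z unit(1,3)] approx[OF M' W' Z' unit(2,4)] lawW[OF b_g'[of 0]] sums
      by simp
    then show "(LINT w|M. g' (W w) (Z w)) \<le> (LINT w|M'. g' (W' w) (Z' w)) + \<epsilon>"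
      using conjunct1[OF approx[OF M W Z unit(1,3)]] conjunct1[OF approx[OF M' W' Z' unit(2,4)]]
      unfolding e_def by linarith
  qed
  have split: "(LINT w|Q. g' (X w) (V w)) = (LINT w|Q. g ((X w)(j := V w))) - (LINT w|Q. g (y0(j := V w)))"
    if Q: "prob_space Q" and X: "X \<in> Q \<rightarrow>\<^sub>M borel_vec UNIV" and V: "V \<in> borel_measurable Q"
    for Q :: "'x measure" and X V
  proof -
    interpret Q: prob_space Q by fact
    show ?thesis
      unfolding g'_def
      by (intro Bochner_Integration.integral_diff Q.bdd_borel_integrable
          bdd_borel_compose[OF V b_g0] bdd_borel_compose[OF fun_upd_measurable[OF X V] g(1)])
  qed
  show ?thesis
    using main lawZ[OF b_g0] split[OF M W Z] split[OF M' W' Z'] by simp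
qed

subsection \<open>Comparison of processes on a tree\<close>

lemma (in prob_space) integral_cond_exp_version:
  assumes "U \<in> borel_measurable M" "d \<in> borel_measurable borel" "h \<in> borel_measurable M"
    and "AE w in M. real_cond_exp M (generated M U) Z w = d (U w)"
  shows "(LINT w|M. h w * real_cond_exp M (generated M U) Z w) = (LINT w|M. h w * d (U w))"
proof (rule integral_cong_AE)
  show "(\<lambda>w. h w * real_cond_exp M (generated M U) Z w) \<in> borel_measurable M"
    by (intro borel_measurable_times assms borel_measurable_cond_exp2)
  show "(\<lambda>w. h w * d (U w)) \<in> borel_measurable M"
    by (intro borel_measurable_times assms measurable_compose[OF assms(1,2)])
  show "AE w in M. h w * real_cond_exp M (generated M U) Z w = h w * d (U w)"
    using assms(4) by eventually_elim simp
qed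

text \<open>The problem after the distribution transform: marginals enter only through their common
  law, copulas only through the probabilities of upper orthants along edges.\<close>

locale process_comparison =
  X: markov_process N E M U + Y: markov_process N E M' V
  for N E and M :: "'a measure" and U and M' :: "'b measure" and V +
  fixes P :: "nat set" and k :: nat
  assumes path: "path_from_root N E P"
    and k: "(0, k) \<in> E" "node_degree E 0 \<ge> 2 \<Longrightarrow> k \<notin> P"
    and law: "\<And>n f. n \<in> N \<Longrightarrow> bdd_borel borel f \<Longrightarrow> (LINT w|M. f (U n w)) = (LINT w|M'. f (V n w))"
    and orthant: "\<And>i j A B. (i, j) \<in> E \<Longrightarrow> up_set A \<Longrightarrow> up_set B \<Longrightarrow>
      \<P>(w in M. U i w \<in> A \<and> U j w \<in> B) \<le> \<P>(w in M'. V i w \<in> A \<and> V j w \<in> B)"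
    and X_child: "\<And>i j. (i, j) \<in> E \<Longrightarrow> j \<noteq> k \<Longrightarrow> increasing_in M (U j) (U i)"
    and Y_parent: "\<And>i j. (i, j) \<in> E \<Longrightarrow> j \<notin> leaves N E \<Longrightarrow> increasing_in M' (V i) (V j)"
    and Y_child: "\<And>i j. (i, j) \<in> E \<Longrightarrow> j \<notin> P \<Longrightarrow> increasing_in M' (V j) (V i)"
begin

text \<open>Passes from orthants to increasing functions of the parent. The product of increasing
  functions of two different coordinates is supermodular, so the coupling lemma applies to the pair
  of \<open>indicator A (U j w)\<close> and \<open>U i w\<close>.\<close>

lemma edge_order:
  assumes e: "(i, j) \<in> E" and A: "up_set A" and d: "bounded_mono d"
  shows "(LINT w|M. indicator A (U j w) * d (U i w)) \<le> (LINT w|M'. indicator A (V j w) * d (V i w))"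
proof -
  note N = X.edge_nodes[OF e]
  obtain c where c: "\<And>x. \<bar>d x\<bar> \<le> c" using d by (auto simp: bounded_mono_def)
  \<comment> \<open>Clipping makes the product bounded on the whole space and does not change an
    indicator.\<close>
  define t where "t x = max 0 (min 1 x)" for x :: real
  define g where "g y = t (y 0) * d (y 1)" for y :: "nat \<Rightarrow> real"
  define r where "r x = (\<lambda>n. if n = (0::nat) then indicat_real A x else 0)" for x
  note bA = bdd_borel_indicator[OF up_set_borel[OF A]]
  have r: "r \<in> borel \<rightarrow>\<^sub>M borel_vec UNIV"
  proof (rule measurable_PiM_single')
    show "(\<lambda>x. r x n) \<in> borel \<rightarrow>\<^sub>M borel" for n
      unfolding r_def using bdd_borel_measurable[OF bA] by (cases "n = 0") auto
  qed auto
  have g: "bdd_borel (borel_vec UNIV) g"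
    unfolding g_def
  proof (rule bdd_borel_mult)
    show "bdd_borel (borel_vec UNIV) (\<lambda>y. t (y 0))"
      unfolding t_def by (rule bdd_borelI[where c = 1]) auto
    show "bdd_borel (borel_vec UNIV) (\<lambda>y. d (y 1))"
      by (rule bdd_borel_compose[OF _ bounded_mono_borel[OF d]]) simp
  qed
  have sm: "supermodular UNIV g"
    unfolding supermodular_UNIV
  proof (intro allI)
    fix x y :: "nat \<Rightarrow> real"
    have m: "0 \<le> (t v - t u) * (d v' - d u')" if "u \<le> v" "u' \<le> v'" for u v u' v'
      using that d by (intro mult_nonneg_nonneg) (auto simp: t_def bounded_mono_def mono_def)
    show "g x + g y \<le> g (inf x y) + g (sup x y)"
      using m[of "x 0" "y 0" "y 1" "x 1"] m[of "y 0" "x 0" "x 1" "y 1"]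
      by (cases "x 0 \<le> y 0"; cases "x 1 \<le> y 1")
        (auto simp: g_def inf_absorb1 inf_absorb2 sup_absorb1 sup_absorb2 algebra_simps)
  qed
  have "(LINT w|M. g ((r (U j w))(1 := U i w))) \<le> (LINT w|M'. g ((r (V j w))(1 := V i w)))"
  proof (rule supermodular_coupling[OF X.prob_space_axioms Y.prob_space_axioms
        measurable_compose[OF X.U_measurable[OF N(2)] r] measurable_compose[OF Y.U_measurable[OF N(2)] r]
        X.U_measurable[OF N(1)] Y.U_measurable[OF N(1)] _ _
        X.U_unit[OF N(1)] Y.U_unit[OF N(1)] law[OF N(2) bdd_borel_compose[OF r]] law[OF N(1)] _ g sm])
    show "r x n \<in> {0..1}" "r x n \<in> {0..1}" for x n by (auto simp: r_def)
    fix D and f :: "(nat \<Rightarrow> real) \<Rightarrow> real" assume D: "up_set D" and f: "mono f"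
    let ?s = "f (\<lambda>n. if n = 0 then 1 else 0) - f (\<lambda>n. 0)"
    note bD = bdd_borel_indicator[OF up_set_borel[OF D]]
    have s: "0 \<le> ?s" using monoD[OF f, of "\<lambda>n. 0"] by (simp add: le_fun_def)
    \<comment> \<open>On the image of \<open>r\<close> an increasing \<open>f\<close> has only two
      values, so it is a constant plus a nonnegative multiple of \<open>indicator A\<close>; the
      required inequality reduces to \<open>orthant\<close>.\<close>
    have fr: "indicator D x * f (r y) = f (\<lambda>n. 0) * indicator D x + ?s * (indicator D x * indicator A y)" for x y
      by (auto simp: r_def indicator_def algebra_simps cong: if_cong)
    have eval: "(LINT w|Q. indicator D (S w) * f (r (T w))) = f (\<lambda>n. 0) * (LINT w|Q. indicator D (S w)) +
        ?s * \<P>(w in Q. S w \<in> D \<and> T w \<in> A)"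
      if "prob_space Q" and S: "S \<in> borel_measurable Q" and T: "T \<in> borel_measurable Q" for Q :: "'x measure" and S T
    proof -
      interpret Q: prob_space Q by fact
      have "bdd_borel Q (\<lambda>w. indicat_real D (S w))" "bdd_borel Q (\<lambda>w. indicat_real D (S w) * indicat_real A (T w))"
        by (intro bdd_borel_mult bdd_borel_compose[OF S bD] bdd_borel_compose[OF T bA])+
      from this[THEN Q.bdd_borel_integrable]
      have "(LINT w|Q. indicator D (S w) * f (r (T w))) = f (\<lambda>n. 0) * (LINT w|Q. indicator D (S w)) +
          ?s * (LINT w|Q. indicator D (S w) * indicator A (T w))"
        unfolding fr by simp
      also have "(LINT w|Q. indicator D (S w) * indicator A (T w)) = \<P>(w in Q. S w \<in> D \<and> T w \<in> A)"
        by (rule measure_eq_integral[symmetric]) (auto simp: indicator_def)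
      finally show ?thesis .
    qed
    show "(LINT w|M. indicator D (U i w) * f (r (U j w))) \<le> (LINT w|M'. indicator D (V i w) * f (r (V j w)))"
      using mult_left_mono[OF orthant[OF e D A] s] law[OF N(1) bD]
      by (simp add: eval[OF X.prob_space_axioms] eval[OF Y.prob_space_axioms] X.U_measurable Y.U_measurable N)
  qed
  moreover have "g ((r x)(1 := y)) = indicator A x * d y" for x y
    by (simp add: g_def t_def r_def indicator_def)
  ultimately show ?thesis by simp
qed

lemma restricted_unit:
  "S \<subseteq> N \<Longrightarrow> restricted S U w n \<in> {0..1}" "S \<subseteq> N \<Longrightarrow> restricted S V w' n \<in> {0..1}"
  using X.U_unit Y.U_unit by (auto simp: restricted_def)

lemma root_in: "0 \<in> N"
  using X.nodes_0_1 by simp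

text \<open>The base case. It rests on the order of the pair alone, since no monotone kernel from
  the root to \<open>k\<close> is at hand.\<close>

lemma compare_first_edge:
  assumes g: "bdd_borel (borel_vec UNIV) g" "supermodular UNIV g"
  shows "(LINT w|M. g (restricted {0, k} U w)) \<le> (LINT w|M'. g (restricted {0, k} V w))"
proof -
  note kN = X.edge_nodes(2)[OF k(1)]
  have sub: "{0} \<subseteq> N" using root_in by simp
  define r where "r x = (\<lambda>n. if n = (0::nat) then x else 0)" for x :: real
  have rU: "restricted {0} U w = r (U 0 w)" for w by (auto simp: restricted_def r_def)
  have rV: "restricted {0} V w = r (V 0 w)" for w by (auto simp: restricted_def r_def)
  have r: "r \<in> borel \<rightarrow>\<^sub>M borel_vec UNIV"
  proof (rule measurable_PiM_single')
    show "(\<lambda>x. r x i) \<in> borel \<rightarrow>\<^sub>M borel" for i unfolding r_def by (cases "i = 0") auto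
  qed auto
  have "(LINT w|M. g ((restricted {0} U w)(k := U k w))) \<le> (LINT w|M'. g ((restricted {0} V w)(k := V k w)))"
  proof (rule supermodular_coupling[OF X.prob_space_axioms Y.prob_space_axioms
        X.restricted_U_measurable[OF sub] Y.restricted_U_measurable[OF sub]
        X.U_measurable[OF kN] Y.U_measurable[OF kN] restricted_unit(1)[OF sub] restricted_unit(2)[OF sub]
        X.U_unit[OF kN] Y.U_unit[OF kN] _ law[OF kN] _ g])
    fix f :: "(nat \<Rightarrow> real) \<Rightarrow> real" assume "bdd_borel (borel_vec UNIV) f"
    then show "(LINT w|M. f (restricted {0} U w)) = (LINT w|M'. f (restricted {0} V w))"
      unfolding rU rV by (intro law[OF root_in] bdd_borel_compose[OF r])
  next
    fix A and d :: "(nat \<Rightarrow> real) \<Rightarrow> real"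
    assume A: "up_set A" and d: "bdd_borel (borel_vec UNIV) d" "mono d"
    obtain c where "\<And>y. \<bar>d y\<bar> \<le> c" using bdd_borel_vec_bound[OF d(1)] by blast
    moreover have "mono (\<lambda>x. d (r x))"
      using d(2) by (auto intro!: monoI monoD[OF d(2)] simp: r_def le_fun_def)
    ultimately have "bounded_mono (\<lambda>x. d (r x))" unfolding bounded_mono_def by blast
    from edge_order[OF k(1) A this]
    show "(LINT w|M. indicator A (U k w) * d (restricted {0} U w)) \<le>
        (LINT w|M'. indicator A (V k w) * d (restricted {0} V w))"
      unfolding rU rV .
  qed
  then show ?thesis by (simp add: restricted_insert[symmetric] insert_commute)
qed

lemma edge_kernel_integral:
  assumes e: "(i, j) \<in> E" and \<phi>: "update_kernel M (U j) (U i) \<phi>"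
    and f: "bdd_borel borel f" and d: "bdd_borel borel d"
  shows "(LINT w|M. f (U j w) * d (U i w)) = (LINT w|M. (LINT u|unif. f (\<phi> (U i w) u)) * d (U i w))"
proof -
  note N = X.edge_nodes[OF e]
  have ij: "i \<noteq> j" using X.depth_child[OF e] by auto
  have b: "bdd_borel (borel_vec UNIV) (\<lambda>y. h (y n))" if "bdd_borel borel h" for h and n :: nat
    by (rule bdd_borel_compose[OF _ that]) simp
  have "(LINT w|M. f (restricted (insert j {i}) U w j) * d (restricted (insert j {i}) U w i)) =
      (LINT w|M. kernel_average \<phi> i j (\<lambda>y. f (y j) * d (y i)) (restricted {i} U w))"
    by (rule X.kernel_extend[OF _ _ uconnected_singleton _ N(2) _ _ \<phi>
        bdd_borel_mult[OF b[OF f] b[OF d]]])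
      (use N ij e in \<open>auto simp: neighbours_def\<close>)
  then show ?thesis using ij by (simp add: kernel_average_def restricted_def)
qed

lemma bdd_borel_kernel_integral:
  assumes \<phi>: "monotone_kernel \<phi>" and f: "bdd_borel borel f"
  shows "bdd_borel borel (\<lambda>x. LINT u|unif. f (\<phi> x u))"
proof -
  define r where "r x = (\<lambda>n::nat. x)" for x :: real
  have r: "r \<in> borel \<rightarrow>\<^sub>M borel_vec UNIV"
    unfolding r_def by (rule measurable_PiM_single') auto
  have "bdd_borel (borel_vec UNIV) (\<lambda>y. f (y 1))"
    by (rule bdd_borel_compose[OF _ f]) simp
  from bdd_borel_compose[OF r bdd_borel_kernel_average[OF \<phi> this, of 0 1]]
  show ?thesis by (simp add: kernel_average_def r_def)
qed

text \<open>Going up from \<open>i\<close>, every edge ends in a node that has a child, so that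
  \<open>Y_parent\<close> applies: \<open>i\<close> has the child \<open>j\<close>, the nodes above
  it lie on the way to \<open>j\<close>. Edges crossed downwards end outside the ancestors of
  \<open>i\<close>, hence outside \<open>P\<close>, and \<open>Y_child\<close> applies.\<close>

lemma grown_from_parent:
  assumes S: "finite S" "X.parent_closed S" "i \<in> S" and e: "(i, j) \<in> E"
    and P: "\<And>p. p \<in> P \<Longrightarrow> p \<in> S \<Longrightarrow> (p, i) \<in> E\<^sup>*"
  shows "grown E (\<lambda>b a. increasing_in M' (V a) (V b)) i S"
proof (rule X.grown_parent_closed[OF S])
  fix c d assume cd: "(c, d) \<in> E" "(d, i) \<in> E\<^sup>*"
  then have "(d, j) \<in> E\<^sup>+" using e by (rule_tac rtrancl_into_trancl1)
  then obtain x where "(d, x) \<in> E" by (meson tranclD)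
  then show "increasing_in M' (V c) (V d)" using Y_parent[OF cd(1)] X.inner_not_leaf by blast
next
  fix c d assume "(c, d) \<in> E" "d \<in> S" "(d, i) \<notin> E\<^sup>*"
  then show "increasing_in M' (V d) (V c)" using Y_child P by blast
qed

text \<open>Given \<open>V i\<close>, node \<open>j\<close> is independent of the other nodes of
  \<open>S\<close> on both sides. An increasing function of the vector on \<open>S\<close> can
  therefore be replaced by its conditional expectation given \<open>V i\<close>, which is again
  increasing, and what remains is an inequality for the single edge.\<close>

lemma compare_edge:
  assumes S: "finite S" "X.parent_closed S" "i \<in> S" and j: "j \<notin> S" and e: "(i, j) \<in> E"
    and P: "\<And>p. p \<in> P \<Longrightarrow> p \<in> S \<Longrightarrow> (p, i) \<in> E\<^sup>*"
    and \<phi>: "update_kernel M (U j) (U i) \<phi>"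
    and g: "bdd_borel (borel_vec UNIV) g" "supermodular UNIV g"
  shows "(LINT w|M'. kernel_average \<phi> i j g (restricted S V w)) \<le> (LINT w|M'. g (restricted (insert j S) V w))"
proof -
  interpret pair: pair_prob_space M' unif ..
  note N = X.edge_nodes[OF e]
  have SN: "S \<subseteq> N" using S by (simp add: X.parent_closed_def)
  have \<phi>m: "monotone_kernel \<phi>" using \<phi> by (simp add: update_kernel_def)
  have \<phi>u: "\<phi> x u \<in> {0..1}" for x u using \<phi>m by (simp add: monotone_kernel_def)
  let ?P = "M' \<Otimes>\<^sub>M unif"
  let ?R = "restricted S V"
  have R: "?R \<in> M' \<rightarrow>\<^sub>M borel_vec UNIV" by (rule Y.restricted_U_measurable[OF SN])
  have Vi: "V i \<in> borel_measurable M'" and Vj: "V j \<in> borel_measurable M'"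
    using Y.U_measurable N by auto
  have Ui: "U i \<in> borel_measurable M" using X.U_measurable N by auto
  \<comment> \<open>The hybrid process: \<open>V\<close> on \<open>S\<close>, with node
    \<open>j\<close> generated from \<open>V i\<close> by the kernel of \<open>U\<close>.\<close>
  define W where "W z = ?R (fst z)" for z :: "'b \<times> real"
  define Z where "Z z = \<phi> (V i (fst z)) (snd z)" for z
  have W: "W \<in> ?P \<rightarrow>\<^sub>M borel_vec UNIV" unfolding W_def using R by measurable
  have Z: "Z \<in> borel_measurable ?P"
    unfolding Z_def by (rule kernel_measurable[OF \<phi>m Vi])
  have fubini: "(LINT z|?P. f z) = (LINT w|M'. (LINT u|unif. f (w, u)))"
    if "bdd_borel ?P f" for f
    by (rule pair.integral_fst'[symmetric]) (rule pair.P.bdd_borel_integrable[OF that])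
  have "(LINT z|?P. g ((W z)(j := Z z))) \<le> (LINT w|M'. g ((?R w)(j := V j w)))"
  proof (rule supermodular_coupling[OF pair.P.prob_space_axioms Y.prob_space_axioms W R Z Vj _ _ _ _ _ _ _ g])
    show "W z n \<in> {0..1}" "?R w n \<in> {0..1}" for z w n
      using restricted_unit(2)[OF SN] unfolding W_def by auto
    show "Z z \<in> {0..1}" for z unfolding Z_def by (rule \<phi>u)
    show "V j w \<in> {0..1}" for w by (rule Y.U_unit[OF N(2)])
    show "(LINT z|?P. f (W z)) = (LINT w|M'. f (?R w))" if "bdd_borel (borel_vec UNIV) f" for f
      using fubini[OF bdd_borel_compose[OF W that]] by (simp add: W_def)
    show "(LINT z|?P. f (Z z)) = (LINT w|M'. f (V j w))" if f: "bdd_borel borel f" for f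
    proof -
      have "(LINT z|?P. f (Z z)) = (LINT w|M'. (LINT u|unif. f (\<phi> (V i w) u)))"
        using fubini[OF bdd_borel_compose[OF Z f]] by (simp add: Z_def)
      also have "\<dots> = (LINT w|M. (LINT u|unif. f (\<phi> (U i w) u)))"
        by (rule law[OF N(1) bdd_borel_kernel_integral[OF \<phi>m f], symmetric])
      also have "\<dots> = (LINT w|M. f (U j w))"
        using edge_kernel_integral[OF e \<phi> f bdd_borel_const[of _ 1]] by simp
      also have "\<dots> = (LINT w|M'. f (V j w))" by (rule law[OF N(2) f])
      finally show ?thesis .
    qed
    fix A and d :: "(nat \<Rightarrow> real) \<Rightarrow> real"
    assume A: "up_set A" and d: "bdd_borel (borel_vec UNIV) d" "mono d"
    have bA: "bdd_borel borel (indicat_real A)" by (intro bdd_borel_indicator up_set_borel A)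
    define \<kappa> where "\<kappa> x = (LINT u|unif. indicat_real A (\<phi> x u))" for x
    have b\<kappa>: "bdd_borel borel \<kappa>" unfolding \<kappa>_def by (rule bdd_borel_kernel_integral[OF \<phi>m bA])
    obtain \<delta> where \<delta>: "bounded_mono \<delta>" "AE w in M'. Y.cond i (\<lambda>w. d (?R w)) w = \<delta> (V i w)"
      using Y.increasing_restricted[OF grown_from_parent[OF S e P] SN d] by blast
    have b\<delta>: "bdd_borel borel \<delta>" by (rule bounded_mono_borel[OF \<delta>(1)])
    have bd: "bdd_borel M' (\<lambda>w. d (?R w))" by (rule bdd_borel_compose[OF R d(1)])
    have m\<delta>: "\<delta> \<in> borel_measurable borel" by (rule bdd_borel_measurable[OF b\<delta>])
    have "(LINT z|?P. indicator A (Z z) * d (W z)) = (LINT w|M'. \<kappa> (V i w) * d (?R w))"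
      using fubini[OF bdd_borel_mult[OF bdd_borel_compose[OF Z bA] bdd_borel_compose[OF W d(1)]]]
      by (simp add: Z_def W_def \<kappa>_def)
    also have "\<dots> = (LINT w|M'. \<kappa> (V i w) * Y.cond i (\<lambda>w. d (?R w)) w)"
      by (rule Y.cond_exp_generated_integral[OF Vi b\<kappa> Y.bdd_borel_integrable[OF bd], symmetric])
    also have "\<dots> = (LINT w|M'. \<kappa> (V i w) * \<delta> (V i w))"
      by (rule Y.integral_cond_exp_version[OF Vi m\<delta> _ \<delta>(2)])
        (rule bdd_borel_measurable[OF bdd_borel_compose[OF Vi b\<kappa>]])
    \<comment> \<open>Only coordinate \<open>i\<close> is left, so the equality of laws permits the
      change from \<open>V\<close> to \<open>U\<close>, where \<open>\<kappa>\<close> turns back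
      into the event at node \<open>j\<close>.\<close>
    also have "\<dots> = (LINT w|M. \<kappa> (U i w) * \<delta> (U i w))"
      by (rule law[OF N(1) bdd_borel_mult[OF b\<kappa> b\<delta>], symmetric])
    also have "\<dots> = (LINT w|M. indicator A (U j w) * \<delta> (U i w))"
      unfolding \<kappa>_def by (rule edge_kernel_integral[OF e \<phi> bA b\<delta>, symmetric])
    also have "\<dots> \<le> (LINT w|M'. indicator A (V j w) * \<delta> (V i w))"
      by (rule edge_order[OF e A \<delta>(1)])
    also have "\<dots> = (LINT w|M'. indicator A (V j w) * Y.cond i (\<lambda>w. d (?R w)) w)"
      by (rule Y.integral_cond_exp_version[OF Vi m\<delta> _ \<delta>(2), symmetric])
        (rule bdd_borel_measurable[OF bdd_borel_compose[OF Vj bA]])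
    also have "\<dots> = (LINT w|M'. d (?R w) * Y.cond i (\<lambda>w. indicator A (V j w)) w)"
      using Y.cond_exp_swap[OF Vi bd bdd_borel_compose[OF Vj bA]] by (simp add: mult.commute)
    also have "\<dots> = (LINT w|M'. d (?R w) * indicator A (V j w))"
      by (rule Y.markov_indicator[symmetric, OF S(1) SN X.parent_closed_uconnected[OF S] S(3) N(2) j _ d(1) up_set_borel[OF A]])
        (use e in \<open>auto simp: neighbours_def\<close>)
    finally show "(LINT z|?P. indicator A (Z z) * d (W z)) \<le> (LINT w|M'. indicator A (V j w) * d (?R w))"
      by (simp add: mult.commute)
  qed
  moreover have "(LINT z|?P. g ((W z)(j := Z z))) = (LINT w|M'. kernel_average \<phi> i j g (?R w))"
  proof -
    from fubini[OF bdd_borel_compose[OF fun_upd_measurable[OF W Z] g(1)]] S(3) show ?thesis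
      by (simp add: W_def Z_def kernel_average_def restricted_def)
  qed
  ultimately show ?thesis by (simp add: restricted_insert)
qed

text \<open>Node \<open>j\<close> is first integrated out of \<open>U\<close>. The induction
  hypothesis, applied to the averaged function, replaces \<open>U\<close> by \<open>V\<close> on the
  smaller set; then the kernel of \<open>U\<close> attached to \<open>V\<close> is exchanged for the
  edge of \<open>V\<close>. Keeping \<open>0\<close> and \<open>k\<close> in the set ends the
  induction at \<open>{0, k}\<close>.\<close>

lemma compare_parent_closed:
  assumes "finite S" "X.parent_closed S" "0 \<in> S" "k \<in> S"
    and "bdd_borel (borel_vec UNIV) g" "supermodular UNIV g"
  shows "(LINT w|M. g (restricted S U w)) \<le> (LINT w|M'. g (restricted S V w))"
  using assms
proof (induction "card S" arbitrary: S g rule: less_induct)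
  case less
  show ?case
  proof (cases "S = {0, k}")
    case True
    then show ?thesis using compare_first_edge less by simp
  next
    case False
    have SN: "S \<subseteq> N" using less by (simp add: X.parent_closed_def)
    obtain i j where ij: "(i, j) \<in> E" "j \<in> S" "j \<noteq> 0" "j \<noteq> k" "X.parent_closed (S - {j})"
      "i \<in> S" "i \<noteq> j" "\<And>p. p \<in> P \<Longrightarrow> p \<in> S - {j} \<Longrightarrow> (p, i) \<in> E\<^sup>*"
      using X.removable_node[OF less(2-4) False less(5) k path] by blast
    let ?S = "S - {j}"
    have ins: "insert j ?S = S" using ij by auto
    have S': "finite ?S" "X.parent_closed ?S" "0 \<in> ?S" "k \<in> ?S" "i \<in> ?S" using less ij by auto
    have card: "card ?S < card S" using less(2) ij(2) by (rule card_Diff1_less)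
    obtain \<phi> where \<phi>: "update_kernel M (U j) (U i) \<phi>"
      using X.ex_update_kernel[OF X.edge_nodes[OF ij(1)] X_child[OF ij(1,4)]] by blast
    have \<phi>m: "monotone_kernel \<phi>" using \<phi> by (simp add: update_kernel_def)
    have "(LINT w|M. g (restricted S U w)) = (LINT w|M. kernel_average \<phi> i j g (restricted ?S U w))"
      using X.kernel_extend[OF S'(1) _ X.parent_closed_uconnected[OF S'(1,2,5)] S'(5) _ _ _ \<phi> less(6)]
        SN ij ins by (auto simp: neighbours_def)
    also have "\<dots> \<le> (LINT w|M'. kernel_average \<phi> i j g (restricted ?S V w))"
      by (rule less(1)[OF card S'(1-4) bdd_borel_kernel_average[OF \<phi>m less(6)]
          supermodular_kernel_average[OF \<phi>m less(6,7)]])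
    also have "\<dots> \<le> (LINT w|M'. g (restricted (insert j ?S) V w))"
      by (rule compare_edge[OF S'(1,2,5) _ ij(1) ij(8) \<phi> less(6,7)]) auto
    finally show ?thesis unfolding ins .
  qed
qed

end

subsection \<open>Distribution transforms\<close>

definition down_set :: "real set \<Rightarrow> bool" where
  "down_set D \<longleftrightarrow> (\<forall>x y. y \<in> D \<longrightarrow> x \<le> y \<longrightarrow> x \<in> D)"

text \<open>Reduces open rays and the whole line to closed rays, whose probabilities are values of
  distribution functions.\<close>

lemma down_set_exhaustion:
  assumes D: "down_set D" "D \<noteq> {}"
  obtains a where "incseq a" "D = (\<Union>n::nat. {..a n})"
proof (cases "bdd_above D")
  case False
  have "D = UNIV"
  proof (intro equalityI subsetI UNIV_I)
    fix x
    obtain y where "y \<in> D" "x < y" using False by (meson bdd_above.I not_le)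
    then show "x \<in> D" using D by (auto simp: down_set_def)
  qed
  moreover have "(\<Union>n::nat. {..real n}) = UNIV" by (auto intro: real_arch_simple)
  ultimately show ?thesis using that[of real] by (auto simp: incseq_def)
next
  case True
  define s where "s = Sup D"
  have le: "x \<le> s" if "x \<in> D" for x using cSup_upper[OF that True] by (simp add: s_def)
  have lt: "x \<in> D" if "x < s" for x
    using less_cSupD[of D x] D that by (auto simp: s_def down_set_def intro: less_imp_le)
  show ?thesis
  proof (cases "s \<in> D")
    case True
    then have "D = {..s}" using le D by (auto simp: down_set_def)
    then show ?thesis using that[of "\<lambda>_. s"] by (auto simp: incseq_def)
  next
    case False
    have "D = (\<Union>n. {..s - 1 / real (Suc n)})"
    proof (intro equalityI subsetI)
      fix x assume "x \<in> D"
      then have "x < s" using le False by (metis less_eq_real_def)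
      then obtain n where "inverse (real (Suc n)) < s - x" using reals_Archimedean[of "s - x"] by auto
      then have "x \<le> s - 1 / real (Suc n)" by (simp add: inverse_eq_divide)
      then show "x \<in> (\<Union>n. {..s - 1 / real (Suc n)})" by auto
    next
      fix x assume "x \<in> (\<Union>n. {..s - 1 / real (Suc n)})"
      then obtain n where "x \<le> s - 1 / real (Suc n)" by auto
      then have "x < s" by (smt (verit) divide_pos_pos of_nat_0_less_iff zero_less_Suc)
      then show "x \<in> D" by (rule lt)
    qed
    moreover have "incseq (\<lambda>n. s - 1 / real (Suc n))"
      by (auto simp: incseq_def intro!: divide_left_mono)
    ultimately show ?thesis using that by blast
  qed
qed

lemma down_set_borel: "down_set D \<Longrightarrow> D \<in> sets borel"
  by (cases "D = {}") (auto elim!: down_set_exhaustion)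

lemma up_set_Compl: "up_set A \<Longrightarrow> down_set (- A)"
  by (auto simp: up_set_def down_set_def)

text \<open>Rectangles with a side on the boundary of the unit square give monotonicity and the
  Lipschitz bound in each argument.\<close>

lemma copula_increment:
  assumes C: "copula C" and u: "0 \<le> u" "u \<le> u'" "u' \<le> 1" and v: "0 \<le> v" "v \<le> 1"
  shows "0 \<le> C u' v - C u v" "C u' v - C u v \<le> u' - u"
    "0 \<le> C v u' - C v u" "C v u' - C v u \<le> u' - u"
proof -
  have two: "u1 \<in> {0..1} \<Longrightarrow> u2 \<in> {0..1} \<Longrightarrow> v1 \<in> {0..1} \<Longrightarrow> v2 \<in> {0..1} \<Longrightarrow> u1 \<le> u2 \<Longrightarrow> v1 \<le> v2 \<Longrightarrow>
      C u2 v2 - C u2 v1 - C u1 v2 + C u1 v1 \<ge> 0" for u1 u2 v1 v2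
    using C unfolding copula_def by blast
  have bd: "x \<in> {0..1} \<Longrightarrow> C x 0 = 0 \<and> C 0 x = 0 \<and> C x 1 = x \<and> C 1 x = x" for x
    using C unfolding copula_def by blast
  show "0 \<le> C u' v - C u v" "C u' v - C u v \<le> u' - u"
    "0 \<le> C v u' - C v u" "C v u' - C v u \<le> u' - u"
    using two[of u u' 0 v] two[of u u' v 1] two[of 0 v u u'] two[of v 1 u u'] bd[of u] bd[of u'] u v
    by auto
qed

context prob_space
begin

lemma measure_le_mono:
  assumes [measurable]: "X \<in> borel_measurable M" and "x \<le> (y::real)"
  shows "\<P>(w in M. X w \<le> x) \<le> \<P>(w in M. X w \<le> y)"
proof (rule finite_measure_mono)
  show "{w \<in> space M. X w \<le> x} \<subseteq> {w \<in> space M. X w \<le> y}"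
    using assms(2) by (auto intro: order_trans[OF _ assms(2)])
  show "{w \<in> space M. X w \<le> y} \<in> sets M" by measurable
qed

lemma measure_down_set_le:
  fixes X :: "'a \<Rightarrow> real"
  assumes X: "X \<in> borel_measurable M" and D: "down_set D"
    and le: "\<And>x. x \<in> D \<Longrightarrow> \<P>(w in M. X w \<le> x) \<le> c" and c: "0 \<le> c"
  shows "\<P>(w in M. X w \<in> D) \<le> c"
proof (cases "D = {}")
  case False
  then obtain a where a: "incseq a" "D = (\<Union>n::nat. {..a n})" using down_set_exhaustion D by blast
  have "(\<lambda>n. \<P>(w in M. X w \<le> a n)) \<longlonglongrightarrow> measure M (\<Union>n. {w \<in> space M. X w \<le> a n})"
    using X a(1) by (intro finite_Lim_measure_incseq) (auto simp: incseq_def intro: order_trans)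
  moreover have "(\<Union>n. {w \<in> space M. X w \<le> a n}) = {w \<in> space M. X w \<in> D}" using a(2) by auto
  moreover have "\<P>(w in M. X w \<le> a n) \<le> c" for n using le a(2) by auto
  ultimately show ?thesis by (auto intro: LIMSEQ_le_const2)
qed (use c in simp)

text \<open>The preimage of a lower ray under a distribution function may be an open ray, for which
  the copula formula is obtained as a limit of closed rays; the Lipschitz property of
  \<open>C\<close> gives convergence on the right-hand side.\<close>

lemma copula_down_sets:
  fixes X Y :: "'a \<Rightarrow> real"
  assumes X: "X \<in> borel_measurable M" and Y: "Y \<in> borel_measurable M"
    and joint: "\<And>x y. \<P>(w in M. X w \<le> x \<and> Y w \<le> y) =
      C (\<P>(w in M. X w \<le> x)) (\<P>(w in M. Y w \<le> y))"
    and C: "copula C" and D: "down_set D" "down_set D'"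
  shows "\<P>(w in M. X w \<in> D \<and> Y w \<in> D') =
    C (\<P>(w in M. X w \<in> D)) (\<P>(w in M. Y w \<in> D'))"
proof (cases "D = {} \<or> D' = {}")
  case True
  then show ?thesis using C by (auto simp: copula_def)
next
  case False
  obtain a where a: "incseq a" "D = (\<Union>n::nat. {..a n})" using down_set_exhaustion D False by metis
  obtain b where b: "incseq b" "D' = (\<Union>n::nat. {..b n})" using down_set_exhaustion D False by metis
  define p where "p = \<P>(w in M. X w \<in> D)"
  define q where "q = \<P>(w in M. Y w \<in> D')"
  define u where "u n = \<P>(w in M. X w \<le> a n)" for n
  define v where "v n = \<P>(w in M. Y w \<le> b n)" for n
  note meas = X [measurable] Y [measurable]
  have mD [measurable]: "D \<in> sets borel" "D' \<in> sets borel" using D by (auto intro: down_set_borel)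
  have u: "u \<longlonglongrightarrow> p"
  proof -
    have "u \<longlonglongrightarrow> measure M (\<Union>n. {w \<in> space M. X w \<le> a n})"
      unfolding u_def using a(1) by (intro finite_Lim_measure_incseq) (auto simp: incseq_def intro: order_trans)
    also have "(\<Union>n. {w \<in> space M. X w \<le> a n}) = {w \<in> space M. X w \<in> D}" using a(2) by auto
    finally show ?thesis by (simp add: p_def)
  qed
  have v: "v \<longlonglongrightarrow> q"
  proof -
    have "v \<longlonglongrightarrow> measure M (\<Union>n. {w \<in> space M. Y w \<le> b n})"
      unfolding v_def using b(1) by (intro finite_Lim_measure_incseq) (auto simp: incseq_def intro: order_trans)
    also have "(\<Union>n. {w \<in> space M. Y w \<le> b n}) = {w \<in> space M. Y w \<in> D'}" using b(2) by auto
    finally show ?thesis by (simp add: q_def)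
  qed
  have pq: "p \<le> 1" "q \<le> 1" unfolding p_def q_def by auto
  have bounds: "0 \<le> u n" "u n \<le> p" "0 \<le> v n" "v n \<le> q" for n
    unfolding u_def v_def p_def q_def using a(2) b(2) by (auto intro!: finite_measure_mono)
  have "(\<lambda>n. C (u n) (v n)) \<longlonglongrightarrow> C p q"
  proof (rule tendsto_sandwich[where f = "\<lambda>n. C p q - (p - u n) - (q - v n)" and h = "\<lambda>_. C p q"])
    have inc: "C p q - (p - u n) - (q - v n) \<le> C (u n) (v n) \<and> C (u n) (v n) \<le> C p q" for n
    proof -
      have "0 \<le> v n" "v n \<le> 1" "u n \<le> 1" "0 \<le> q" "0 \<le> p" using bounds[of n] pq by linarith+
      then show ?thesis
        using copula_increment(1,2)[OF C, where u = "u n" and u' = p and v = q]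
          copula_increment(3,4)[OF C, where u = "v n" and u' = q and v = "u n"] bounds[of n] pq
        by linarith
    qed
    then show "\<forall>\<^sub>F n in sequentially. C p q - (p - u n) - (q - v n) \<le> C (u n) (v n)"
      "\<forall>\<^sub>F n in sequentially. C (u n) (v n) \<le> C p q" by auto
    have "(\<lambda>n. C p q - (p - u n) - (q - v n)) \<longlonglongrightarrow> C p q - (p - p) - (q - q)"
      by (intro tendsto_diff tendsto_const u v)
    then show "(\<lambda>n. C p q - (p - u n) - (q - v n)) \<longlonglongrightarrow> C p q" by simp
  qed simp
  moreover have "(\<lambda>n. C (u n) (v n)) \<longlonglongrightarrow> \<P>(w in M. X w \<in> D \<and> Y w \<in> D')"
  proof -
    have "(\<lambda>n. \<P>(w in M. X w \<le> a n \<and> Y w \<le> b n)) \<longlonglongrightarrow>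
        measure M (\<Union>n. {w \<in> space M. X w \<le> a n \<and> Y w \<le> b n})"
      using a(1) b(1) by (intro finite_Lim_measure_incseq) (auto simp: incseq_def intro: order_trans)
    also have "(\<Union>n. {w \<in> space M. X w \<le> a n \<and> Y w \<le> b n}) = {w \<in> space M. X w \<in> D \<and> Y w \<in> D'}"
    proof (intro equalityI subsetI)
      fix w assume "w \<in> {w \<in> space M. X w \<in> D \<and> Y w \<in> D'}"
      then obtain n m where "w \<in> space M" "X w \<le> a n" "Y w \<le> b m" using a(2) b(2) by auto
      moreover have "a n \<le> a (max n m)" "b m \<le> b (max n m)"
        using a(1) b(1) by (auto simp: incseq_def)
      ultimately have "w \<in> space M" "X w \<le> a (max n m)" "Y w \<le> b (max n m)" by linarith+
      then show "w \<in> (\<Union>n. {w \<in> space M. X w \<le> a n \<and> Y w \<le> b n})" by blast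
    qed (use a(2) b(2) in auto)
    finally show ?thesis unfolding joint u_def v_def .
  qed
  ultimately show ?thesis unfolding p_def q_def by (rule LIMSEQ_unique[symmetric])
qed

text \<open>Flat pieces of \<open>F\<close> carry no mass to the right of their left end. If
  \<open>x < X w\<close> with \<open>F (X w) \<le> F x\<close>, a rational \<open>q\<close> between
  them lies on the same flat piece, and exceeding \<open>q\<close> without exceeding its value of
  \<open>F\<close> has probability 0; countably many \<open>q\<close> suffice.\<close>

lemma AE_cdf_minimal:
  fixes X :: "'a \<Rightarrow> real"
  assumes X: "X \<in> borel_measurable M" and F: "\<And>x. F x = \<P>(w in M. X w \<le> x)"
  shows "AE w in M. \<forall>x. F (X w) \<le> F x \<longrightarrow> X w \<le> x"
proof -
  note X [measurable]
  have F_mono: "x \<le> y \<Longrightarrow> F x \<le> F y" for x y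
    unfolding F by (rule measure_le_mono[OF X])
  have "AE w in M. \<not> (q < X w \<and> F (X w) \<le> F q)" for q
  proof -
    let ?D = "{x. F x \<le> F q}"
    let ?N = "{w \<in> space M. q < X w \<and> X w \<in> ?D}" and ?L = "{w \<in> space M. X w \<le> q}"
    have D: "down_set ?D" using F_mono unfolding down_set_def by (auto intro: order_trans)
    note [measurable] = down_set_borel[OF D]
    have le: "\<P>(w in M. X w \<in> ?D) \<le> F q"
      by (rule measure_down_set_le[OF X D]) (auto simp: F)
    have split: "{w \<in> space M. X w \<in> ?D} = ?L \<union> ?N"
    proof -
      have "F (X w) \<le> F q" if "X w \<le> q" for w using F_mono[OF that] .
      then show ?thesis by (auto simp: not_le)
    qed
    have sum: "measure M (?L \<union> ?N) =
        F q + prob ?N"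
    proof -
      have "?L \<in> sets M" "?N \<in> sets M"
        by measurable
      moreover have "?L \<inter> ?N = {}" by auto
      ultimately show ?thesis by (simp only: finite_measure_Union F[of q, symmetric])
    qed
    have "F q + prob ?N \<le> F q"
      using le unfolding split sum .
    then have "prob ?N = 0"
      using measure_nonneg[of M "?N"] by linarith
    moreover have "?N \<in> sets M" by measurable
    ultimately show ?thesis
      by (intro AE_I[where N = "?N"])
        (auto simp: emeasure_eq_measure)
  qed
  then have "AE w in M. \<forall>q\<in>\<rat>. \<not> (q < X w \<and> F (X w) \<le> F q)"
    by (simp add: AE_ball_countable countable_rat)
  then show ?thesis
  proof eventually_elim
    case (elim w)
    show ?case
    proof (intro allI impI, rule ccontr)
      fix x assume x: "F (X w) \<le> F x" "\<not> X w \<le> x"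
      then obtain q where "q \<in> \<rat>" "x < q" "q < X w" using Rats_dense_in_real[of x "X w"] by auto
      then show False using elim x F_mono[of x q] by (meson less_imp_le order_trans)
    qed
  qed
qed

end

text \<open>The event \<open>F (X w) < u\<close> means that \<open>X w\<close> lies in a down-set,
  whose probability is the supremum of the values \<open>F x < u\<close>. Each such value is
  approximated by values of \<open>G\<close> below \<open>u\<close>, so the law of the transform
  depends on the closure of the range only.\<close>

lemma cdf_transform_le:
  fixes X :: "'a \<Rightarrow> real" and Y :: "'b \<Rightarrow> real"
  assumes M: "prob_space M" and X: "X \<in> borel_measurable M"
    and F: "\<And>x. F x = \<P>(w in M. X w \<le> x)"
    and M': "prob_space M'" and Y: "Y \<in> borel_measurable M'"
    and G: "\<And>x. G x = \<P>(w in M'. Y w \<le> x)"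
    and ran: "closure (range F) = closure (range G)"
  shows "\<P>(w in M. F (X w) < u) \<le> \<P>(w in M'. G (Y w) < u)"
proof -
  interpret X: prob_space M by fact
  interpret Y: prob_space M' by fact
  note X [measurable] Y [measurable]
  have F_mono: "x \<le> y \<Longrightarrow> F x \<le> F y" for x y
    unfolding F by (rule X.measure_le_mono[OF X])
  have G_mono: "x \<le> y \<Longrightarrow> G x \<le> G y" for x y
    unfolding G by (rule Y.measure_le_mono[OF Y])
  have mG [measurable]: "G \<in> borel_measurable borel"
    using G_mono by (intro borel_measurable_mono) (auto simp: mono_def)
  have "\<P>(w in M. X w \<in> {x. F x < u}) \<le> \<P>(w in M'. G (Y w) < u)"
  proof (rule X.measure_down_set_le[OF X])
    show "down_set {x. F x < u}" using F_mono unfolding down_set_def by (auto intro: le_less_trans)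
    fix x assume x: "x \<in> {x. F x < u}"
    have "F x \<le> \<P>(w in M'. G (Y w) < u)"
    proof (rule field_le_epsilon)
      fix e :: real assume e: "e > 0"
      have "F x \<in> closure (range G)" using ran by (metis closure_subset rangeI subsetD)
      \<comment> \<open>The bound \<open>u - F x\<close> keeps the approximating value of
        \<open>G\<close> below \<open>u\<close>.\<close>
      moreover have "0 < min e (u - F x)" using x e by simp
      ultimately obtain z where "z \<in> range G" "dist z (F x) < min e (u - F x)"
        unfolding closure_approachable by blast
      then obtain y where y: "dist (G y) (F x) < min e (u - F x)" by blast
      then have "G y < u" "F x \<le> G y + e" by (auto simp: dist_real_def)
      have "G y \<le> \<P>(w in M'. G (Y w) < u)"
        unfolding G[of y] using G_mono \<open>G y < u\<close> by (intro Y.finite_measure_mono) (auto intro: le_less_trans)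
      then show "F x \<le> \<P>(w in M'. G (Y w) < u) + e" using \<open>F x \<le> G y + e\<close> by linarith
    qed
    then show "\<P>(w in M. X w \<le> x) \<le> \<P>(w in M'. G (Y w) < u)"
      by (simp add: F)
  qed simp
  then show ?thesis by simp
qed

lemma cdf_transform_law:
  fixes X :: "'a \<Rightarrow> real" and Y :: "'b \<Rightarrow> real"
  assumes M: "prob_space M" and X: "X \<in> borel_measurable M"
    and F: "\<And>x. F x = \<P>(w in M. X w \<le> x)"
    and M': "prob_space M'" and Y: "Y \<in> borel_measurable M'"
    and G: "\<And>x. G x = \<P>(w in M'. Y w \<le> x)"
    and ran: "closure (range F) = closure (range G)"
  shows "distr M borel (\<lambda>w. F (X w)) = distr M' borel (\<lambda>w. G (Y w))"
proof -
  interpret X: prob_space M by fact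
  interpret Y: prob_space M' by fact
  note X [measurable] Y [measurable]
  have "mono F" "mono G"
    unfolding F[abs_def] G[abs_def]
    using X.measure_le_mono[OF X] Y.measure_le_mono[OF Y] by (auto intro: monoI)
  then have [measurable]: "F \<in> borel_measurable borel" "G \<in> borel_measurable borel"
    by (auto intro: borel_measurable_mono)
  have eq: "\<P>(w in M. F (X w) < u) = \<P>(w in M'. G (Y w) < u)" for u
    by (rule antisym[OF cdf_transform_le[OF M X F M' Y G ran] cdf_transform_le[OF M' Y G M X F ran[symmetric]]])
  show ?thesis
  proof (rule measure_eqI_generator_eq[where E = "range lessThan" and \<Omega> = UNIV and A = "\<lambda>n. {..<real n}"])
    show "Int_stable (range lessThan :: real set set)"
    proof (rule Int_stableI)
      fix S T :: "real set" assume "S \<in> range lessThan" "T \<in> range lessThan"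
      then obtain a b where "S = {..<a}" "T = {..<b}" by blast
      then have "S \<inter> T = {..<min a b}" by auto
      then show "S \<inter> T \<in> range lessThan" by blast
    qed
    show "sets (distr M borel (\<lambda>w. F (X w))) = sigma_sets UNIV (range lessThan)"
      "sets (distr M' borel (\<lambda>w. G (Y w))) = sigma_sets UNIV (range lessThan)"
      unfolding borel_Iio by simp_all
    show "(\<Union>n. {..<real n}) = UNIV" by (auto intro: reals_Archimedean2)
    show "emeasure (distr M borel (\<lambda>w. F (X w))) {..<real n} \<noteq> \<infinity>" for n
      by (simp add: emeasure_distr X.emeasure_eq_measure)
    fix S :: "real set" assume "S \<in> range lessThan"
    then obtain u where S: "S = {..<u}" by auto
    have "(\<lambda>w. F (X w)) -` S \<inter> space M = {w \<in> space M. F (X w) < u}"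
      "(\<lambda>w. G (Y w)) -` S \<inter> space M' = {w \<in> space M'. G (Y w) < u}" using S by auto
    then show "emeasure (distr M borel (\<lambda>w. F (X w))) S = emeasure (distr M' borel (\<lambda>w. G (Y w))) S"
      using eq S by (simp add: emeasure_distr X.emeasure_eq_measure Y.emeasure_eq_measure)
  qed auto
qed

text \<open>\<open>clipped_quantile F l h\<close> recovers from \<open>F x\<close>, for almost every \<open>x\<close>, its value clipped to \<open>[l, h]\<close>, and unlike the
  quantile function itself it is real-valued and monotone on the whole line.\<close>

definition clipped_quantile :: "(real \<Rightarrow> real) \<Rightarrow> real \<Rightarrow> real \<Rightarrow> real \<Rightarrow> real" where
  "clipped_quantile F l h u = Inf (insert h {x \<in> {l..h}. u \<le> F x})"

lemma clipped_quantile_bdd: "bdd_below (insert h {x \<in> {l..h}. u \<le> F x})" for l h u :: real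
  by (rule bdd_belowI[where m = "min l h"]) auto

lemma mono_clipped_quantile: "mono (clipped_quantile F l h)"
  unfolding clipped_quantile_def
  by (intro monoI cInf_superset_mono clipped_quantile_bdd) auto

lemma clipped_quantile_antimono:
  assumes "\<And>x. G x \<le> F x"
  shows "clipped_quantile F l h u \<le> clipped_quantile G l h u"
  unfolding clipped_quantile_def using assms
  by (intro cInf_superset_mono clipped_quantile_bdd) (auto intro: order_trans)

lemma clipped_quantile_bounds:
  assumes "l \<le> h"
  shows "l \<le> clipped_quantile F l h u" "clipped_quantile F l h u \<le> h"
  unfolding clipped_quantile_def using assms
  by (auto intro!: cInf_greatest cInf_lower clipped_quantile_bdd)

lemma clipped_quantile_eq:
  assumes "l \<le> h" "mono F" and x: "\<And>y. F x \<le> F y \<Longrightarrow> x \<le> y"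
  shows "clipped_quantile F l h (F x) = max l (min h x)"
  unfolding clipped_quantile_def
proof (rule cInf_eq_minimum)
  show "max l (min h x) \<in> insert h {y \<in> {l..h}. F x \<le> F y}"
    using assms(1) monoD[OF assms(2), of x l] by (auto simp: max_def min_def)
  fix y assume "y \<in> insert h {y \<in> {l..h}. F x \<le> F y}"
  then show "max l (min h x) \<le> y" using assms(1) x[of y] by (auto simp: min_def max_def)
qed

text \<open>What matters is a measurable function that inverts \<open>F\<close> at almost every
  value of the variable; there the clipped quantiles are eventually constant in
  \<open>n\<close>.\<close>

definition quantile :: "(real \<Rightarrow> real) \<Rightarrow> real \<Rightarrow> real" where
  "quantile F u = lim (\<lambda>n. clipped_quantile F (- real n) (real n) u)"

lemma quantile_measurable: "quantile F \<in> borel_measurable borel"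
  unfolding quantile_def[abs_def]
  by (intro borel_measurable_lim_metric borel_measurable_mono mono_clipped_quantile)

lemma quantile_eq:
  assumes "mono F" and x: "\<And>y. F x \<le> F y \<Longrightarrow> x \<le> y"
  shows "quantile F (F x) = x"
proof -
  obtain m where m: "\<bar>x\<bar> \<le> real m" using real_arch_simple by blast
  have "clipped_quantile F (- real n) (real n) (F x) = x" if "n \<ge> m" for n
  proof -
    have "\<bar>x\<bar> \<le> real n" using m that by linarith
    then show ?thesis using clipped_quantile_eq[OF _ assms(1) x, of "- real n" "real n"] by auto
  qed
  then have "(\<lambda>n. clipped_quantile F (- real n) (real n) (F x)) \<longlonglongrightarrow> x"
    by (intro tendsto_eventually eventually_sequentiallyI)
  then show ?thesis unfolding quantile_def by (rule limI)
qed

text \<open>\<open>X\<close> is almost surely a function of \<open>F (X w)\<close>, so the two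
  variables generate the same sigma-algebra up to null sets.\<close>

lemma (in prob_space) cond_exp_transform:
  assumes X: "X \<in> borel_measurable M" and F: "F \<in> borel_measurable borel" and q: "q \<in> borel_measurable borel"
    and inv: "AE w in M. q (F (X w)) = X w" and Z: "integrable M Z"
  shows "AE w in M. real_cond_exp M (generated M X) Z w = real_cond_exp M (generated M (\<lambda>w. F (X w))) Z w"
proof (rule sigma_finite_subalgebra.real_cond_exp_charact[OF generated_sigma_finite[OF X]])
  let ?U = "\<lambda>w. F (X w)"
  let ?R = "real_cond_exp M (generated M ?U) Z"
  have U: "?U \<in> borel_measurable M" using X F by measurable
  show iR: "integrable M ?R" by (rule cond_exp_integrable[OF U Z])
  have "sets (generated M ?U) \<subseteq> sets (generated M X)"
  proof
    fix A assume "A \<in> sets (generated M ?U)"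
    then obtain B where B: "B \<in> sets borel" "A = ?U -` B \<inter> space M" by (auto simp: sets_generated)
    have "F -` B \<in> sets borel" using measurable_sets[OF F B(1)] by simp
    moreover have "A = X -` (F -` B) \<inter> space M" using B by auto
    ultimately show "A \<in> sets (generated M X)" by (auto simp: sets_generated)
  qed
  then have "subalgebra (generated M X) (generated M ?U)"
    by (auto simp: subalgebra_def space_generated)
  then show "?R \<in> borel_measurable (generated M X)"
    by (rule measurable_from_subalg) (rule borel_measurable_cond_exp)
  show "integrable M Z" by fact
  fix A assume "A \<in> sets (generated M X)"
  then obtain B where B: "B \<in> sets borel" "A = X -` B \<inter> space M" by (auto simp: sets_generated)
  note X [measurable] U [measurable] q [measurable] B(1) [measurable]
  have A: "(LINT w|M. indicator A w * W w) = (LINT w|M. indicator (q -` B) (?U w) * W w)"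
    if W [measurable]: "W \<in> borel_measurable M" for W :: "'a \<Rightarrow> real"
  proof (rule integral_cong_AE)
    have qB: "q -` B \<in> sets borel" using measurable_sets[OF q B(1)] by simp
    then have [measurable]: "(\<lambda>w. indicat_real (q -` B) (?U w)) \<in> borel_measurable M" by measurable
    have "A \<in> sets M" unfolding B(2) by measurable
    then show "(\<lambda>w. indicator A w * W w) \<in> borel_measurable M" by measurable
    show "(\<lambda>w. indicator (q -` B) (?U w) * W w) \<in> borel_measurable M" by measurable
    show "AE w in M. indicator A w * W w = indicator (q -` B) (?U w) * W w"
      using inv AE_space by eventually_elim (auto simp: B(2) indicator_def)
  qed
  have qB: "q -` B \<in> sets borel" using measurable_sets[OF q B(1)] by simp
  have "(LINT w|M. indicator A w * Z w) = (LINT w|M. indicator (q -` B) (?U w) * Z w)"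
    by (rule A) (use Z in auto)
  also have "\<dots> = (LINT w|M. indicator (q -` B) (?U w) * ?R w)"
    by (rule cond_exp_generated_integral[OF U bdd_borel_indicator[OF qB] Z, symmetric])
  also have "\<dots> = (LINT w|M. indicator A w * ?R w)"
    by (rule A[symmetric]) (use iR in auto)
  finally show "set_lebesgue_integral M A Z = set_lebesgue_integral M A ?R"
    by (simp add: set_lebesgue_integral_def)
qed

section \<open>Transforming a Markov tree model into the unit cube\<close>

locale markov_tree_model = tree N E + prob_space M
  for N E and M :: "'a measure" +
  fixes X :: "nat \<Rightarrow> 'a \<Rightarrow> real" and F :: "nat \<Rightarrow> real \<Rightarrow> real" and B :: "nat \<times> nat \<Rightarrow> real \<Rightarrow> real \<Rightarrow> real"
  assumes distributed: "markov_tree_distributed M X F N E B"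
    and copulas: "\<And>e. e \<in> E \<Longrightarrow> copula (B e)"
begin

lemma X_measurable: "n \<in> N \<Longrightarrow> X n \<in> borel_measurable M"
  using distributed by (simp add: markov_tree_distributed_def)

lemma F_eq: "n \<in> N \<Longrightarrow> F n x = \<P>(w in M. X n w \<le> x)"
proof -
  assume n: "n \<in> N"
  then have "F n x = cdf (distr M borel (X n)) x"
    using distributed by (auto simp: markov_tree_distributed_def)
  also have "\<dots> = measure M (X n -` {..x} \<inter> space M)"
    unfolding cdf_def using X_measurable[OF n] by (simp add: measure_distr)
  also have "X n -` {..x} \<inter> space M = {w \<in> space M. X n w \<le> x}" by auto
  finally show ?thesis .
qed

lemma F_mono: "n \<in> N \<Longrightarrow> mono (F n)"
  using F_eq measure_le_mono[OF X_measurable] by (auto intro!: monoI)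

lemma F_measurable: "n \<in> N \<Longrightarrow> F n \<in> borel_measurable borel"
  by (intro borel_measurable_mono F_mono)

definition U :: "nat \<Rightarrow> 'a \<Rightarrow> real" where
  "U n w = F n (X n w)"

lemma U_borel: "n \<in> N \<Longrightarrow> U n \<in> borel_measurable M"
  unfolding U_def[abs_def] using measurable_compose[OF X_measurable F_measurable] by blast

lemma AE_minimal: "n \<in> N \<Longrightarrow> AE w in M. \<forall>x. F n (X n w) \<le> F n x \<longrightarrow> X n w \<le> x"
  by (rule AE_cdf_minimal[OF X_measurable F_eq])

lemma AE_clipped_quantile:
  assumes "n \<in> N" "l \<le> h"
  shows "AE w in M. clipped_quantile (F n) l h (U n w) = max l (min h (X n w))"
  using AE_minimal[OF assms(1)]
  by eventually_elim (auto simp: U_def intro!: clipped_quantile_eq assms F_mono)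

lemma AE_quantile: "n \<in> N \<Longrightarrow> AE w in M. quantile (F n) (F n (X n w)) = X n w"
  using AE_minimal[of n] by (auto elim!: eventually_mono intro!: quantile_eq F_mono)

lemma cond_exp_X_U:
  "n \<in> N \<Longrightarrow> integrable M Z \<Longrightarrow>
    AE w in M. real_cond_exp M (generated M (X n)) Z w = real_cond_exp M (generated M (U n)) Z w"
  unfolding U_def[abs_def]
  by (rule cond_exp_transform[OF X_measurable F_measurable quantile_measurable AE_quantile])

text \<open>Events of the transformed subvectors are events of the original ones, and conditioning
  on \<open>U i\<close> agrees with conditioning on \<open>X i\<close>.\<close>

lemma markov_tree_U: "markov_tree M U N E"
  unfolding markov_tree_def
proof (intro allI impI)
  fix J K i
  assume a: "J \<subseteq> N \<and> K \<subseteq> N \<and> finite J \<and> finite K \<and> J \<inter> K = {} \<and> i \<in> N \<and> separates E i J K"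
  then have ci: "cond_indep_given M (X i) (borel_vec J) (subvector J X) (borel_vec K) (subvector K X)"
    using distributed by (auto simp: markov_tree_distributed_def markov_tree_def)
  have i: "i \<in> N" using a by blast
  have tm: "(\<lambda>x. \<lambda>n\<in>J. F n (x n)) \<in> borel_vec J \<rightarrow>\<^sub>M borel_vec J" if "J \<subseteq> N" for J
    using that by (intro measurable_restrict measurable_compose[OF _ F_measurable]) auto
  have sub: "subvector J U w = (\<lambda>n\<in>J. F n (subvector J X w n))" for J w
    by (auto simp: subvector_def U_def)
  define T where "T J A = (\<lambda>x. \<lambda>n\<in>J. F n (x n)) -` A \<inter> space (borel_vec J)" for J A
  have T: "T J A \<in> sets (borel_vec J)" if "J \<subseteq> N" "A \<in> sets (borel_vec J)" for J A
    unfolding T_def using tm[OF that(1)] that(2) by (rule measurable_sets)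
  have TU: "indicat_real A (subvector J U w) = indicator (T J A) (subvector J X w)" for J A w
  proof -
    have "subvector J X w \<in> space (borel_vec J)" by (simp add: subvector_def space_PiM)
    then show ?thesis unfolding sub T_def by (auto simp: indicator_def)
  qed
  have b: "bdd_borel M (\<lambda>w. indicat_real (T J A) (subvector J X w))"
    if "J \<subseteq> N" "A \<in> sets (borel_vec J)" for J A
    by (rule bdd_borel_compose[OF subvector_measurable bdd_borel_indicator[OF T[OF that]]])
      (use that X_measurable in auto)
  show "cond_indep_given M (U i) (borel_vec J) (subvector J U) (borel_vec K) (subvector K U)"
    unfolding cond_indep_given_def TU
  proof (intro ballI)
    fix A D assume A: "A \<in> sets (borel_vec J)" and D: "D \<in> sets (borel_vec K)"
    let ?A = "\<lambda>w. indicat_real (T J A) (subvector J X w)"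
    let ?D = "\<lambda>w. indicat_real (T K D) (subvector K X w)"
    have bA: "bdd_borel M ?A" and bD: "bdd_borel M ?D" using b a A D by auto
    have "AE w in M. real_cond_exp M (generated M (X i)) (\<lambda>w. ?A w * ?D w) w =
        real_cond_exp M (generated M (X i)) ?A w * real_cond_exp M (generated M (X i)) ?D w"
      using ci T a A D unfolding cond_indep_given_def by blast
    with cond_exp_X_U[OF i bdd_borel_integrable[OF bA]] cond_exp_X_U[OF i bdd_borel_integrable[OF bD]]
      cond_exp_X_U[OF i bdd_borel_integrable[OF bdd_borel_mult[OF bA bD]]]
    show "AE w in M. real_cond_exp M (generated M (U i)) (\<lambda>w. ?A w * ?D w) w =
        real_cond_exp M (generated M (U i)) ?A w * real_cond_exp M (generated M (U i)) ?D w"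
      by eventually_elim simp
  qed
qed

lemma U_in_unit: "n \<in> N \<Longrightarrow> U n w \<in> {0..1}"
  by (simp add: U_def F_eq)

sublocale markov_process N E M U
  by unfold_locales (fact U_borel U_in_unit markov_tree_U)+

text \<open>The version \<open>g\<close> of the conditional expectation increases only off a null
  set \<open>Z\<close> and is a function of \<open>X i\<close>. It is carried over to
  \<open>U i\<close> by an infimum over the points beyond a given level, which increases everywhere;
  almost surely \<open>X i w\<close> is the least point of its level, so the infimum is attained
  there.\<close>

lemma increasing_U:
  assumes i: "i \<in> N" and j: "j \<in> N" and inc: "st_increasing_in M (X j) (X i)"
  shows "increasing_in M (U j) (U i)"
  unfolding increasing_in_def
proof (intro allI impI)
  fix h :: "real \<Rightarrow> real" assume h: "bounded_mono h"
  obtain c where c: "\<And>x. \<bar>h x\<bar> \<le> c" and hm: "mono h" using h by (auto simp: bounded_mono_def)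
  define f where "f x = h (F j x)" for x
  have fm: "mono f" unfolding f_def using monoD[OF F_mono[OF j]] monoD[OF hm] by (auto intro!: monoI)
  have hU: "bdd_borel M (\<lambda>w. h (U j w))"
    by (rule bdd_borel_compose[OF U_borel[OF j] bounded_mono_borel[OF h]])
  have fX: "f (X j w) = h (U j w)" for w by (simp add: f_def U_def)
  note iU = bdd_borel_integrable[OF hU]
  let ?R = "real_cond_exp M (generated M (X i)) (\<lambda>w. h (U j w))"
  obtain g where g: "g \<in> borel_measurable borel" "AE w in M. g (X i w) = ?R w"
    "\<exists>Z\<in>null_sets (distr M borel (X i)). mono_on (- Z) g"
    using inc fm iU unfolding st_increasing_in_def fX[symmetric] by blast
  then obtain Z where Z: "Z \<in> null_sets (distr M borel (X i))" "mono_on (- Z) g" by blast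
  define t where "t x = max (- c) (min c (g x))" for x
  \<comment> \<open>The added \<open>c\<close> keeps the infimum defined and within the bound when
    no point off \<open>Z\<close> reaches the level \<open>u\<close>.\<close>
  define S where "S u = insert c (t ` {x. x \<notin> Z \<and> u \<le> F i x})" for u
  define k where "k u = Inf (S u)" for u
  have c0: "0 \<le> c" using c[of 0] by linarith
  have bdd: "bdd_below (S u)" for u
    unfolding S_def by (rule bdd_belowI[where m = "- c"]) (use c0 in \<open>auto simp: t_def\<close>)
  have t_bounds: "- c \<le> t x" "t x \<le> c" for x using c0 by (auto simp: t_def)
  have "mono k"
    unfolding k_def by (intro monoI cInf_superset_mono bdd) (auto simp: S_def)
  moreover have "\<bar>k u\<bar> \<le> c" for u
  proof -
    have "- c \<le> k u" unfolding k_def S_def using t_bounds c0 by (intro cInf_greatest) auto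
    moreover have "k u \<le> c" unfolding k_def by (rule cInf_lower[OF _ bdd]) (simp add: S_def)
    ultimately show ?thesis by (simp add: abs_le_iff)
  qed
  ultimately have k: "bounded_mono k" unfolding bounded_mono_def by blast
  have "AE x in distr M borel (X i). x \<notin> Z" using Z(1) by (rule AE_not_in)
  then have notZ: "AE w in M. X i w \<notin> Z" by (rule AE_distrD[OF X_measurable[OF i]])
  note sf = generated_sigma_finite[OF X_measurable[OF i]]
  have "AE w in M. ?R w \<ge> - c"
    by (rule sigma_finite_subalgebra.real_cond_exp_ge_c[OF sf iU]) (use c in \<open>auto simp: abs_le_iff minus_le_iff\<close>)
  moreover have "AE w in M. ?R w \<le> c"
    by (rule sigma_finite_subalgebra.real_cond_exp_le_c[OF sf iU]) (use c in \<open>auto simp: abs_le_iff\<close>)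
  ultimately have "AE w in M. ?R w = k (U i w)"
    using notZ g(2) AE_minimal[OF i]
  proof eventually_elim
    case (elim w)
    have tR: "t (X i w) = ?R w" using elim by (simp add: t_def)
    have "k (U i w) = t (X i w)"
      unfolding k_def
    proof (rule cInf_eq_minimum)
      show "t (X i w) \<in> S (U i w)" unfolding S_def U_def using elim by auto
      fix y assume "y \<in> S (U i w)"
      then consider "y = c" | x where "y = t x" "x \<notin> Z" "U i w \<le> F i x" by (auto simp: S_def)
      then show "t (X i w) \<le> y"
      proof cases
        case 2
        then have "X i w \<le> x" using elim by (simp add: U_def)
        then have "g (X i w) \<le> g x" by (intro mono_onD[OF Z(2)]) (use 2 elim in auto)
        then show ?thesis unfolding 2(1) t_def by linarith
      qed (use t_bounds in simp)
    qed
    then show ?case using tR by simp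
  qed
  with cond_exp_X_U[OF i iU]
  have "AE w in M. real_cond_exp M (generated M (U i)) (\<lambda>w. h (U j w)) w = k (U i w)"
    by eventually_elim simp
  then show "\<exists>k. bounded_mono k \<and>
      (AE w in M. real_cond_exp M (generated M (U i)) (\<lambda>w. h (U j w)) w = k (U i w))"
    using k by blast
qed

lemma down_set_U:
  assumes "n \<in> N" "down_set A"
  shows "down_set (F n -` A)"
  using assms monoD[OF F_mono[OF assms(1)]] unfolding down_set_def by blast

text \<open>Complementation turns the copula formula for lower orthants into one for upper orthants.
  As \<open>p\<close> and \<open>q\<close> are fixed by the one-dimensional laws, which the two
  models share, the orthant comparison becomes the pointwise order of the copulas.\<close>

lemma orthant_U:
  assumes e: "(i, j) \<in> E" and A: "up_set A" and D: "up_set D"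
  defines "p \<equiv> \<P>(w in M. U i w \<in> - A)" and "q \<equiv> \<P>(w in M. U j w \<in> - D)"
  shows "\<P>(w in M. U i w \<in> A \<and> U j w \<in> D) = 1 - p - q + B (i, j) p q"
proof -
  have N: "i \<in> N" "j \<in> N" using e edge_nodes by auto
  note [measurable] = U_borel[OF N(1)] U_borel[OF N(2)] up_set_borel[OF A] up_set_borel[OF D]
  have joint: "\<P>(w in M. X i w \<le> x \<and> X j w \<le> y) =
      B (i, j) (\<P>(w in M. X i w \<le> x)) (\<P>(w in M. X j w \<le> y))" for x y
    using distributed e unfolding F_eq[OF N(1), symmetric] F_eq[OF N(2), symmetric]
    by (auto simp: markov_tree_distributed_def)
  have "\<P>(w in M. X i w \<in> F i -` (- A) \<and> X j w \<in> F j -` (- D)) =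
      B (i, j) (\<P>(w in M. X i w \<in> F i -` (- A))) (\<P>(w in M. X j w \<in> F j -` (- D)))"
    by (rule copula_down_sets[OF X_measurable[OF N(1)] X_measurable[OF N(2)] joint copulas[OF e]
        down_set_U[OF N(1) up_set_Compl[OF A]] down_set_U[OF N(2) up_set_Compl[OF D]]])
  then have neg: "\<P>(w in M. U i w \<in> - A \<and> U j w \<in> - D) = B (i, j) p q"
    by (simp add: p_def q_def U_def)
  let ?A = "{w \<in> space M. U i w \<in> - A}" and ?D = "{w \<in> space M. U j w \<in> - D}"
  have s: "?A \<in> sets M" "?D \<in> sets M" by measurable
  have "\<P>(w in M. U i w \<in> A \<and> U j w \<in> D) = 1 - measure M (?A \<union> ?D)"
  proof -
    have "{w \<in> space M. U i w \<in> A \<and> U j w \<in> D} = space M - (?A \<union> ?D)" by auto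
    then show ?thesis using s by (simp only: prob_compl sets.Un)
  qed
  moreover have "measure M (?A \<union> ?D) = p + q - measure M (?A \<inter> ?D)"
    using s measure_Un3[of ?A M ?D] by (simp add: p_def q_def fmeasurable_eq_sets)
  moreover have "?A \<inter> ?D = {w \<in> space M. U i w \<in> - A \<and> U j w \<in> - D}" by auto
  ultimately show ?thesis using neg by simp
qed

end

subsection \<open>Truncation\<close>

lemma st_le_imp_ge:
  assumes F: "distribution_function F" and G: "distribution_function G" and le: "st_le F G"
  shows "G x \<le> F x"
proof -
  have real: "real_distribution (interval_measure H)" "cdf (interval_measure H) = H"
    if "distribution_function H" for H
  proof -
    have H: "\<And>x y. x \<le> y \<Longrightarrow> H x \<le> H y" "\<And>a. continuous (at_right a) H"
      "(H \<longlongrightarrow> 0) at_bot" "(H \<longlongrightarrow> 1) at_top"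
      using that by (auto simp: distribution_function_def mono_def)
    show "real_distribution (interval_measure H)" by (rule real_distribution_interval_measure[OF H])
    show "cdf (interval_measure H) = H" by (rule cdf_interval_measure[OF H(1-3)])
  qed
  have int: "integrable (interval_measure H) (indicat_real {x<..}) \<and>
      (LINT y|(interval_measure H). indicat_real {x<..} y) = 1 - H x" if H: "distribution_function H" for H
  proof -
    interpret H: real_distribution "interval_measure H" by (rule real(1)[OF H])
    have "{x<..} = space (interval_measure H) - {..x}" by auto
    then have "measure (interval_measure H) {x<..} = 1 - measure (interval_measure H) {..x}"
      using H.prob_compl[of "{..x}"] by simp
    also have "measure (interval_measure H) {..x} = H x"
      using fun_cong[OF real(2)[OF H], of x] by (simp add: cdf_def)
    finally have "measure (interval_measure H) {x<..} = 1 - H x" .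
    moreover have "integrable (interval_measure H) (indicat_real {x<..})"
      by (intro H.bdd_borel_integrable bdd_borel_indicator) simp
    ultimately show ?thesis by simp
  qed
  have "mono (indicat_real {x<..})" by (auto simp: mono_def indicator_def)
  then have "1 - F x \<le> 1 - G x"
    using le int[OF F] int[OF G] unfolding st_le_def by metis
  then show ?thesis by simp
qed

text \<open>Clipping on both sides at once need not be dominated by a monotone \<open>f\<close>. The
  side on which clipping may enlarge \<open>f\<close> is released first, under a bound that depends
  on the other cut; the remaining cut is then dominated by \<open>a + \<bar>f x\<bar>\<close>.
  Eventual equality of the truncations stands in for continuity of \<open>f\<close>.\<close>

lemma truncation_limit:
  fixes f :: "'v \<Rightarrow> real" and R :: "'a \<Rightarrow> 'v" and R' :: "'b \<Rightarrow> 'v"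
  assumes M: "prob_space M" and M': "prob_space M'"
    and R: "R \<in> M \<rightarrow>\<^sub>M K" and R': "R' \<in> M' \<rightarrow>\<^sub>M K"
    and f: "f \<in> borel_measurable K" "integrable M (\<lambda>w. f (R w))" "integrable M' (\<lambda>w. f (R' w))"
    and T: "\<And>m n :: nat. T m n \<in> K \<rightarrow>\<^sub>M K" "\<And>n. S n \<in> K \<rightarrow>\<^sub>M K"
    and T_lim: "\<And>x n. x \<in> space K \<Longrightarrow> \<forall>\<^sub>F m in sequentially. T m n x = S n x"
    and S_lim: "\<And>x. x \<in> space K \<Longrightarrow> \<forall>\<^sub>F n in sequentially. S n x = x"
    and T_bound: "\<And>n m x. x \<in> space K \<Longrightarrow> \<bar>f (T m n x)\<bar> \<le> c n"
    and S_bound: "\<And>n x. x \<in> space K \<Longrightarrow> \<bar>f (S n x)\<bar> \<le> a + \<bar>f x\<bar>"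
    and le: "\<And>m n. (LINT w|M. f (T m n (R w))) \<le> (LINT w|M'. f (T m n (R' w)))"
  shows "(LINT w|M. f (R w)) \<le> (LINT w|M'. f (R' w))"
proof -
  have lim_m: "(\<lambda>m. LINT w|Q. f (T m n (X w))) \<longlonglongrightarrow> (LINT w|Q. f (S n (X w)))"
    if Q: "prob_space Q" and X: "X \<in> Q \<rightarrow>\<^sub>M K" for Q :: "'x measure" and X n
  proof (rule integral_dominated_convergence[where w = "\<lambda>_. c n"])
    interpret Q: prob_space Q by fact
    show "integrable Q (\<lambda>_. c n)" by simp
    show "(\<lambda>w. f (S n (X w))) \<in> borel_measurable Q" "(\<lambda>w. f (T m n (X w))) \<in> borel_measurable Q" for m
      using X T f(1) by (auto intro: measurable_compose)
    show "AE w in Q. (\<lambda>m. f (T m n (X w))) \<longlonglongrightarrow> f (S n (X w))"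
    proof (rule AE_I2)
      fix w assume "w \<in> space Q"
      then have "\<forall>\<^sub>F m in sequentially. T m n (X w) = S n (X w)" using measurable_space[OF X] T_lim by blast
      then show "(\<lambda>m. f (T m n (X w))) \<longlonglongrightarrow> f (S n (X w))"
        by (intro tendsto_eventually) (auto elim: eventually_mono)
    qed
    show "AE w in Q. norm (f (T m n (X w))) \<le> c n" for m
      using T_bound measurable_space[OF X] by (intro AE_I2) auto
  qed
  have lim_n: "(\<lambda>n. LINT w|Q. f (S n (X w))) \<longlonglongrightarrow> (LINT w|Q. f (X w))"
    if Q: "prob_space Q" and X: "X \<in> Q \<rightarrow>\<^sub>M K" and i: "integrable Q (\<lambda>w. f (X w))" for Q :: "'x measure" and X
  proof (rule integral_dominated_convergence[where w = "\<lambda>w. a + \<bar>f (X w)\<bar>"])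
    interpret Q: prob_space Q by fact
    show "integrable Q (\<lambda>w. a + \<bar>f (X w)\<bar>)" using i by simp
    show "(\<lambda>w. f (X w)) \<in> borel_measurable Q" "(\<lambda>w. f (S n (X w))) \<in> borel_measurable Q" for n
      using X T f(1) by (auto intro: measurable_compose)
    show "AE w in Q. (\<lambda>n. f (S n (X w))) \<longlonglongrightarrow> f (X w)"
    proof (rule AE_I2)
      fix w assume "w \<in> space Q"
      then have "\<forall>\<^sub>F n in sequentially. S n (X w) = X w" using measurable_space[OF X] S_lim by blast
      then show "(\<lambda>n. f (S n (X w))) \<longlonglongrightarrow> f (X w)"
        by (intro tendsto_eventually) (auto elim: eventually_mono)
    qed
    show "AE w in Q. norm (f (S n (X w))) \<le> a + \<bar>f (X w)\<bar>" for n
      using S_bound measurable_space[OF X] by (intro AE_I2) auto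
  qed
  have "(LINT w|M. f (S n (R w))) \<le> (LINT w|M'. f (S n (R' w)))" for n
    by (rule LIMSEQ_le[OF lim_m[OF M R] lim_m[OF M' R']]) (use le in auto)
  then show ?thesis
    by (intro LIMSEQ_le[OF lim_n[OF M R f(2)] lim_n[OF M' R' f(3)]]) auto
qed

text \<open>Reduces the comparison to functions bounded below, which makes the domination in the
  clipping limits possible.\<close>

lemma lower_truncation_limit:
  fixes f :: "'a \<Rightarrow> real" and g :: "'b \<Rightarrow> real"
  assumes f: "integrable M f" and g: "integrable M' g"
    and le: "\<And>a::nat. (LINT w|M. max (f w) (- real a)) \<le> (LINT w|M'. max (g w) (- real a))"
  shows "(LINT w|M. f w) \<le> (LINT w|M'. g w)"
proof -
  have lim: "(\<lambda>a::nat. LINT w|Q. max (h w) (- real a)) \<longlonglongrightarrow> (LINT w|Q. h w)"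
    if h: "integrable Q h" for Q :: "'x measure" and h
  proof (rule integral_dominated_convergence[where w = "\<lambda>w. \<bar>h w\<bar>"])
    show "h \<in> borel_measurable Q" "(\<lambda>w. max (h w) (- real a)) \<in> borel_measurable Q" for a
      using h by auto
    show "AE w in Q. (\<lambda>a. max (h w) (- real a)) \<longlonglongrightarrow> h w"
    proof (intro AE_I2 tendsto_eventually)
      fix w
      obtain m where "\<bar>h w\<bar> \<le> real m" using real_arch_simple by blast
      then have "max (h w) (- real a) = h w" if "a \<ge> m" for a using that by (auto simp: max_def)
      then show "\<forall>\<^sub>F a in sequentially. max (h w) (- real a) = h w" by (rule eventually_sequentiallyI)
    qed
    show "integrable Q (\<lambda>w. \<bar>h w\<bar>)" using h by simp
  qed auto
  show ?thesis by (rule LIMSEQ_le[OF lim[OF f] lim[OF g]]) (use le in auto)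
qed

text \<open>By monotonicity the values at meet and join enclose the other two, and their sum is at
  least as large; the increasing convex map \<open>t \<mapsto> max t c\<close> preserves such an
  inequality.\<close>

lemma supermodular_max:
  assumes sm: "supermodular J f"
    and mono: "mono_on (space (borel_vec J)) f \<or> antimono_on (space (borel_vec J)) f"
  shows "supermodular J (\<lambda>x. max (f x) c)"
  unfolding supermodular_def
proof (intro ballI)
  fix x y assume xy: "x \<in> space (borel_vec J)" "y \<in> space (borel_vec J)"
  have s: "inf x y \<in> space (borel_vec J)" "sup x y \<in> space (borel_vec J)"
    using xy by (auto simp: space_PiM PiE_def extensional_def)
  have le: "inf x y \<le> x" "inf x y \<le> y" "x \<le> sup x y" "y \<le> sup x y" by auto
  have "f x + f y \<le> f (inf x y) + f (sup x y)" using sm xy unfolding supermodular_def by blast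
  moreover from mono have "f (inf x y) \<le> f x \<and> f (inf x y) \<le> f y \<and> f x \<le> f (sup x y) \<and> f y \<le> f (sup x y) \<or>
      f x \<le> f (inf x y) \<and> f y \<le> f (inf x y) \<and> f (sup x y) \<le> f x \<and> f (sup x y) \<le> f y"
    using s xy le unfolding monotone_on_def by blast
  ultimately show "max (f x) c + max (f y) c \<le> max (f (inf x y)) c + max (f (sup x y)) c"
    by (auto simp: max_def)
qed

definition clip :: "nat set \<Rightarrow> real \<Rightarrow> real \<Rightarrow> (nat \<Rightarrow> real) \<Rightarrow> nat \<Rightarrow> real" where
  "clip J l h x = (\<lambda>n\<in>J. max l (min h (x n)))"

definition floor_at :: "nat set \<Rightarrow> real \<Rightarrow> (nat \<Rightarrow> real) \<Rightarrow> nat \<Rightarrow> real" where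
  "floor_at J l x = (\<lambda>n\<in>J. max l (x n))"

definition cap_at :: "nat set \<Rightarrow> real \<Rightarrow> (nat \<Rightarrow> real) \<Rightarrow> nat \<Rightarrow> real" where
  "cap_at J h x = (\<lambda>n\<in>J. min h (x n))"

lemma truncation_measurable:
  "clip J l h \<in> borel_vec J \<rightarrow>\<^sub>M borel_vec J"
  "floor_at J l \<in> borel_vec J \<rightarrow>\<^sub>M borel_vec J"
  "cap_at J h \<in> borel_vec J \<rightarrow>\<^sub>M borel_vec J"
proof -
  have [measurable]: "(\<lambda>x. x n) \<in> borel_measurable (borel_vec J)" if "n \<in> J" for n
    using that by (rule measurable_component_singleton)
  show "clip J l h \<in> borel_vec J \<rightarrow>\<^sub>M borel_vec J"
    unfolding clip_def[abs_def] by (rule measurable_restrict) measurable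
  show "floor_at J l \<in> borel_vec J \<rightarrow>\<^sub>M borel_vec J"
    unfolding floor_at_def[abs_def] by (rule measurable_restrict) measurable
  show "cap_at J h \<in> borel_vec J \<rightarrow>\<^sub>M borel_vec J"
    unfolding cap_at_def[abs_def] by (rule measurable_restrict) measurable
qed

lemma finite_bound:
  fixes x :: "nat \<Rightarrow> real"
  assumes "finite J"
  obtains m :: nat where "\<And>n. n \<in> J \<Longrightarrow> \<bar>x n\<bar> \<le> real m"
proof -
  obtain m :: nat where m: "Max (insert 0 ((\<lambda>n. \<bar>x n\<bar>) ` J)) \<le> real m" using real_arch_simple by blast
  have "\<bar>x n\<bar> \<le> real m" if "n \<in> J" for n
  proof -
    have "\<bar>x n\<bar> \<le> Max (insert 0 ((\<lambda>n. \<bar>x n\<bar>) ` J))" by (rule Max_ge) (use assms that in auto)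
    then show ?thesis using m by linarith
  qed
  then show ?thesis by (rule that)
qed

lemma clip_eventually:
  assumes J: "finite J" and x: "x \<in> space (borel_vec J)"
  shows "\<forall>\<^sub>F m in sequentially. clip J (- real m) (real n) x = cap_at J (real n) x"
    "\<forall>\<^sub>F m in sequentially. clip J (- real n) (real m) x = floor_at J (- real n) x"
    "\<forall>\<^sub>F n in sequentially. cap_at J (real n) x = x"
    "\<forall>\<^sub>F n in sequentially. floor_at J (- real n) x = x"
proof -
  obtain m :: nat where m: "\<And>n. n \<in> J \<Longrightarrow> \<bar>x n\<bar> \<le> real m" using finite_bound[OF J] by blast
  have b: "x i \<le> real k" "- real k \<le> x i" if "k \<ge> m" "i \<in> J" for k i
    using m[OF that(2)] that(1) by (auto simp: abs_le_iff intro: order_trans)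
  have x': "x i = undefined" if "i \<notin> J" for i
    using x that by (auto simp: space_PiM PiE_def extensional_def)
  show "\<forall>\<^sub>F m in sequentially. clip J (- real m) (real n) x = cap_at J (real n) x"
  proof (rule eventually_sequentiallyI[of m])
    fix k assume "k \<ge> m"
    then have "max (- real k) (min (real n) (x i)) = min (real n) (x i)" if "i \<in> J" for i
      using b[of k i] that by (auto simp: max_def min_def)
    then show "clip J (- real k) (real n) x = cap_at J (real n) x"
      by (simp add: clip_def cap_at_def restrict_def fun_eq_iff)
  qed
  show "\<forall>\<^sub>F m in sequentially. clip J (- real n) (real m) x = floor_at J (- real n) x"
  proof (rule eventually_sequentiallyI[of m])
    fix k assume "k \<ge> m"
    then have "max (- real n) (min (real k) (x i)) = max (- real n) (x i)" if "i \<in> J" for i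
      using b[of k i] that by (auto simp: max_def min_def)
    then show "clip J (- real n) (real k) x = floor_at J (- real n) x"
      by (simp add: clip_def floor_at_def restrict_def fun_eq_iff)
  qed
  show "\<forall>\<^sub>F n in sequentially. cap_at J (real n) x = x"
    by (intro eventually_sequentiallyI[of m])
      (simp add: cap_at_def restrict_def fun_eq_iff min_absorb2 b x')
  show "\<forall>\<^sub>F n in sequentially. floor_at J (- real n) x = x"
    by (intro eventually_sequentiallyI[of m])
      (simp add: floor_at_def restrict_def fun_eq_iff max_absorb2 b x')
qed


section \<open>Comparison of the original vectors\<close>

locale model_comparison =
  X: markov_tree_model N E M X F B + Y: markov_tree_model N E M' Y G C
  for N E and M :: "'a measure" and X F B and M' :: "'b measure" and Y G C +
  fixes P :: "nat set" and k :: nat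
  assumes path: "path_from_root N E P"
    and k: "(0, k) \<in> E" "node_degree E 0 \<ge> 2 \<Longrightarrow> k \<notin> P"
    and lo: "\<And>e. e \<in> E \<Longrightarrow> lo_le (B e) (C e)"
    and ran: "\<And>n. n \<in> N \<Longrightarrow> closure (range (F n)) = closure (range (G n))"
    and X_child: "\<And>i j. (i, j) \<in> E \<Longrightarrow> j \<noteq> k \<Longrightarrow> st_increasing_in M (X j) (X i)"
    and Y_parent: "\<And>i j. (i, j) \<in> E \<Longrightarrow> j \<notin> leaves N E \<Longrightarrow> st_increasing_in M' (Y i) (Y j)"
    and Y_child: "\<And>i j. (i, j) \<in> E \<Longrightarrow> j \<notin> P \<Longrightarrow> st_increasing_in M' (Y j) (Y i)"
begin

lemma law_eq:
  assumes n: "n \<in> N" and f: "bdd_borel borel f"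
  shows "(LINT w|M. f (X.U n w)) = (LINT w|M'. f (Y.U n w))"
proof -
  have "distr M borel (X.U n) = distr M' borel (Y.U n)"
    unfolding X.U_def[abs_def] Y.U_def[abs_def]
    by (rule cdf_transform_law[OF X.prob_space_axioms X.X_measurable[OF n] X.F_eq[OF n]
        Y.prob_space_axioms Y.X_measurable[OF n] Y.F_eq[OF n] ran[OF n]])
  then show ?thesis
    using integral_distr[OF X.U_borel[OF n] bdd_borel_measurable[OF f]]
      integral_distr[OF Y.U_borel[OF n] bdd_borel_measurable[OF f]] by simp
qed

sublocale process_comparison N E M X.U M' Y.U P k
proof
  show "path_from_root N E P" by (rule path)
  show "(0, k) \<in> E" by (rule k)
  show "node_degree E 0 \<ge> 2 \<Longrightarrow> k \<notin> P" by (rule k)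
  show "(LINT w|M. f (X.U n w)) = (LINT w|M'. f (Y.U n w))" if "n \<in> N" "bdd_borel borel f" for n f
    by (rule law_eq[OF that])
  show "increasing_in M (X.U j) (X.U i)" if "(i, j) \<in> E" "j \<noteq> k" for i j
    by (rule X.increasing_U[OF X.edge_nodes[OF that(1)] X_child[OF that]])
  show "increasing_in M' (Y.U i) (Y.U j)" if "(i, j) \<in> E" "j \<notin> leaves N E" for i j
    by (rule Y.increasing_U[OF X.edge_nodes(2)[OF that(1)] X.edge_nodes(1)[OF that(1)] Y_parent[OF that]])
  show "increasing_in M' (Y.U j) (Y.U i)" if "(i, j) \<in> E" "j \<notin> P" for i j
    by (rule Y.increasing_U[OF X.edge_nodes[OF that(1)] Y_child[OF that]])
  fix i j A D assume e: "(i, j) \<in> E" and A: "up_set A" and D: "up_set D"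
  have eq: "\<P>(w in M. X.U n w \<in> - S) = \<P>(w in M'. Y.U n w \<in> - S)"
    if n: "n \<in> N" and S: "up_set S" for n S
  proof -
    have "\<P>(w in M. X.U n w \<in> - S) = (LINT w|M. indicator (- S) (X.U n w))"
      by (rule measure_eq_integral) (auto simp: indicator_def)
    also have "\<dots> = (LINT w|M'. indicator (- S) (Y.U n w))"
      by (rule law_eq[OF n bdd_borel_indicator]) (rule down_set_borel[OF up_set_Compl[OF S]])
    also have "\<dots> = \<P>(w in M'. Y.U n w \<in> - S)"
      by (rule measure_eq_integral[symmetric]) (auto simp: indicator_def)
    finally show ?thesis .
  qed
  show "\<P>(w in M. X.U i w \<in> A \<and> X.U j w \<in> D) \<le> \<P>(w in M'. Y.U i w \<in> A \<and> Y.U j w \<in> D)"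
    unfolding X.orthant_U[OF e A D] Y.orthant_U[OF e A D]
      eq[OF X.edge_nodes(1)[OF e] A] eq[OF X.edge_nodes(2)[OF e] D]
    using lo[OF e] unfolding lo_le_def by simp
qed

text \<open>Clipped quantiles express the clipped vectors through \<open>U\<close>. The dependence
  is compared with the same quantiles \<open>Q G\<close> on both sides; the change from
  \<open>Q F\<close> to \<open>Q G\<close> is a pointwise inequality, where the stochastic order and
  the monotonicity of \<open>f\<close> combine with matching signs.\<close>

lemma compare_clip:
  assumes J: "finite J" "J \<subseteq> N" and f: "f \<in> borel_measurable (borel_vec J)" "supermodular J f"
    and lh: "l \<le> h"
    and bound: "\<And>x. x \<in> space (borel_vec J) \<Longrightarrow> (\<And>n. n \<in> J \<Longrightarrow> l \<le> x n \<and> x n \<le> h) \<Longrightarrow> \<bar>f x\<bar> \<le> c"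
    and dir: "mono_on (space (borel_vec J)) f \<and> (\<forall>n\<in>N. \<forall>x. G n x \<le> F n x) \<or>
      antimono_on (space (borel_vec J)) f \<and> (\<forall>n\<in>N. \<forall>x. F n x \<le> G n x)"
  shows "(LINT w|M. f (clip J l h (subvector J X w))) \<le> (LINT w|M'. f (clip J l h (subvector J Y w)))"
proof -
  \<comment> \<open>Coordinatewise monotone, hence a lattice homomorphism, and with values in the
    cube on which \<open>f\<close> is bounded: composition with \<open>f\<close> gives a bounded
    supermodular test function.\<close>
  define Q where "Q H y = (\<lambda>n\<in>J. clipped_quantile (H n) l h (y n))" for H and y :: "nat \<Rightarrow> real"
  have Q_space: "Q H y \<in> space (borel_vec J)" for H y by (simp add: Q_def space_PiM)
  have Q_meas: "Q H \<in> borel_vec UNIV \<rightarrow>\<^sub>M borel_vec J" for H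
    unfolding Q_def[abs_def]
  proof (rule measurable_restrict)
    fix n
    have "(\<lambda>y. y n) \<in> borel_vec UNIV \<rightarrow>\<^sub>M borel" by simp
    from measurable_compose[OF this borel_measurable_mono[OF mono_clipped_quantile]]
    show "(\<lambda>y. clipped_quantile (H n) l h (y n)) \<in> borel_vec UNIV \<rightarrow>\<^sub>M borel" .
  qed
  have Q_bound: "\<bar>f (Q H y)\<bar> \<le> c" for H y
    by (rule bound[OF Q_space]) (simp add: Q_def clipped_quantile_bounds[OF lh])
  have b: "bdd_borel (borel_vec UNIV) (\<lambda>y. f (Q H y))" for H
    by (rule bdd_borelI[OF measurable_compose[OF Q_meas f(1)] Q_bound])
  have "supermodular UNIV (\<lambda>y. f (Q G y))"
    unfolding supermodular_UNIV
  proof (intro allI)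
    fix x y :: "nat \<Rightarrow> real"
    have m: "clipped_quantile (G n) l h u \<le> clipped_quantile (G n) l h v" if "u \<le> v" for n u v
      using monoD[OF mono_clipped_quantile that] .
    have "inf (Q G x) (Q G y) = Q G (inf x y)"
    proof
      fix n show "inf (Q G x) (Q G y) n = Q G (inf x y) n"
        using m[of "x n" "y n" n] m[of "y n" "x n" n]
        by (cases "x n \<le> y n") (auto simp: Q_def inf_absorb1 inf_absorb2)
    qed
    moreover have "sup (Q G x) (Q G y) = Q G (sup x y)"
    proof
      fix n show "sup (Q G x) (Q G y) n = Q G (sup x y) n"
        using m[of "x n" "y n" n] m[of "y n" "x n" n]
        by (cases "x n \<le> y n") (auto simp: Q_def sup_absorb1 sup_absorb2)
    qed
    ultimately show "f (Q G x) + f (Q G y) \<le> f (Q G (inf x y)) + f (Q G (sup x y))"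
      using f(2) Q_space unfolding supermodular_def by metis
  qed
  note sm = this
  \<comment> \<open>The comparison on subtrees requires \<open>0\<close> and \<open>k\<close>; nodes
    of \<open>T\<close> outside \<open>J\<close> do not enter the value of \<open>Q\<close>.\<close>
  obtain T where T: "finite T" "insert 0 (insert k J) \<subseteq> T" "X.parent_closed T"
    using X.finite_parent_closed_hull[of "insert 0 (insert k J)"] J root_in X.edge_nodes(2)[OF k(1)] by auto
  have TN: "T \<subseteq> N" using T by (simp add: X.parent_closed_def)
  have restr: "Q H (restricted T V w) = Q H (\<lambda>n. V n w)" for H and V :: "nat \<Rightarrow> 'x \<Rightarrow> real" and w
    using T(2) by (auto simp: Q_def restricted_def fun_eq_iff)
  have core: "(LINT w|M. f (Q G (\<lambda>n. X.U n w))) \<le> (LINT w|M'. f (Q G (\<lambda>n. Y.U n w)))"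
    using compare_parent_closed[OF T(1,3) _ _ b sm] T(2) unfolding restr by simp
  have clipX: "AE w in M. clip J l h (subvector J X w) = Q F (\<lambda>n. X.U n w)"
  proof -
    have "AE w in M. \<forall>n\<in>J. clipped_quantile (F n) l h (X.U n w) = max l (min h (X n w))"
      using J X.AE_clipped_quantile[OF _ lh] by (intro AE_finite_allI) auto
    then show ?thesis by eventually_elim (auto simp: clip_def Q_def subvector_def fun_eq_iff)
  qed
  have clipY: "AE w in M'. clip J l h (subvector J Y w) = Q G (\<lambda>n. Y.U n w)"
  proof -
    have "AE w in M'. \<forall>n\<in>J. clipped_quantile (G n) l h (Y.U n w) = max l (min h (Y n w))"
      using J Y.AE_clipped_quantile[OF _ lh] by (intro AE_finite_allI) auto
    then show ?thesis by eventually_elim (auto simp: clip_def Q_def subvector_def fun_eq_iff)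
  qed
  have subX: "subvector J X \<in> M \<rightarrow>\<^sub>M borel_vec J" and subY: "subvector J Y \<in> M' \<rightarrow>\<^sub>M borel_vec J"
    using J X.X_measurable Y.X_measurable by (auto intro!: subvector_measurable)
  have clip_bounds: "\<bar>f (clip J l h x)\<bar> \<le> c" for x
    by (rule bound) (use lh in \<open>auto simp: clip_def space_PiM\<close>)
  have bX: "bdd_borel M (\<lambda>w. f (clip J l h (subvector J X w)))"
    by (rule bdd_borelI[OF measurable_compose[OF subX measurable_compose[OF truncation_measurable(1) f(1)]] clip_bounds])
  have bY: "bdd_borel M' (\<lambda>w. f (clip J l h (subvector J Y w)))"
    by (rule bdd_borelI[OF measurable_compose[OF subY measurable_compose[OF truncation_measurable(1) f(1)]] clip_bounds])
  have bXU: "bdd_borel M (\<lambda>w. f (Q G (\<lambda>n. X.U n w)))"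
    using bdd_borel_compose[OF X.restricted_U_measurable[OF TN] b[of G]] unfolding restr .
  have bYU: "bdd_borel M' (\<lambda>w. f (Q G (\<lambda>n. Y.U n w)))"
    using bdd_borel_compose[OF Y.restricted_U_measurable[OF TN] b[of G]] unfolding restr .
  have FG: "f (Q F y) \<le> f (Q G y)" for y
    using dir
  proof (elim disjE conjE)
    assume "mono_on (space (borel_vec J)) f" and le: "\<forall>n\<in>N. \<forall>x. G n x \<le> F n x"
    moreover have "Q F y \<le> Q G y" using J le by (auto simp: Q_def le_fun_def intro!: clipped_quantile_antimono)
    ultimately show ?thesis using Q_space unfolding monotone_on_def by blast
  next
    assume "antimono_on (space (borel_vec J)) f" and le: "\<forall>n\<in>N. \<forall>x. F n x \<le> G n x"
    moreover have "Q G y \<le> Q F y" using J le by (auto simp: Q_def le_fun_def intro!: clipped_quantile_antimono)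
    ultimately show ?thesis using Q_space unfolding monotone_on_def by blast
  qed
  have "(LINT w|M. f (clip J l h (subvector J X w))) \<le> (LINT w|M. f (Q G (\<lambda>n. X.U n w)))"
  proof (rule integral_mono_AE)
    show "AE w in M. f (clip J l h (subvector J X w)) \<le> f (Q G (\<lambda>n. X.U n w))"
      using clipX by eventually_elim (simp add: FG)
  qed (intro X.bdd_borel_integrable bX bXU)+
  also note core
  also have "(LINT w|M'. f (Q G (\<lambda>n. Y.U n w))) = (LINT w|M'. f (clip J l h (subvector J Y w)))"
  proof (rule integral_cong_AE)
    show "AE w in M'. f (Q G (\<lambda>n. Y.U n w)) = f (clip J l h (subvector J Y w))"
      using clipY by eventually_elim simp
  qed (intro bdd_borel_measurable bY bYU)+
  finally show ?thesis .
qed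

text \<open>Values are cut off below at \<open>- real a\<close> before the coordinates are clipped,
  so that a monotone function is controlled from both sides while clipping is undone;
  \<open>supermodular_max\<close> keeps the cut function admissible.\<close>

lemma compare_integrable:
  assumes J: "finite J" "J \<subseteq> N" and f: "f \<in> borel_measurable (borel_vec J)" "supermodular J f"
    and dir: "mono_on (space (borel_vec J)) f \<and> (\<forall>n\<in>N. \<forall>x. G n x \<le> F n x) \<or>
      antimono_on (space (borel_vec J)) f \<and> (\<forall>n\<in>N. \<forall>x. F n x \<le> G n x)"
    and int: "integrable M (\<lambda>w. f (subvector J X w))" "integrable M' (\<lambda>w. f (subvector J Y w))"
  shows "(LINT w|M. f (subvector J X w)) \<le> (LINT w|M'. f (subvector J Y w))"
proof (rule lower_truncation_limit[OF int])
  fix a :: nat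
  let ?K = "borel_vec J"
  define g where "g x = max (f x) (- real a)" for x
  define const where "const t = (\<lambda>n\<in>J. t)" for t :: real
  have const: "const t \<in> space ?K" for t by (simp add: const_def space_PiM)
  have dir': "mono_on (space ?K) g \<and> (\<forall>n\<in>N. \<forall>x. G n x \<le> F n x) \<or>
      antimono_on (space ?K) g \<and> (\<forall>n\<in>N. \<forall>x. F n x \<le> G n x)"
  proof -
    have "mono_on (space ?K) g" if "mono_on (space ?K) f"
      using that unfolding monotone_on_def g_def by (meson max.mono order_refl)
    moreover have "antimono_on (space ?K) g" if "antimono_on (space ?K) f"
      using that unfolding monotone_on_def g_def by (meson max.mono order_refl)
    ultimately show ?thesis using dir by blast
  qed
  have gm: "g \<in> borel_measurable ?K" unfolding g_def using f(1) by measurable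
  have gs: "supermodular J g" unfolding g_def using dir by (intro supermodular_max f(2)) blast
  have ga: "- real a \<le> g x" for x by (simp add: g_def)
  have gi: "integrable M (\<lambda>w. g (subvector J X w))" "integrable M' (\<lambda>w. g (subvector J Y w))"
    unfolding g_def using int by (auto intro!: integrable_max)
  have subX: "subvector J X \<in> M \<rightarrow>\<^sub>M ?K" and subY: "subvector J Y \<in> M' \<rightarrow>\<^sub>M ?K"
    using J X.X_measurable Y.X_measurable by (auto intro!: subvector_measurable)
  have le: "(LINT w|M. g (clip J (- real m) (real n) (subvector J X w))) \<le>
      (LINT w|M'. g (clip J (- real m) (real n) (subvector J Y w)))" for m n
  proof (rule compare_clip[OF J gm gs _ _ dir'])
    fix x assume x: "x \<in> space ?K" "\<And>i. i \<in> J \<Longrightarrow> - real m \<le> x i \<and> x i \<le> real n"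
    \<comment> \<open>On the cube a monotone function is bounded above by its value at a corner: the
      upper one if it increases, the lower one if it decreases.\<close>
    have "const (- real m) \<le> x" "x \<le> const (real n)"
      using x by (auto simp: const_def le_fun_def restrict_def space_PiM PiE_def extensional_def)
    then have "g x \<le> g (const (real n)) \<or> g x \<le> g (const (- real m))"
      using dir' const x(1) unfolding monotone_on_def by blast
    then show "\<bar>g x\<bar> \<le> real a + \<bar>g (const (real n))\<bar> + \<bar>g (const (- real m))\<bar>"
      using ga[of x] by linarith
  qed simp
  have clip_space: "clip J l h x \<in> space ?K" "cap_at J h x \<in> space ?K" "floor_at J l x \<in> space ?K" for l h x
    by (auto simp: clip_def cap_at_def floor_at_def space_PiM)
  have "(LINT w|M. g (subvector J X w)) \<le> (LINT w|M'. g (subvector J Y w))"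
    using dir'
  proof (elim disjE conjE)
    assume mono: "mono_on (space ?K) g"
    have gmono: "g x \<le> g y" if "x \<in> space ?K" "y \<in> space ?K" "x \<le> y" for x y
      using mono that unfolding monotone_on_def by blast
    \<comment> \<open>For increasing \<open>g\<close> the lower bound of the clipping is released
      first, under the value at the upper corner; capping from above only lowers
      \<open>g\<close>.\<close>
    show ?thesis
    proof (rule truncation_limit[where T = "\<lambda>m n. clip J (- real m) (real n)" and S = "\<lambda>n. cap_at J (real n)"
          and c = "\<lambda>n. real a + \<bar>g (const (real n))\<bar>" and a = "real a",
          OF X.prob_space_axioms Y.prob_space_axioms subX subY gm gi truncation_measurable(1,3) _ _ _ _ le])
      fix x assume x: "x \<in> space ?K"
      show "\<forall>\<^sub>F m in sequentially. clip J (- real m) (real n) x = cap_at J (real n) x" for n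
        by (rule clip_eventually(1)[OF J(1) x])
      show "\<forall>\<^sub>F n in sequentially. cap_at J (real n) x = x" by (rule clip_eventually(3)[OF J(1) x])
      show "\<bar>g (clip J (- real m) (real n) x)\<bar> \<le> real a + \<bar>g (const (real n))\<bar>" for m n
      proof -
        have "clip J (- real m) (real n) x \<le> const (real n)"
          by (auto simp: clip_def const_def le_fun_def)
        from gmono[OF clip_space(1) const this] show ?thesis using ga[of "clip J (- real m) (real n) x"] by linarith
      qed
      show "\<bar>g (cap_at J (real n) x)\<bar> \<le> real a + \<bar>g x\<bar>" for n
      proof -
        have "cap_at J (real n) x \<le> x"
          using x by (auto simp: cap_at_def le_fun_def restrict_def space_PiM PiE_def extensional_def)
        from gmono[OF clip_space(2) x this] show ?thesis using ga[of "cap_at J (real n) x"] by linarith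
      qed
    qed
  next
    assume anti: "antimono_on (space ?K) g"
    have ganti: "g y \<le> g x" if "x \<in> space ?K" "y \<in> space ?K" "x \<le> y" for x y
      using anti that unfolding monotone_on_def by blast
    \<comment> \<open>For decreasing \<open>g\<close> the roles of the two bounds are reversed,
      since raising coordinates lowers \<open>g\<close>.\<close>
    show ?thesis
    proof (rule truncation_limit[where T = "\<lambda>m n. clip J (- real n) (real m)" and S = "\<lambda>n. floor_at J (- real n)"
          and c = "\<lambda>n. real a + \<bar>g (const (- real n))\<bar>" and a = "real a",
          OF X.prob_space_axioms Y.prob_space_axioms subX subY gm gi truncation_measurable(1,2) _ _ _ _ le])
      fix x assume x: "x \<in> space ?K"
      show "\<forall>\<^sub>F m in sequentially. clip J (- real n) (real m) x = floor_at J (- real n) x" for n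
        by (rule clip_eventually(2)[OF J(1) x])
      show "\<forall>\<^sub>F n in sequentially. floor_at J (- real n) x = x" by (rule clip_eventually(4)[OF J(1) x])
      show "\<bar>g (clip J (- real n) (real m) x)\<bar> \<le> real a + \<bar>g (const (- real n))\<bar>" for m n
      proof -
        have "const (- real n) \<le> clip J (- real n) (real m) x"
          by (auto simp: clip_def const_def le_fun_def)
        from ganti[OF const clip_space(1) this] show ?thesis using ga[of "clip J (- real n) (real m) x"] by linarith
      qed
      show "\<bar>g (floor_at J (- real n) x)\<bar> \<le> real a + \<bar>g x\<bar>" for n
      proof -
        have "x \<le> floor_at J (- real n) x"
          using x by (auto simp: floor_at_def le_fun_def restrict_def space_PiM PiE_def extensional_def)
        from ganti[OF x clip_space(3) this] show ?thesis using ga[of "floor_at J (- real n) x"] by linarith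
      qed
    qed
  qed
  then show "(LINT w|M. max (f (subvector J X w)) (- real a)) \<le> (LINT w|M'. max (f (subvector J Y w)) (- real a))"
    by (simp add: g_def)
qed

end

lemma weight_bounded_integrable:
  assumes b: "weight_function J b" and f: "f \<in> borel_measurable (borel_vec J)" "weight_bounded J b f"
    and X: "X \<in> M \<rightarrow>\<^sub>M borel_vec J" and int: "integrable M (\<lambda>w. b (X w))"
  shows "integrable M (\<lambda>w. f (X w))"
proof -
  obtain c where c: "\<And>x. x \<in> space (borel_vec J) \<Longrightarrow> \<bar>f x\<bar> / b x \<le> c"
    using f(2) unfolding weight_bounded_def by blast
  show ?thesis
  proof (rule Bochner_Integration.integrable_bound)
    show "integrable M (\<lambda>w. c * b (X w))" using int by simp
    show "(\<lambda>w. f (X w)) \<in> borel_measurable M" using measurable_compose[OF X f(1)] .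
    have "\<bar>f x\<bar> \<le> \<bar>c * b x\<bar>" if "x \<in> space (borel_vec J)" for x
    proof -
      have "1 \<le> b x" using b that by (simp add: weight_function_def)
      then have "\<bar>f x\<bar> \<le> c * b x" using c[OF that] by (simp add: field_simps)
      then show ?thesis by linarith
    qed
    then show "AE w in M. norm (f (X w)) \<le> norm (c * b (X w))"
      using measurable_space[OF X] by (intro AE_I2) auto
  qed
qed

theorem theorem3p1:
  fixes N :: "nat set" and E :: "(nat \<times> nat) set" and P :: "nat set" and kstar :: nat
    and F G :: "nat \<Rightarrow> real \<Rightarrow> real"
    and B C :: "nat \<times> nat \<Rightarrow> real \<Rightarrow> real \<Rightarrow> real"
    and M :: "'a measure" and X :: "nat \<Rightarrow> 'a \<Rightarrow> real"
    and M' :: "'b measure" and Y :: "nat \<Rightarrow> 'b \<Rightarrow> real"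
    and b :: "nat set \<Rightarrow> (nat \<Rightarrow> real) \<Rightarrow> real"
  assumes tree: "rooted_tree N E"
    and P: "path_from_root N E P"
    and kstar: "(0, kstar) \<in> E" "node_degree E 0 \<ge> 2 \<Longrightarrow> kstar \<notin> P"
    and F: "\<And>n. n \<in> N \<Longrightarrow> distribution_function (F n)"
    and G: "\<And>n. n \<in> N \<Longrightarrow> distribution_function (G n)"
    and B: "\<And>e. e \<in> E \<Longrightarrow> copula (B e)"
    and C: "\<And>e. e \<in> E \<Longrightarrow> copula (C e)"
    and X: "markov_tree_distributed M X F N E B"
    and Y: "markov_tree_distributed M' Y G N E C"
    and weight: "\<And>J. J \<in> compared_index_sets N \<Longrightarrow> weight_function J (b J)"
    and X_integrable: "weight_integrable b N M X"
    and Y_integrable: "weight_integrable b N M' Y"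
    and X_child: "\<And>i j. (i, j) \<in> E \<Longrightarrow> j \<noteq> kstar \<Longrightarrow> st_increasing_in M (X j) (X i)"
    and Y_parent: "\<And>i j. (i, j) \<in> E \<Longrightarrow> j \<notin> leaves N E \<Longrightarrow> st_increasing_in M' (Y i) (Y j)"
    and Y_child: "\<And>i j. (i, j) \<in> E \<Longrightarrow> j \<notin> P \<Longrightarrow> st_increasing_in M' (Y j) (Y i)"
    and ran: "\<And>n. n \<in> N \<Longrightarrow> closure (range (F n)) = closure (range (G n))"
  shows "((\<forall>e\<in>E. lo_le (B e) (C e)) \<and> (\<forall>n\<in>N. st_le (F n) (G n)) \<longrightarrow> ism_le b N M X M' Y) \<and>
         ((\<forall>e\<in>E. lo_le (B e) (C e)) \<and> (\<forall>n\<in>N. st_le (G n) (F n)) \<longrightarrow> dsm_le b N M X M' Y)"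
proof -
  have mX: "markov_tree_model N E M X F B" and mY: "markov_tree_model N E M' Y G C"
    using tree X Y B C
    by (auto simp: markov_tree_model_def tree_def markov_tree_model_axioms_def markov_tree_distributed_def)
  interpret X: markov_tree_model N E M X F B by (rule mX)
  interpret Y: markov_tree_model N E M' Y G C by (rule mY)
  have finite_sub: "finite J" "J \<subseteq> N" if "J \<in> compared_index_sets N" for J
    using that by (auto simp: compared_index_sets_def split: if_splits)
  have int: "integrable M (\<lambda>w. f (subvector J X w))" "integrable M' (\<lambda>w. f (subvector J Y w))"
    if J: "J \<in> compared_index_sets N" and f: "f \<in> borel_measurable (borel_vec J)" "weight_bounded J (b J) f" for J f
  proof -
    have "subvector J X \<in> M \<rightarrow>\<^sub>M borel_vec J" "subvector J Y \<in> M' \<rightarrow>\<^sub>M borel_vec J"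
      using finite_sub[OF J] X.X_measurable Y.X_measurable by (auto intro!: subvector_measurable)
    moreover have "integrable M (\<lambda>w. b J (subvector J X w))" "integrable M' (\<lambda>w. b J (subvector J Y w))"
      using X_integrable Y_integrable J by (auto simp: weight_integrable_def)
    ultimately show "integrable M (\<lambda>w. f (subvector J X w))" "integrable M' (\<lambda>w. f (subvector J Y w))"
      using weight_bounded_integrable[OF weight[OF J] f] by blast+
  qed
  have comparison: "model_comparison N E M X F B M' Y G C P kstar" if "\<forall>e\<in>E. lo_le (B e) (C e)"
    by (intro model_comparison.intro mX mY model_comparison_axioms.intro)
      (use that P kstar ran X_child Y_parent Y_child in auto)
  show ?thesis
  proof (intro conjI impI)
    assume a: "(\<forall>e\<in>E. lo_le (B e) (C e)) \<and> (\<forall>n\<in>N. st_le (F n) (G n))"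
    then have "\<forall>n\<in>N. \<forall>x. G n x \<le> F n x" using st_le_imp_ge[OF F G] by blast
    note le = this
    show "ism_le b N M X M' Y"
      unfolding ism_le_def ism_le_vec_def
    proof (intro ballI impI)
      fix J f
      assume J: "J \<in> compared_index_sets N" and f: "f \<in> borel_measurable (borel_vec J)"
        and p: "weight_bounded J (b J) f \<and> supermodular J f \<and> mono_on (space (borel_vec J)) f"
      note wb = conjunct1[OF p] and sm = conjunct1[OF conjunct2[OF p]] and m = conjunct2[OF conjunct2[OF p]]
      show "(LINT w|M. f (subvector J X w)) \<le> (LINT w|M'. f (subvector J Y w))"
        by (rule model_comparison.compare_integrable[OF comparison[OF conjunct1[OF a]] finite_sub[OF J] f sm _ int[OF J f wb]])
          (use m le in blast)
    qed
  next
    assume a: "(\<forall>e\<in>E. lo_le (B e) (C e)) \<and> (\<forall>n\<in>N. st_le (G n) (F n))"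
    then have "\<forall>n\<in>N. \<forall>x. F n x \<le> G n x" using st_le_imp_ge[OF G F] by blast
    note le = this
    show "dsm_le b N M X M' Y"
      unfolding dsm_le_def dsm_le_vec_def
    proof (intro ballI impI)
      fix J f
      assume J: "J \<in> compared_index_sets N" and f: "f \<in> borel_measurable (borel_vec J)"
        and p: "weight_bounded J (b J) f \<and> supermodular J f \<and> antimono_on (space (borel_vec J)) f"
      note wb = conjunct1[OF p] and sm = conjunct1[OF conjunct2[OF p]] and m = conjunct2[OF conjunct2[OF p]]
      show "(LINT w|M. f (subvector J X w)) \<le> (LINT w|M'. f (subvector J Y w))"
        by (rule model_comparison.compare_integrable[OF comparison[OF conjunct1[OF a]] finite_sub[OF J] f sm _ int[OF J f wb]])
          (use m le in blast)
    qed
  qed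
qed

end
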